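(* Let $v\in L^2(\Omega)$, let $f=0$ and $v_h=P_hv$, and let $u_h$ be the semidiscrete solution, i.e. $\partial_t^\alpha u_h(t)+A_hu_h(t)=0$ for $t>0$, $u_h(0)=v_h$. Let $(U_h^n)_{n=0}^N$, $U_h^n\equiv U_h^{n,M_n}$, be produced by the incomplete iterative scheme (defined in the context) with $f=0$, this $v_h$, with exact solves $U_h^n=\overline U_h^n$ for $n=1,2$, and with an iterative solver satisfying the contraction property with constants $c_0>0$, $\kappa\in(0,1)$. Let $\ell_n=\ln(1+t_n/\tau)$. Then there exists a $\delta>0$ such that, if $$c_0\kappa^{M_n}\le\delta\,\min(t_n,1)\,\ell_n^{-1}$$ (at all time levels $n\ge 3$), then for $n=1,\dots,N$ $$\|U_h^n-u_h(t_n)\|_{L^2(\Omega)}\le c\,\tau\, t_n^{-1}\,\ell_n\,\|v\|_{L^2(\Omega)},$$ where $\delta$ and $c$ are independent of $h$ and $\tau$ (and of $v$ and $n$).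
   Context: Setting: $\Omega\subset\mathbb R^d$ ($d=1,2,3$) is a convex polyhedral domain, $T>0$, $\alpha\in(0,1)$. $\partial_t^\alpha u(t)=\frac1{\Gamma(1-\alpha)}\int_0^t(t-s)^{-\alpha}u'(s)\,ds$ is the Caputo derivative. Space discretization: $\mathcal T_h$ is a shape regular quasi-uniform triangulation of $\Omega$ into $d$-simplexes with mesh size $h$; $X_h\subset H_0^1(\Omega)$ is the space of continuous piecewise linear functions on $\mathcal T_h$ vanishing on $\partial\Omega$. $P_h:L^2(\Omega)\to X_h$ is the $L^2(\Omega)$-orthogonal projection; $A_h:X_h\to X_h$ is defined by $(A_h\varphi_h,\chi)=(\nabla\varphi_h,\nabla\chi)$ for all $\varphi_h,\chi\in X_h$. Time discretization: $\tau=T/N$, $t_n=n\tau$, $n=0,\dots,N$. The weights $b_j^{(\alpha)}$ are given by $(1-\xi)^\alpha=\sum_{j\ge0}b_j^{(\alpha)}\xi^j$. Put $f_h^n=P_hf(t_n)$. Incomplete iterative scheme: $U_h^0=v_h\in X_h$. Given $U_h^0,\dots,U_h^{n-1}$, let $\overline U_h^n\in X_h$ be the exact solution of $$(I+\tau^\alpha A_h)\overline U_h^n=\tau^\alpha f_h^n-\sum_{j=1}^nb_j^{(\alpha)}U_h^{n-j}+\sum_{j=0}^nb_j^{(\alpha)}U_h^0 .$$ For $n\ge2$ the starting guess is $U_h^{n,0}=2U_h^{n-1}-U_h^{n-2}$; an iterative solver produces from it a sequence $U_h^{n,m}\in X_h$, $m\ge 1$, of approximations of $\overline U_h^n$, and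 one sets $U_h^n=U_h^{n,M_n}$ for a chosen $M_n\in\mathbb N$ (at levels where an exact solve is prescribed, $U_h^n=\overline U_h^n$). Contraction property: with the norm $|\psi|=\|(I+\tau^\alpha A_h)^{1/2}\psi\|_{L^2(\Omega)}$ on $X_h$, there are $\kappa\in(0,1)$ and $c_0>0$ such that $|U_h^{n,m}-\overline U_h^n|\le c_0\kappa^m|U_h^{n,0}-\overline U_h^n|$ for all $m\ge1$ (at every level $n$ where the solver is used). *)

theory Defs
  imports "HOL-Analysis.Analysis"
begin

section \<open>Domain and meshes\<close>

text \<open>Polytopes are bounded, and a nonempty open convex set is the interior of its closure.\<close>

definition convex_polyhedral_domain :: "'a::euclidean_space set \<Rightarrow> bool" where
  "convex_polyhedral_domain \<Omega> \<longleftrightarrow>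
     open \<Omega> \<and> convex \<Omega> \<and> \<Omega> \<noteq> {} \<and> polytope (closure \<Omega>)"

text \<open>Only the cells of full dimension belong to the mesh; \<^const>\<open>triangulation\<close> says that
  any two of them meet in a common (possibly empty) face.\<close>

definition mesh_of :: "'a::euclidean_space set \<Rightarrow> 'a set set \<Rightarrow> bool" where
  "mesh_of \<Omega> \<T> \<longleftrightarrow>
     triangulation \<T> \<and> (\<forall>K\<in>\<T>. int DIM('a) simplex K) \<and> \<Union>\<T> = closure \<Omega>"

definition mesh_size :: "'a::euclidean_space set set \<Rightarrow> real" where
  "mesh_size \<T> = Max (diameter ` \<T>)"

definition inball_diameter :: "'a::euclidean_space set \<Rightarrow> real" where
  "inball_diameter K = 2 * Sup {r. 0 \<le> r \<and> (\<exists>x. cball x r \<subseteq> K)}"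

text \<open>Both properties concern a whole family of meshes: the constants do not depend on
  the member of the family.\<close>

definition shape_regular :: "'a::euclidean_space set set set \<Rightarrow> bool" where
  "shape_regular \<M> \<longleftrightarrow> (\<exists>\<sigma>. \<forall>\<T>\<in>\<M>. \<forall>K\<in>\<T>. diameter K \<le> \<sigma> * inball_diameter K)"

definition quasi_uniform :: "'a::euclidean_space set set set \<Rightarrow> bool" where
  "quasi_uniform \<M> \<longleftrightarrow> (\<exists>\<gamma>. \<forall>\<T>\<in>\<M>. \<forall>K\<in>\<T>. mesh_size \<T> \<le> \<gamma> * diameter K)"


section \<open>The finite element space and its operators\<close>

definition L2 :: "'a::euclidean_space set \<Rightarrow> ('a \<Rightarrow> real) set" where
  "L2 \<Omega> = {v. v \<in> borel_measurable (lebesgue_on \<Omega>) \<and>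
             integrable (lebesgue_on \<Omega>) (\<lambda>x. (v x)\<^sup>2)}"

definition L2_inner :: "'a::euclidean_space set \<Rightarrow> ('a \<Rightarrow> real) \<Rightarrow> ('a \<Rightarrow> real) \<Rightarrow> real" where
  "L2_inner \<Omega> v w = (\<integral>x. v x * w x \<partial>lebesgue_on \<Omega>)"

definition L2_norm :: "'a::euclidean_space set \<Rightarrow> ('a \<Rightarrow> real) \<Rightarrow> real" where
  "L2_norm \<Omega> v = sqrt (L2_inner \<Omega> v v)"

text \<open>Members of the space \<open>X\<^sub>h\<close> are extended by zero to the whole space, so that two of them
  are equal as HOL functions iff they agree on the closure of the domain.\<close>

definition fe_space :: "'a::euclidean_space set \<Rightarrow> 'a set set \<Rightarrow> ('a \<Rightarrow> real) set" where
  "fe_space \<Omega> \<T> = {\<phi>. continuous_on (closure \<Omega>) \<phi> \<and>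
                     (\<forall>K\<in>\<T>. \<exists>a b. \<forall>x\<in>K. \<phi> x = a \<bullet> x + b) \<and>
                     (\<forall>x. x \<notin> \<Omega> \<longrightarrow> \<phi> x = 0)}"

text \<open>The classical gradient. A function in \<open>X\<^sub>h\<close> is differentiable in the interior of every
  simplex, so this is its weak gradient almost everywhere.\<close>

definition grad :: "('a::euclidean_space \<Rightarrow> real) \<Rightarrow> 'a \<Rightarrow> 'a" where
  "grad \<phi> x = (\<Sum>i\<in>Basis. frechet_derivative \<phi> (at x) i *\<^sub>R i)"

definition dirichlet_form :: "'a::euclidean_space set \<Rightarrow> ('a \<Rightarrow> real) \<Rightarrow> ('a \<Rightarrow> real) \<Rightarrow> real" where
  "dirichlet_form \<Omega> \<phi> \<eta> = (\<integral>x. grad \<phi> x \<bullet> grad \<eta> x \<partial>lebesgue_on \<Omega>)"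

definition L2_projection :: "'a::euclidean_space set \<Rightarrow> 'a set set \<Rightarrow> ('a \<Rightarrow> real) \<Rightarrow> 'a \<Rightarrow> real" where
  "L2_projection \<Omega> \<T> v =
     (THE \<phi>. \<phi> \<in> fe_space \<Omega> \<T> \<and>
        (\<forall>\<eta>\<in>fe_space \<Omega> \<T>. L2_inner \<Omega> \<phi> \<eta> = L2_inner \<Omega> v \<eta>))"

definition A_h :: "'a::euclidean_space set \<Rightarrow> 'a set set \<Rightarrow> ('a \<Rightarrow> real) \<Rightarrow> 'a \<Rightarrow> real" where
  "A_h \<Omega> \<T> \<phi> =
     (THE \<psi>. \<psi> \<in> fe_space \<Omega> \<T> \<and>
        (\<forall>\<eta>\<in>fe_space \<Omega> \<T>. L2_inner \<Omega> \<psi> \<eta> = dirichlet_form \<Omega> \<phi> \<eta>))"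

text \<open>\<open>S\<close> is the positive semidefinite self-adjoint square root of \<open>B\<close> on \<open>X\<^sub>h\<close>.\<close>

definition is_sqrt_on ::
  "'a::euclidean_space set \<Rightarrow> ('a \<Rightarrow> real) set \<Rightarrow>
   (('a \<Rightarrow> real) \<Rightarrow> 'a \<Rightarrow> real) \<Rightarrow> (('a \<Rightarrow> real) \<Rightarrow> 'a \<Rightarrow> real) \<Rightarrow> bool" where
  "is_sqrt_on \<Omega> X B S \<longleftrightarrow>
     (\<forall>\<phi>\<in>X. S \<phi> \<in> X) \<and>
     (\<forall>\<phi>\<in>X. \<forall>\<eta>\<in>X. \<forall>a b. S (\<lambda>x. a * \<phi> x + b * \<eta> x) = (\<lambda>x. a * S \<phi> x + b * S \<eta> x)) \<and>
     (\<forall>\<phi>\<in>X. \<forall>\<eta>\<in>X. L2_inner \<Omega> (S \<phi>) \<eta> = L2_inner \<Omega> \<phi> (S \<eta>)) \<and>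
     (\<forall>\<phi>\<in>X. 0 \<le> L2_inner \<Omega> (S \<phi>) \<phi>) \<and>
     (\<forall>\<phi>\<in>X. S (S \<phi>) = B \<phi>)"

text \<open>The root is unique on \<open>X\<close> only; its values elsewhere are irrelevant, hence the
  choice operator.\<close>

definition sqrt_on ::
  "'a::euclidean_space set \<Rightarrow> ('a \<Rightarrow> real) set \<Rightarrow>
   (('a \<Rightarrow> real) \<Rightarrow> 'a \<Rightarrow> real) \<Rightarrow> ('a \<Rightarrow> real) \<Rightarrow> 'a \<Rightarrow> real" where
  "sqrt_on \<Omega> X B = (SOME S. is_sqrt_on \<Omega> X B S)"

text \<open>The operator \<open>I + \<tau>\<^sup>\<alpha> A\<^sub>h\<close> and the norm given by its square root.\<close>

definition step_op ::
  "'a::euclidean_space set \<Rightarrow> 'a set set \<Rightarrow> real \<Rightarrow> real \<Rightarrow> ('a \<Rightarrow> real) \<Rightarrow> 'a \<Rightarrow> real" where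
  "step_op \<Omega> \<T> \<alpha> \<tau> \<psi> = (\<lambda>x. \<psi> x + \<tau> powr \<alpha> * A_h \<Omega> \<T> \<psi> x)"

definition energy_norm ::
  "'a::euclidean_space set \<Rightarrow> 'a set set \<Rightarrow> real \<Rightarrow> real \<Rightarrow> ('a \<Rightarrow> real) \<Rightarrow> real" where
  "energy_norm \<Omega> \<T> \<alpha> \<tau> \<psi> =
     L2_norm \<Omega> (sqrt_on \<Omega> (fe_space \<Omega> \<T>) (step_op \<Omega> \<T> \<alpha> \<tau>) \<psi>)"


section \<open>The semidiscrete problem\<close>

definition caputo :: "real \<Rightarrow> (real \<Rightarrow> real) \<Rightarrow> real \<Rightarrow> real" where
  "caputo \<alpha> u t =
     1 / Gamma (1 - \<alpha>) * (LBINT s:{0<..<t}. (t - s) powr (- \<alpha>) * deriv u s)"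

text \<open>Since \<open>X\<^sub>h\<close> is finite dimensional, continuity, differentiability and the Caputo
  derivative of an \<open>X\<^sub>h\<close>-valued function of time may be taken at each point of space.
  The solution need not be differentiable at time 0, where its derivative behaves like
  \<open>t powr (\<alpha> - 1)\<close>. Integrability is demanded explicitly because the Lebesgue integral of a
  nonintegrable function is 0 in HOL.\<close>

definition semidiscrete_solution ::
  "'a::euclidean_space set \<Rightarrow> 'a set set \<Rightarrow> real \<Rightarrow> ('a \<Rightarrow> real) \<Rightarrow> (real \<Rightarrow> 'a \<Rightarrow> real) \<Rightarrow> bool" where
  "semidiscrete_solution \<Omega> \<T> \<alpha> v\<^sub>h u \<longleftrightarrow>
     (\<forall>t\<ge>0. u t \<in> fe_space \<Omega> \<T>) \<and>
     u 0 = v\<^sub>h \<and>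
     (\<forall>x. continuous_on {0..} (\<lambda>t. u t x)) \<and>
     (\<forall>x. \<forall>t>0. (\<lambda>s. u s x) differentiable (at t)) \<and>
     (\<forall>x. \<forall>t>0. set_integrable lborel {0<..<t}
                  (\<lambda>s. (t - s) powr (- \<alpha>) * deriv (\<lambda>r. u r x) s)) \<and>
     (\<forall>t>0. \<forall>x. caputo \<alpha> (\<lambda>s. u s x) t + A_h \<Omega> \<T> (u t) x = 0)"


section \<open>The incomplete iterative scheme\<close>

definition cq_weight :: "real \<Rightarrow> nat \<Rightarrow> real" where
  "cq_weight \<alpha> =
     (THE b. \<forall>\<xi>. \<bar>\<xi>\<bar> < 1 \<longrightarrow> (\<lambda>j. b j * \<xi> ^ j) sums ((1 - \<xi>) powr \<alpha>))"

lemma cq_weight_eq: "cq_weight \<alpha> j = (-1) ^ j * (\<alpha> gchoose j)"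
proof -
  define g where "g = (\<lambda>j::nat. (-1) ^ j * (\<alpha> gchoose j))"
  have g: "(\<lambda>j. g j * \<xi> ^ j) sums ((1 - \<xi>) powr \<alpha>)" if "\<bar>\<xi>\<bar> < 1" for \<xi>
    using gen_binomial_real[of "- \<xi>" \<alpha>] that
    by (simp add: g_def power_minus[of \<xi>] mult_ac)
  have uniq: "b = g"
    if b: "\<forall>\<xi>. \<bar>\<xi>\<bar> < 1 \<longrightarrow> (\<lambda>j. b j * \<xi> ^ j) sums ((1 - \<xi>) powr \<alpha>)" for b :: "nat \<Rightarrow> real"
  proof -
    define d where "d = (\<lambda>j. b j - g j)"
    have d: "(\<lambda>j. d j * \<xi> ^ j) sums 0" if "\<bar>\<xi>\<bar> < 1" for \<xi>
      using sums_diff[OF b[rule_format, OF that] g[OF that]]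
      by (simp add: d_def left_diff_distrib)
    have "d n = 0" for n
    proof (induction n rule: less_induct)
      case (less n)
      have "(\<lambda>j. d (j + n) * \<xi> ^ j) sums 0" if "\<xi> \<noteq> 0" "norm \<xi> < 1" for \<xi> :: real
      proof -
        have "(\<lambda>j. d (j + n) * \<xi> ^ (j + n)) sums 0"
          using d[of \<xi>] that less.IH
          by (subst sums_zero_iff_shift[where f = "\<lambda>j. d j * \<xi> ^ j"]) auto
        then have "(\<lambda>j. d (j + n) * \<xi> ^ (j + n) / \<xi> ^ n) sums (0 / \<xi> ^ n)"
          by (rule sums_divide)
        then show ?thesis
          using that by (simp add: power_add)
      qed
      then have "((\<lambda>\<xi>::real. 0) \<longlongrightarrow> d (0 + n)) (at 0)"
        by (intro powser_limit_0_strong[of 1 "\<lambda>j. d (j + n)"]) auto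
      then show "d n = 0"
        by (simp add: tendsto_const_iff)
    qed
    then show "b = g"
      by (auto simp: d_def fun_eq_iff)
  qed
  have "cq_weight \<alpha> = g"
    unfolding cq_weight_def using g uniq by (intro the_equality) auto
  then show ?thesis
    by (simp add: g_def)
qed

text \<open>\<open>w\<close> solves the time stepping equation at level \<open>n\<close> exactly, given the earlier values \<open>U\<close>.\<close>

definition exact_step ::
  "'a::euclidean_space set \<Rightarrow> 'a set set \<Rightarrow> real \<Rightarrow> real \<Rightarrow> (real \<Rightarrow> 'a \<Rightarrow> real) \<Rightarrow>
   (nat \<Rightarrow> 'a \<Rightarrow> real) \<Rightarrow> nat \<Rightarrow> ('a \<Rightarrow> real) \<Rightarrow> bool" where
  "exact_step \<Omega> \<T> \<alpha> \<tau> f U n w \<longleftrightarrow>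
     w \<in> fe_space \<Omega> \<T> \<and>
     (\<forall>x. step_op \<Omega> \<T> \<alpha> \<tau> w x =
          \<tau> powr \<alpha> * L2_projection \<Omega> \<T> (f (real n * \<tau>)) x
          - (\<Sum>j=1..n. cq_weight \<alpha> j * U (n - j) x)
          + (\<Sum>j=0..n. cq_weight \<alpha> j * U 0 x))"

text \<open>\<open>Ubar n\<close> is the exact solution and \<open>W n m\<close> the \<open>m\<close>-th iterate at level \<open>n\<close>; the set \<open>E\<close>
  consists of the levels with an exact solve, and \<open>M n\<close> is the number of iterations performed
  at the other levels (at least one). The extrapolated starting guess needs \<open>n \<ge> 2\<close>.\<close>

definition incomplete_scheme ::
  "'a::euclidean_space set \<Rightarrow> 'a set set \<Rightarrow> real \<Rightarrow> real \<Rightarrow> nat \<Rightarrow> (real \<Rightarrow> 'a \<Rightarrow> real) \<Rightarrow>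
   ('a \<Rightarrow> real) \<Rightarrow> nat set \<Rightarrow> (nat \<Rightarrow> 'a \<Rightarrow> real) \<Rightarrow> (nat \<Rightarrow> 'a \<Rightarrow> real) \<Rightarrow>
   (nat \<Rightarrow> nat \<Rightarrow> 'a \<Rightarrow> real) \<Rightarrow> (nat \<Rightarrow> nat) \<Rightarrow> bool" where
  "incomplete_scheme \<Omega> \<T> \<alpha> \<tau> N f v\<^sub>h E U Ubar W M \<longleftrightarrow>
     v\<^sub>h \<in> fe_space \<Omega> \<T> \<and> U 0 = v\<^sub>h \<and>
     (\<forall>n\<in>{1..N}. exact_step \<Omega> \<T> \<alpha> \<tau> f U n (Ubar n)) \<and>
     (\<forall>n\<in>{1..N} \<inter> E. U n = Ubar n) \<and>
     (\<forall>n\<in>{1..N} - E.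
        (2 \<le> n \<longrightarrow> W n 0 = (\<lambda>x. 2 * U (n - 1) x - U (n - 2) x)) \<and>
        (\<forall>m\<ge>1. W n m \<in> fe_space \<Omega> \<T>) \<and>
        1 \<le> M n \<and> U n = W n (M n))"

definition contraction_property ::
  "'a::euclidean_space set \<Rightarrow> 'a set set \<Rightarrow> real \<Rightarrow> real \<Rightarrow> nat \<Rightarrow> nat set \<Rightarrow> real \<Rightarrow> real \<Rightarrow>
   (nat \<Rightarrow> 'a \<Rightarrow> real) \<Rightarrow> (nat \<Rightarrow> nat \<Rightarrow> 'a \<Rightarrow> real) \<Rightarrow> bool" where
  "contraction_property \<Omega> \<T> \<alpha> \<tau> N E c\<^sub>0 \<kappa> Ubar W \<longleftrightarrow>
     (\<forall>n\<in>{1..N} - E. \<forall>m\<ge>1.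
        energy_norm \<Omega> \<T> \<alpha> \<tau> (\<lambda>x. W n m x - Ubar n x)
        \<le> c\<^sub>0 * \<kappa> ^ m * energy_norm \<Omega> \<T> \<alpha> \<tau> (\<lambda>x. W n 0 x - Ubar n x))"

end

theory Submission
  imports Defs "HOL-Complex_Analysis.Complex_Analysis"
begin

text \<open>
  In an \<open>L\<^sup>2\<close>-orthonormal eigenbasis of \<open>A\<^sub>h\<close> everything reduces to the scalar problem with
  \<open>\<mu> = \<lambda> \<tau>\<^sup>\<alpha> \<ge> 0\<close>, and all bounds must be uniform in \<open>\<mu>\<close>. They come from one identity: the function
  \<open>1 / (s\<^sup>\<alpha> + \<mu>)\<close> is the Stieltjes transform of an explicit nonnegative density \<open>q\<close>. Expanding in
  \<open>\<xi> = 1 - s\<close> shows that the solution operators of the time stepping scheme are the moments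
  \<open>\<integral> q(r) (1 + r)\<^sup>-\<^sup>j\<^sup>-\<^sup>1 dr\<close>, while the semidiscrete solution is the Laplace transform of
  \<open>\<mu> q(r) / r\<close>. The exact scheme is therefore off by at most \<open>sup\<^sub>r |(1 + r)\<^sup>-\<^sup>n - e\<^sup>-\<^sup>n\<^sup>r| \<le> 2 / n\<close>.

  The solver errors \<open>\<epsilon>\<^sub>k\<close> enter the scheme as perturbations with bounded solution operators. The
  extrapolated starting guess is a second difference away from the new value; second differences
  are \<open>O(n\<^sup>-\<^sup>2)\<close> for the exact scheme, and the earlier perturbations enter them through a kernel
  of size \<open>O((n - k + 1)\<^sup>-\<^sup>2)\<close>. For small \<open>\<delta>\<close> induction yields \<open>|\<epsilon>\<^sub>n| \<le> \<tau> n\<^sup>-\<^sup>1 \<parallel>v\<parallel>\<close>, and summing these over the time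
  levels produces the logarithm.
\<close>

section \<open>The Stieltjes representation of the resolvent symbol\<close>

text \<open>The contraction acts in the energy norm, whose square carries the weight
  \<open>1 + \<mu>\<close>, while the initial value is controlled in \<open>L2\<close> only. Hence
  the second difference of the exact scheme must absorb \<open>sqrt (1 + \<mu>)\<close> uniformly in
  \<mu>. At level 2 this fails: the second difference still contains the raw initial value and grows
  like \<open>sqrt \<mu>\<close> in the energy norm. From level 3 on a spare power of
  \<open>1 / (1 + r)\<close> is available, which is why levels 1 and 2 are solved exactly. The
  factors in the bound on \<open>c\<^sub>0 * \<kappa> ^ M n\<close> have separate roles: the time
  \<open>n \<tau>\<close> turns \<open>n^-2\<close> into \<open>\<tau> / n\<close>, the inverse
  logarithm pays for the sum over the earlier errors, and the cap 1 with a small \<delta> absorbs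
  the current error, which enters its own starting error. The substitution \<open>r = exp x\<close>
  moves the branch cut to the lines \<open>Im z = pi\<close> and \<open>Im z = - pi\<close>, so a
  rectangle replaces a keyhole contour. The semidiscrete solution is given by its equation alone; a
  uniqueness argument has to identify it with the integral.\<close>

text \<open>The point \<open>- \<mu>\<close> lies on the nonpositive half-line. The distance from
  \<open>exp w\<close> to that half-line is the full modulus if \<open>0 \<le> c\<close>, and the
  modulus of the imaginary part otherwise; in the second case \<open>\<bar>Im w\<bar>\<close> lies
  between \<open>pi / 2\<close> and \<open>pi * \<alpha>\<close>, where the sine decreases.\<close>

lemma norm_add_nonneg_ge_sin:
  fixes w :: complex and \<alpha> \<mu> :: real
  assumes "0 < \<alpha>" "\<alpha> < 1" "0 \<le> \<mu>" "\<bar>Im w\<bar> \<le> pi * \<alpha>"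
  shows "exp (Re w) * sin (pi * \<alpha>) \<le> norm (exp w + of_real \<mu>)"
proof -
  define c where "c = cos (Im w)"
  have sp: "0 < sin (pi * \<alpha>)" using assms by (intro sin_gt_zero) auto
  have cge: "cos (pi * \<alpha>) \<le> c"
    using cos_monotone_0_pi_le[of "\<bar>Im w\<bar>" "pi * \<alpha>"] assms by (simp add: c_def)
  have "(exp (Re w) * sin (pi * \<alpha>))\<^sup>2 \<le> (exp (Re w) * c + \<mu>)\<^sup>2 + (exp (Re w) * sin (Im w))\<^sup>2"
  proof (cases "0 \<le> c")
    case True
    have "(exp (Re w) * sin (pi * \<alpha>))\<^sup>2 \<le> (exp (Re w))\<^sup>2 * 1"
      unfolding power_mult_distrib by (intro mult_left_mono) (auto simp: abs_square_le_1)
    also have "\<dots> = (exp (Re w) * c)\<^sup>2 + (exp (Re w) * sin (Im w))\<^sup>2"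
      by (simp add: c_def power_mult_distrib flip: distrib_left)
    also have "(exp (Re w) * c)\<^sup>2 \<le> (exp (Re w) * c + \<mu>)\<^sup>2"
      using True assms by (intro power_mono) auto
    finally show ?thesis by simp
  next
    case False
    have "c\<^sup>2 \<le> (cos (pi * \<alpha>))\<^sup>2"
      using cge False by (simp add: abs_le_square_iff[symmetric])
    hence "(sin (pi * \<alpha>))\<^sup>2 \<le> (sin (Im w))\<^sup>2"
      by (simp add: sin_squared_eq c_def)
    hence "(exp (Re w) * sin (pi * \<alpha>))\<^sup>2 \<le> (exp (Re w) * sin (Im w))\<^sup>2"
      unfolding power_mult_distrib by (intro mult_left_mono) auto
    thus ?thesis by (smt (verit) zero_le_power2)
  qed
  also have "\<dots> = (norm (exp w + of_real \<mu>))\<^sup>2"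
    by (simp add: cmod_power2 Re_exp Im_exp c_def)
  finally show ?thesis
    using sp by (simp add: abs_le_square_iff[symmetric])
qed

lemma add_Complex: "complex_of_real x + Complex 0 c = Complex x c"
  by (simp add: complex_eq_iff)

lemma contour_integral_linepath_horizontal:
  fixes a b c :: real
  assumes "a < b"
  shows "contour_integral (linepath (Complex a c) (Complex b c)) f = integral {a..b} (\<lambda>x. f (Complex x c))"
proof -
  have eq: "linepath (Complex a c) (Complex b c) = (+) (Complex 0 c) \<circ> linepath (of_real a) (of_real b)"
    by (auto simp: fun_eq_iff linepath_def complex_eq_iff algebra_simps)
  show ?thesis
    unfolding eq contour_integral_translate
    using assms by (subst contour_integral_linepath_Reals_eq) (auto simp: o_def add_Complex)
qed

text \<open>The density in the variable \<open>x = ln r\<close>, so the factor \<open>exp x\<close> is the Jacobian.\<close>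

definition res_density :: "real \<Rightarrow> real \<Rightarrow> real \<Rightarrow> real" where
  "res_density \<alpha> \<mu> x =
     sin (pi * \<alpha>) / pi * exp (\<alpha> * x) * exp x /
     ((exp (\<alpha> * x))\<^sup>2 + 2 * \<mu> * exp (\<alpha> * x) * cos (pi * \<alpha>) + \<mu>\<^sup>2)"

text \<open>The denominator of the density is the squared modulus of
  \<open>exp (\<alpha> z) + \<mu>\<close> on the line \<open>Im z = pi\<close>, so the sector bound
  applies to it.\<close>

lemma res_denom_eq:
  "(exp (\<alpha> * x))\<^sup>2 + 2 * \<mu> * exp (\<alpha> * x) * cos (pi * \<alpha>) + \<mu>\<^sup>2
   = (norm (exp (Complex (\<alpha> * x) (pi * \<alpha>)) + of_real \<mu>))\<^sup>2"
proof -
  have "(exp (\<alpha> * x) * sin (pi * \<alpha>))\<^sup>2 = (exp (\<alpha> * x))\<^sup>2 - (exp (\<alpha> * x) * cos (pi * \<alpha>))\<^sup>2"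
    by (simp add: power_mult_distrib sin_squared_eq algebra_simps)
  then show ?thesis
    by (simp add: cmod_power2 Re_exp Im_exp power2_sum)
qed

context
  fixes \<alpha> \<mu> :: real
  assumes \<alpha>: "0 < \<alpha>" "\<alpha> < 1" and \<mu>: "0 \<le> \<mu>"
begin

lemma sin_pi_pos: "0 < sin (pi * \<alpha>)"
  using \<alpha> by (intro sin_gt_zero) auto

lemma res_denom_ge1: "(exp (\<alpha> * x) * sin (pi * \<alpha>))\<^sup>2 \<le> (exp (\<alpha> * x))\<^sup>2 + 2 * \<mu> * exp (\<alpha> * x) * cos (pi * \<alpha>) + \<mu>\<^sup>2"
  unfolding res_denom_eq
  using norm_add_nonneg_ge_sin[of \<alpha> \<mu> "Complex (\<alpha> * x) (pi * \<alpha>)"] \<alpha> \<mu> sin_pi_pos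
  by (intro power_mono) auto

text \<open>Completing the square in \<open>exp (\<alpha> * x)\<close> leaves a multiple of the
  square of \<mu>. This is what absorbs the additional factor \<mu> in
  \<open>relax_factor_diff2\<close>.\<close>

lemma res_denom_ge2: "(\<mu> * sin (pi * \<alpha>))\<^sup>2 \<le> (exp (\<alpha> * x))\<^sup>2 + 2 * \<mu> * exp (\<alpha> * x) * cos (pi * \<alpha>) + \<mu>\<^sup>2"
proof -
  have "(exp (\<alpha> * x))\<^sup>2 + 2 * \<mu> * exp (\<alpha> * x) * cos (pi * \<alpha>) + \<mu>\<^sup>2
     = (exp (\<alpha> * x) + \<mu> * cos (pi * \<alpha>))\<^sup>2 + (\<mu> * sin (pi * \<alpha>))\<^sup>2"
    by (simp add: power2_sum power_mult_distrib sin_squared_eq algebra_simps)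
  then show ?thesis by simp
qed

lemma res_denom_pos: "0 < (exp (\<alpha> * x))\<^sup>2 + 2 * \<mu> * exp (\<alpha> * x) * cos (pi * \<alpha>) + \<mu>\<^sup>2"
  using res_denom_ge1[of x] sin_pi_pos by (smt (verit) exp_gt_zero mult_pos_pos zero_less_power)

lemma res_density_nonneg: "0 \<le> res_density \<alpha> \<mu> x"
  unfolding res_density_def using sin_pi_pos res_denom_pos[of x] by (intro divide_nonneg_pos) auto

lemma res_density_continuous: "continuous_on A (res_density \<alpha> \<mu>)"
  unfolding res_density_def using res_denom_pos
  by (intro continuous_intros) (auto, metis less_irrefl)

lemma res_density_measurable [measurable]: "res_density \<alpha> \<mu> \<in> borel_measurable borel"
  using res_density_continuous[of UNIV] by (rule borel_measurable_continuous_onI)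

text \<open>The residue theorem for \<open>e\<^sup>z / ((e\<^sup>\<alpha>\<^sup>z + \<mu>) (e\<^sup>z - s))\<close> on the rectangle with corners \<open>\<plusminus>R \<plusminus> \<i>\<pi>\<close>. In
  the strip \<open>|Im z| \<le> \<pi>\<close> the only pole is \<open>ln s\<close>, and \<open>e\<^sup>z\<close> takes the same value \<open>- e\<^sup>x\<close> on both
  horizontal sides, whose difference is the density. The bound is that of the vertical sides.\<close>

lemma res_contour:
  assumes s: "0 < s" and n: "\<bar>ln s\<bar> < R"
  shows "norm (integral {-R..R} (\<lambda>x. res_density \<alpha> \<mu> x / (s + exp x)) - 1 / (s powr \<alpha> + \<mu>))
      \<le> exp (-R) / ((s - exp (-R)) * (exp (- \<alpha> * R) * sin (pi * \<alpha>)))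
       + exp R / ((exp R - s) * (exp (\<alpha> * R) * sin (pi * \<alpha>)))"
proof -
  \<comment> \<open>Since \<open>\<alpha> < 1\<close>, both conditions describe open neighbourhoods
    of the closed strip of half-width \<open>pi\<close>. The first keeps
    \<open>exp (\<alpha> z)\<close> off the nonpositive reals, so the denominator of
    \<open>g\<close> has no zero; the second leaves \<open>ln s\<close> as the only zero of
    \<open>h\<close>.\<close>
  define S where "S = {z. \<alpha> * \<bar>Im z\<bar> < pi} \<inter> {z. \<bar>Im z\<bar> < 2 * pi}"
  define g where "g = (\<lambda>z::complex. exp z / (exp (of_real \<alpha> * z) + of_real \<mu>))"
  define h where "h = (\<lambda>z::complex. exp z - of_real s)"
  define f where "f = (\<lambda>z. g z / h z)"
  define c :: complex where "c = of_real (ln s)"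
  have sp: "0 < sin (pi * \<alpha>)" by (rule sin_pi_pos)
  have R: "R > 0" using n by auto
  have nz: "exp (of_real \<alpha> * z) + of_real \<mu> \<noteq> 0" if "\<alpha> * \<bar>Im z\<bar> < pi" for z :: complex
  proof
    assume "exp (of_real \<alpha> * z) + of_real \<mu> = 0"
    hence e: "exp (of_real \<alpha> * z) = of_real (-\<mu>)" by (simp add: add_eq_0_iff)
    have "sin (\<alpha> * Im z) = 0"
      using arg_cong[OF e, of Im] by (simp add: Im_exp)
    moreover have "\<bar>\<alpha> * Im z\<bar> < pi" using that \<alpha> by (simp add: abs_mult)
    ultimately have "\<alpha> * Im z = 0"
      by (smt (verit) sin_gt_zero sin_minus)
    hence "cos (\<alpha> * Im z) = 1" by (simp only: cos_zero)
    hence "0 < exp (\<alpha> * Re z) * cos (\<alpha> * Im z)" by simp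
    moreover have "exp (\<alpha> * Re z) * cos (\<alpha> * Im z) = -\<mu>"
      using arg_cong[OF e, of Re] by (simp add: Re_exp)
    ultimately show False using \<mu> by simp
  qed
  have hz: "h z = 0 \<longleftrightarrow> z = c" if "\<bar>Im z\<bar> < 2 * pi" for z
  proof
    assume "h z = 0"
    hence "exp z = exp c" using s by (simp add: h_def c_def exp_of_real)
    then obtain k :: int where k: "z = c + of_int (2 * k) * of_real pi * \<i>"
      by (auto simp: exp_eq)
    hence "Im z = 2 * k * pi" by (simp add: c_def)
    hence "\<bar>real_of_int k\<bar> < 1" using that by (simp add: abs_mult)
    hence "k = 0" by linarith
    thus "z = c" using k by simp
  qed (use s in \<open>simp add: h_def c_def exp_of_real\<close>)
  have openS: "open S" unfolding S_def by (intro open_Int open_Collect_less continuous_intros)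
  have convS: "convex S"
  proof -
    have "S = {z. Im z < pi / \<alpha>} \<inter> {z. Im z > - (pi / \<alpha>)} \<inter> ({z. Im z < 2 * pi} \<inter> {z. Im z > - (2 * pi)})"
    proof -
      have *: "\<alpha> * \<bar>y\<bar> < pi \<longleftrightarrow> \<bar>y\<bar> < pi / \<alpha>" for y
        using \<alpha> by (simp add: pos_less_divide_eq mult.commute)
      show ?thesis unfolding S_def * abs_less_iff by auto
    qed
    thus ?thesis
      by (simp only:) (intro convex_Int convex_halfspace_Im_lt convex_halfspace_Im_gt)
  qed
  have holg: "g holomorphic_on S" unfolding g_def S_def
    by (intro holomorphic_intros) (auto simp: nz)
  have holh: "h holomorphic_on S" unfolding h_def by (intro holomorphic_intros)
  have cS: "c \<in> S" using \<alpha> by (auto simp: S_def c_def)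
  have expc: "exp c = of_real s" using s by (simp add: c_def exp_of_real)
  have expac: "exp (of_real \<alpha> * c) = of_real (s powr \<alpha>)"
    using s by (simp add: c_def powr_def exp_of_real flip: of_real_mult)
  \<comment> \<open>The derivative of \<open>h\<close> at the simple pole is \<open>s\<close>, which
    then cancels the numerator \<open>exp c = s\<close>.\<close>
  have "residue f c = g c / of_real s"
    unfolding f_def
  proof (rule residue_simple_pole_deriv[OF holg holh openS _ cS])
    show "connected S" using convS by (rule convex_connected)
    show "(h has_field_derivative of_real s) (at c)"
      unfolding h_def by (auto intro!: derivative_eq_intros simp: expc)
    show "g c \<noteq> 0" using nz[of c] by (simp add: g_def c_def)
    show "h c = 0" by (simp add: h_def expc)
  qed (use s in auto)
  also have "\<dots> = 1 / of_real (s powr \<alpha> + \<mu>)"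
    using s by (simp add: g_def expc expac)
  finally have res: "residue f c = 1 / of_real (s powr \<alpha> + \<mu>)" .
  define a b where "a = Complex (-R) (-pi)" and "b = Complex R pi"
  have box: "cbox a b \<subseteq> S"
  proof
    fix z assume "z \<in> cbox a b"
    hence le: "\<bar>Im z\<bar> \<le> pi" by (auto simp: a_def b_def in_cbox_complex_iff)
    have "\<alpha> * \<bar>Im z\<bar> \<le> \<alpha> * pi" using \<alpha> le by (intro mult_left_mono) auto
    also have "\<alpha> * pi < pi" using \<alpha> by simp
    finally have "\<alpha> * \<bar>Im z\<bar> < pi" .
    moreover have "\<bar>Im z\<bar> < 2 * pi" using le pi_gt_zero by linarith
    ultimately show "z \<in> S" by (simp add: S_def)
  qed
  have cbox: "c \<in> box a b" using n by (auto simp: a_def b_def c_def in_box_complex_iff)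
  have img: "path_image (rectpath a b) \<subseteq> S - {c}"
    using box cbox R path_image_rectpath_cbox_minus_box[of a b] by (auto simp: a_def b_def)
  have holf: "f holomorphic_on S - {c}" unfolding f_def
    using holg holh hz by (intro holomorphic_on_divide) (auto simp: S_def intro: holomorphic_on_subset)
  have ci: "contour_integral (rectpath a b) f = 2 * pi * \<i> * (1 / of_real (s powr \<alpha> + \<mu>))"
  proof -
    have "contour_integral (rectpath a b) f = 2 * pi * \<i> * (\<Sum>p\<in>{c}. winding_number (rectpath a b) p * residue f p)"
    proof (rule Residue_theorem[OF openS _ _ holf])
      show "connected S" using convS by (rule convex_connected)
      show "\<forall>z. z \<notin> S \<longrightarrow> winding_number (rectpath a b) z = 0"
        using box R by (intro allI impI winding_number_rectpath_outside) (auto simp: a_def b_def)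
    qed (use img in auto)
    also have "(\<Sum>p\<in>{c}. winding_number (rectpath a b) p * residue f p) = winding_number (rectpath a b) c * residue f c"
      by simp
    also have "winding_number (rectpath a b) c = 1"
      using cbox by (rule winding_number_rectpath)
    finally show ?thesis by (simp add: res)
  qed
  have contf: "continuous_on (S - {c}) f" using holf by (rule holomorphic_on_imp_continuous_on)
  define p1 p2 where "p1 = Complex R (-pi)" and "p2 = Complex (-R) pi"
  have pimg: "path_image (rectpath a b) = closed_segment a p1 \<union> closed_segment p1 b \<union> closed_segment b p2 \<union> closed_segment p2 a"
    by (simp add: rectpath_def Let_def a_def b_def p1_def p2_def path_image_join Un_assoc)
  have int: "f contour_integrable_on linepath a p1" "f contour_integrable_on linepath p1 b"
     "f contour_integrable_on linepath b p2" "f contour_integrable_on linepath p2 a"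
    using img contf unfolding pimg
    by (auto intro!: contour_integrable_continuous_linepath intro: continuous_on_subset)
  have split: "contour_integral (rectpath a b) f = contour_integral (linepath a p1) f + contour_integral (linepath p1 b) f
      + contour_integral (linepath b p2) f + contour_integral (linepath p2 a) f"
    using int by (simp add: rectpath_def Let_def a_def b_def p1_def p2_def)
  have bnd: "norm (f z) \<le> exp (Re z) / (\<bar>exp (Re z) - s\<bar> * (exp (\<alpha> * Re z) * sin (pi * \<alpha>)))"
    if "\<bar>Im z\<bar> \<le> pi" "exp (Re z) \<noteq> s" for z
  proof -
    have 1: "exp (\<alpha> * Re z) * sin (pi * \<alpha>) \<le> norm (exp (of_real \<alpha> * z) + of_real \<mu>)"
      using norm_add_nonneg_ge_sin[of \<alpha> \<mu> "of_real \<alpha> * z"] \<alpha> \<mu> that by (simp add: abs_mult mult.commute)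
    have 2: "\<bar>exp (Re z) - s\<bar> \<le> norm (exp z - of_real s)"
      using norm_triangle_ineq3[of "exp z" "of_real s"] s by simp
    have "norm (f z) = exp (Re z) / (norm (exp z - of_real s) * norm (exp (of_real \<alpha> * z) + of_real \<mu>))"
      by (simp add: f_def g_def h_def norm_divide norm_mult mult.commute)
    also have "\<dots> \<le> exp (Re z) / (\<bar>exp (Re z) - s\<bar> * (exp (\<alpha> * Re z) * sin (pi * \<alpha>)))"
      using 1 2 that sp by (intro divide_left_mono mult_mono mult_pos_pos)
       (use 1 2 that sp in \<open>auto intro: less_le_trans[OF _ 1] less_le_trans[OF _ 2] simp del: zero_less_norm_iff\<close>)
    finally show ?thesis .
  qed
  have ers: "exp R > s" using n s by (smt (verit) exp_less_cancel_iff exp_ln)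
  have erm: "exp (-R) < s" using n s by (smt (verit) exp_less_cancel_iff exp_ln)
  \<comment> \<open>Each vertical side has length \<open>2 * pi\<close>. The same factor stands in
    front of the residue, so it cancels from the final bound.\<close>
  define B where "B = (\<lambda>r. exp r / (\<bar>exp r - s\<bar> * (exp (\<alpha> * r) * sin (pi * \<alpha>))))"
  have vert: "norm (contour_integral (linepath (Complex r (- y)) (Complex r y)) f) \<le> B r * (2 * pi)"
    if "f contour_integrable_on linepath (Complex r (- y)) (Complex r y)" "exp r \<noteq> s" "\<bar>y\<bar> = pi" for r y
  proof -
    have "norm (contour_integral (linepath (Complex r (- y)) (Complex r y)) f) \<le> B r * norm (Complex r y - Complex r (- y))"
    proof (rule contour_integral_bound_linepath[OF that(1)])
      show "0 \<le> B r" using sp by (simp add: B_def)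
      show "norm (f z) \<le> B r" if "z \<in> closed_segment (Complex r (- y)) (Complex r y)" for z
        using bnd[of z] that \<open>exp r \<noteq> s\<close> \<open>\<bar>y\<bar> = pi\<close>
        by (auto simp: closed_segment_same_Re closed_segment_eq_real_ivl B_def split: if_splits)
    qed
    also have "Complex r y - Complex r (- y) = Complex 0 (2 * y)" by (simp add: complex_eq_iff)
    also have "norm (Complex 0 (2 * y)) = 2 * pi" using that by (simp add: cmod_eq_Im abs_mult)
    finally show ?thesis .
  qed
  have B1: "norm (contour_integral (linepath p1 b) f) \<le> B R * (2 * pi)"
    unfolding p1_def b_def by (rule vert[of R pi]) (use int ers in \<open>auto simp: p1_def b_def\<close>)
  have B2: "norm (contour_integral (linepath p2 a) f) \<le> B (- R) * (2 * pi)"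
    unfolding p2_def a_def using vert[of "- R" "- pi"] int erm by (simp add: p2_def a_def)
  have i1: "contour_integral (linepath a p1) f = integral {-R..R} (\<lambda>x. f (Complex x (-pi)))"
    unfolding a_def p1_def using R by (intro contour_integral_linepath_horizontal) auto
  have i2: "contour_integral (linepath b p2) f = - integral {-R..R} (\<lambda>x. f (Complex x pi))"
  proof -
    have "contour_integral (linepath b p2) f = - contour_integral (linepath p2 b) f"
      by (metis contour_integral_reversepath reversepath_linepath valid_path_linepath)
    also have "contour_integral (linepath p2 b) f = integral {-R..R} (\<lambda>x. f (Complex x pi))"
      unfolding b_def p2_def using R by (intro contour_integral_linepath_horizontal) auto
    finally show ?thesis .
  qed
  have Ih: "(\<lambda>x. f (Complex x y)) integrable_on {-R..R}" if "y = pi \<or> y = -pi" for y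
  proof (rule integrable_continuous_interval, rule continuous_on_compose2[OF contf])
    show "continuous_on {- R..R} (\<lambda>x. Complex x y)" by (intro continuous_intros)
    show "(\<lambda>x. Complex x y) ` {- R..R} \<subseteq> S - {c}"
    proof (rule image_subsetI)
      fix x assume x: "x \<in> {-R..R}"
      have "Complex x y \<in> cbox a b"
        using x that R by (auto simp: a_def b_def in_cbox_complex_iff)
      moreover have "Complex x y \<noteq> c" using that pi_gt_zero by (auto simp: c_def complex_eq_iff)
      ultimately show "Complex x y \<in> S - {c}" using box by auto
    qed
  qed
  \<comment> \<open>The two values of \<open>exp (\<alpha> z)\<close> are complex conjugate, so the
    jump is \<open>1 / cnj w - 1 / w\<close>, which brings in the sine over the squared modulus of
    \<open>w\<close>.\<close>
  have diff: "f (Complex x (-pi)) - f (Complex x pi) = (2 * pi * \<i>) * of_real (res_density \<alpha> \<mu> x / (s + exp x))" for x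
  proof -
    define w where "w = exp (Complex (\<alpha> * x) (pi * \<alpha>)) + of_real \<mu>"
    have e1: "exp (Complex x pi) = - of_real (exp x)" "exp (Complex x (-pi)) = - of_real (exp x)"
      by (simp_all add: exp_eq_polar complex_eq_iff Re_exp Im_exp)
    have w1: "exp (of_real \<alpha> * Complex x pi) + of_real \<mu> = w"
      by (simp add: w_def complex_eq_iff Re_exp Im_exp mult.commute)
    have w2: "exp (of_real \<alpha> * Complex x (-pi)) + of_real \<mu> = cnj w"
      by (simp add: w_def complex_eq_iff Re_exp Im_exp mult.commute)
    have wn: "w \<noteq> 0" using res_denom_pos[of x] unfolding res_denom_eq w_def[symmetric] by auto
    have fz: "f z = of_real (exp x / (exp x + s)) * (1 / w')"
      if "exp z = - of_real (exp x)" "exp (of_real \<alpha> * z) + of_real \<mu> = w'" for z w'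
    proof -
      have "- complex_of_real (exp x) - of_real s = - of_real (exp x + s)" by simp
      then show ?thesis unfolding f_def g_def h_def that
        by (metis (no_types, lifting) divide_divide_eq_left divide_divide_eq_left' minus_divide_divide mult.commute mult.right_neutral of_real_divide times_divide_eq_right)
    qed
    note f1 = fz[OF e1(1) w1] and f2 = fz[OF e1(2) w2]
    have "1 / cnj w - 1 / w = (w - cnj w) / (w * cnj w)" using wn by (simp add: field_simps)
    also have "w - cnj w = 2 * \<i> * of_real (exp (\<alpha> * x) * sin (pi * \<alpha>))"
      by (simp add: w_def complex_eq_iff Im_exp)
    also have "w * cnj w = of_real ((norm w)\<^sup>2)" by (simp only: complex_norm_square)
    finally have "1 / cnj w - 1 / w = 2 * \<i> * of_real (exp (\<alpha> * x) * sin (pi * \<alpha>) / (norm w)\<^sup>2)"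
      by simp
    hence "f (Complex x (-pi)) - f (Complex x pi)
       = of_real (exp x / (exp x + s)) * (2 * \<i> * of_real (exp (\<alpha> * x) * sin (pi * \<alpha>) / (norm w)\<^sup>2))"
      unfolding f1 f2 by (simp only: right_diff_distrib[symmetric])
    also have "\<dots> = (2 * pi * \<i>) * of_real (exp x / (exp x + s) * (exp (\<alpha> * x) * sin (pi * \<alpha>) / (norm w)\<^sup>2) / pi)"
      by simp
    also have "exp x / (exp x + s) * (exp (\<alpha> * x) * sin (pi * \<alpha>) / (norm w)\<^sup>2) / pi = res_density \<alpha> \<mu> x / (s + exp x)"
      unfolding res_density_def res_denom_eq w_def[symmetric] by (simp add: mult_ac add.commute)
    finally show ?thesis .
  qed
  define I where "I = integral {-R..R} (\<lambda>x. res_density \<alpha> \<mu> x / (s + exp x))"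
  have Iint: "(\<lambda>x. res_density \<alpha> \<mu> x / (s + exp x)) integrable_on {-R..R}"
    using s by (intro integrable_continuous_interval continuous_intros res_density_continuous)
      (smt (verit) exp_gt_zero)
  have horiz: "contour_integral (linepath a p1) f + contour_integral (linepath b p2) f = 2 * pi * \<i> * of_real I"
  proof -
    have "contour_integral (linepath a p1) f + contour_integral (linepath b p2) f
      = integral {-R..R} (\<lambda>x. f (Complex x (-pi)) - f (Complex x pi))"
      unfolding i1 i2 using Ih by (subst integral_diff) auto
    also have "\<dots> = (2 * pi * \<i>) * integral {-R..R} (\<lambda>x. of_real (res_density \<alpha> \<mu> x / (s + exp x)))"
      unfolding diff by (rule Henstock_Kurzweil_Integration.integral_mult_right)
    also have "integral {-R..R} (\<lambda>x. complex_of_real (res_density \<alpha> \<mu> x / (s + exp x))) = of_real I"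
      unfolding I_def using has_integral_of_real[OF integrable_integral[OF Iint]] by (rule integral_unique)
    finally show ?thesis .
  qed
  have eq: "2 * pi * \<i> * of_real (I - 1 / (s powr \<alpha> + \<mu>)) = - (contour_integral (linepath p1 b) f + contour_integral (linepath p2 a) f)"
  proof -
    have "2 * pi * \<i> * of_real (I - 1 / (s powr \<alpha> + \<mu>)) = 2 * pi * \<i> * of_real I - 2 * pi * \<i> * (1 / of_real (s powr \<alpha> + \<mu>))"
      by (simp add: right_diff_distrib)
    then show ?thesis unfolding horiz[symmetric] ci[symmetric] split by simp
  qed
  have "2 * pi * norm (I - 1 / (s powr \<alpha> + \<mu>)) = norm (2 * pi * \<i> * of_real (I - 1 / (s powr \<alpha> + \<mu>)))"
    by (simp only: norm_mult norm_of_real norm_ii) (simp)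
  also have "\<dots> \<le> B R * (2 * pi) + B (- R) * (2 * pi)"
    unfolding eq norm_minus_cancel using norm_triangle_mono[OF B1 B2] .
  also have "\<dots> = 2 * pi * (B (- R) + B R)" by (simp add: algebra_simps)
  finally show ?thesis using ers erm by (simp add: I_def B_def)
qed

end

lemma tendsto_exp_neg_mult: "0 < c \<Longrightarrow> (\<lambda>n. exp (- c * real n)) \<longlonglongrightarrow> 0"
  by (rule filterlim_compose[OF exp_at_bot], subst filterlim_uminus_at_bot)
     (auto intro!: filterlim_tendsto_pos_mult_at_top[OF tendsto_const] filterlim_real_sequentially)

text \<open>The limit of \<open>res_contour\<close> as \<open>R\<close> runs to infinity through the
  integers. The integrand is nonnegative, so monotone convergence yields integrability together with
  the value.\<close>

lemma res_density_Stieltjes: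
  assumes \<alpha>: "0 < \<alpha>" "\<alpha> < 1" and \<mu>: "0 \<le> \<mu>" and s: "0 < s"
  shows "has_bochner_integral lborel (\<lambda>x. res_density \<alpha> \<mu> x / (s + exp x)) (1 / (s powr \<alpha> + \<mu>))"
proof (rule has_bochner_integral_monotone_convergence)
  define u where "u = (\<lambda>x. res_density \<alpha> \<mu> x / (s + exp x))"
  have pos: "s + exp x > 0" for x :: real using s by (simp add: add_pos_pos)
  have u0: "0 \<le> u x" for x using res_density_nonneg[OF \<alpha> \<mu>, of x] pos[of x] by (simp add: u_def)
  have ucont: "continuous_on A u" for A
    unfolding u_def using pos by (intro continuous_intros res_density_continuous[OF \<alpha> \<mu>]) (metis less_irrefl)
  define f where "f = (\<lambda>n x. indicator {-real n..real n} x *\<^sub>R u x)"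
  have ui: "set_integrable lborel {-real n..real n} u" for n
    by (rule borel_integrable_atLeastAtMost'[OF ucont])
  show "integrable lborel (f n)" for n
    using ui[of n] by (simp add: f_def set_integrable_def)
  show "AE x in lborel. mono (\<lambda>n. f n x)"
    using u0 by (intro AE_I2 monoI) (auto simp: f_def indicator_def)
  show "AE x in lborel. (\<lambda>n. f n x) \<longlonglongrightarrow> u x"
  proof (rule AE_I2)
    fix x :: real
    have "eventually (\<lambda>n. f n x = u x) sequentially"
      using eventually_ge_at_top[of "nat \<lceil>\<bar>x\<bar>\<rceil>"]
    proof eventually_elim
      case (elim n)
      hence "\<bar>x\<bar> \<le> real n" by linarith
      thus ?case by (auto simp: f_def indicator_def)
    qed
    thus "(\<lambda>n. f n x) \<longlonglongrightarrow> u x" by (rule tendsto_eventually)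
  qed
  define m where "m = sin (pi * \<alpha>)"
  have m: "0 < m" using sin_pi_pos[OF \<alpha> \<mu>] by (simp add: m_def)
  \<comment> \<open>The bound of \<open>res_contour\<close> after cancelling exponentials. The left
    side decays because \<open>\<alpha> < 1\<close>, the right side because
    \<open>0 < \<alpha>\<close>.\<close>
  define B where "B = (\<lambda>n. exp (- (1 - \<alpha>) * real n) / ((s - exp (- 1 * real n)) * m) + exp (- \<alpha> * real n) / ((1 - s * exp (- 1 * real n)) * m))"
  have B: "B \<longlonglongrightarrow> 0 / ((s - 0) * m) + 0 / ((1 - s * 0) * m)"
    unfolding B_def using s m \<alpha> by (intro tendsto_intros tendsto_exp_neg_mult) auto
  have int: "integral\<^sup>L lborel (f n) = integral {-real n..real n} u" for n
    using set_borel_integral_eq_integral(2)[OF ui[of n]] by (simp add: f_def set_lebesgue_integral_def)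
  show "(\<lambda>n. integral\<^sup>L lborel (f n)) \<longlonglongrightarrow> 1 / (s powr \<alpha> + \<mu>)"
  proof (rule LIM_zero_cancel, rule Lim_null_comparison)
    show "B \<longlonglongrightarrow> 0" using B by simp
    have ev: "eventually (\<lambda>n. \<bar>ln s\<bar> < real n) sequentially"
      using filterlim_real_sequentially by (auto simp: filterlim_at_top_dense)
    show "eventually (\<lambda>n. norm (integral\<^sup>L lborel (f n) - 1 / (s powr \<alpha> + \<mu>)) \<le> B n) sequentially"
      using ev
    proof eventually_elim
      case (elim n)
      have 1: "exp (- real n) / ((s - exp (- real n)) * (exp (- \<alpha> * real n) * m)) = exp (- (1 - \<alpha>) * real n) / ((s - exp (- 1 * real n)) * m)"
      proof -
        have "exp (- real n) = exp (- (1 - \<alpha>) * real n) * exp (- \<alpha> * real n)"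
          by (simp add: algebra_simps flip: exp_add)
        then show ?thesis by (simp add: divide_simps)
      qed
      have 2: "exp (real n) / ((exp (real n) - s) * (exp (\<alpha> * real n) * m)) = exp (- \<alpha> * real n) / ((1 - s * exp (- 1 * real n)) * m)"
      proof -
        have e: "exp (real n) - s = exp (real n) * (1 - s * exp (- 1 * real n))"
          by (simp add: algebra_simps flip: exp_add)
        show ?thesis unfolding e by (simp add: exp_minus divide_simps)
      qed
      show ?case
        using res_contour[OF \<alpha> \<mu> s elim] unfolding int B_def m_def[symmetric] 1 2 u_def .
    qed
  qed
  show "u \<in> borel_measurable lborel" unfolding u_def using res_density_measurable[OF \<alpha> \<mu>] by measurable
qed

section \<open>Solution operators of the time stepping scheme\<close>

lemma powser_sums_zero_unique:
  fixes d :: "nat \<Rightarrow> real"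
  assumes d: "\<And>\<xi>. \<bar>\<xi>\<bar> < 1 \<Longrightarrow> (\<lambda>j. d j * \<xi> ^ j) sums 0"
  shows "d n = 0"
proof (induction n rule: less_induct)
  case (less n)
  have "(\<lambda>j. d (j + n) * \<xi> ^ j) sums 0" if "\<xi> \<noteq> 0" "norm \<xi> < 1" for \<xi> :: real
  proof -
    have "(\<lambda>j. d (j + n) * \<xi> ^ (j + n)) sums 0"
      using d[of \<xi>] that less.IH
      by (subst sums_zero_iff_shift[where f = "\<lambda>j. d j * \<xi> ^ j"]) auto
    then have "(\<lambda>j. d (j + n) * \<xi> ^ (j + n) / \<xi> ^ n) sums (0 / \<xi> ^ n)"
      by (rule sums_divide)
    then show ?thesis
      using that by (simp add: power_add)
  qed
  then have "((\<lambda>\<xi>::real. 0) \<longlongrightarrow> d (0 + n)) (at 0)"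
    by (intro powser_limit_0_strong[of 1 "\<lambda>j. d (j + n)"]) auto
  then show "d n = 0"
    by (simp add: tendsto_const_iff)
qed

lemma cq_weight_sums:
  assumes "\<bar>\<xi>\<bar> < 1"
  shows "(\<lambda>j. cq_weight \<alpha> j * \<xi> ^ j) sums ((1 - \<xi>) powr \<alpha>)"
  using gen_binomial_real[of "- \<xi>" \<alpha>] assms
  by (simp add: cq_weight_eq power_minus[of \<xi>] mult_ac)

lemma one_plus_power_ge:
  fixes r :: real assumes "0 \<le> r"
  shows "1 + real n * r + real n * (real n - 1) / 2 * r\<^sup>2 \<le> (1 + r) ^ n"
proof (induction n)
  case (Suc n)
  have "1 + real (Suc n) * r + real (Suc n) * (real (Suc n) - 1) / 2 * r\<^sup>2
     \<le> (1 + real n * r + real n * (real n - 1) / 2 * r\<^sup>2) * (1 + r)"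
  proof -
    have "0 \<le> real n * (real n - 1) / 2 * r\<^sup>2 * r"
      using assms by (cases n) auto
    moreover have "(1 + real n * r + real n * (real n - 1) / 2 * r\<^sup>2) * (1 + r) =
        1 + real (Suc n) * r + real (Suc n) * (real (Suc n) - 1) / 2 * r\<^sup>2 + real n * (real n - 1) / 2 * r\<^sup>2 * r"
      by (simp add: field_simps power2_eq_square)
    ultimately show ?thesis by linarith
  qed
  also have "\<dots> \<le> (1 + r) ^ n * (1 + r)"
    using Suc assms by (intro mult_right_mono) auto
  finally show ?case by (simp add: mult.commute)
qed simp

text \<open>The quadratic binomial term of \<open>(1 + r) ^ n\<close> alone dominates. Every factor
  \<open>n^-2\<close> in the second differences originates here, because the second difference of
  \<open>1 / (1 + r) ^ j\<close> in \<open>j\<close> is \<open>r^2 / (1 + r) ^ j\<close>.\<close>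

lemma square_div_power_le:
  fixes r :: real assumes "0 \<le> r" "2 \<le> n"
  shows "r\<^sup>2 / (1 + r) ^ n \<le> 2 / (real n * (real n - 1))"
proof -
  have "real n * (real n - 1) / 2 * r\<^sup>2 \<le> (1 + r) ^ n"
    using one_plus_power_ge[OF assms(1), of n] assms by (smt (verit) mult_nonneg_nonneg of_nat_0_le_iff)
  then show ?thesis using assms by (simp add: field_simps add_pos_nonneg)
qed

lemma ln_one_plus_ge:
  fixes r :: real assumes "0 \<le> r" shows "r - r\<^sup>2 / 2 \<le> ln (1 + r)"
proof -
  define f where "f = (\<lambda>x::real. ln (1 + x) - x + x\<^sup>2 / 2)"
  have "f 0 \<le> f r"
  proof (rule DERIV_nonneg_imp_nondecreasing[OF assms])
    fix x :: real assume x: "0 \<le> x" "x \<le> r"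
    have "(f has_real_derivative (1 / (1 + x) - 1 + x)) (at x)"
      unfolding f_def using x by (auto intro!: derivative_eq_intros)
    moreover have "1 / (1 + x) - 1 + x = x\<^sup>2 / (1 + x)"
      using x by (simp add: field_simps power2_eq_square)
    ultimately show "\<exists>y. (f has_real_derivative y) (at x) \<and> 0 \<le> y"
      using x by auto
  qed
  then show ?thesis by (simp add: f_def)
qed

text \<open>Backward Euler against the exponential, uniformly in the stiffness \<open>r\<close>: the
  relative error is at most \<open>n r^2 / 2\<close>, and the power \<open>1 / (1 + r) ^ n\<close>
  in front of it consumes the \<open>r^2\<close>. For \<open>n = 1\<close> that power is too weak,
  and the trivial bound serves.\<close>

lemma exp_rational_diff:
  fixes r :: real assumes r: "0 \<le> r" and n: "1 \<le> n"
  shows "\<bar>1 / (1 + r) ^ n - exp (- r * real n)\<bar> \<le> 2 / real n"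
proof -
  have pw: "1 / (1 + r) ^ n = exp (- real n * ln (1 + r))"
    using r by (simp add: exp_minus exp_of_nat_mult inverse_eq_divide)
  have le1: "exp (- r * real n) \<le> 1 / (1 + r) ^ n"
    unfolding pw using mult_left_mono[OF ln_add_one_self_le_self[OF r], of "real n"] by (simp add: mult.commute)
  have p1: "1 / (1 + r) ^ n \<le> 1" using r by (simp add: one_le_power)
  show ?thesis
  proof (cases "n = 1")
    case True
    have "\<bar>1 / (1 + r) ^ n - exp (- r * real n)\<bar> \<le> 2"
      using le1 p1 exp_gt_zero[of "- r * real n"] by linarith
    with True show ?thesis by simp
  next
    case False
    hence n2: "2 \<le> n" using n by simp
    define \<delta> where "\<delta> = real n * (r - ln (1 + r))"
    have "exp (- r * real n) = 1 / (1 + r) ^ n * exp (- \<delta>)"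
      unfolding pw \<delta>_def by (simp add: algebra_simps flip: exp_add)
    hence "1 / (1 + r) ^ n - exp (- r * real n) = 1 / (1 + r) ^ n * (1 - exp (- \<delta>))"
      by (simp only: right_diff_distrib mult_1_right)
    also have "\<dots> \<le> 1 / (1 + r) ^ n * (real n * (r\<^sup>2 / 2))"
    proof (intro mult_left_mono)
      have "1 - exp (- \<delta>) \<le> \<delta>" using exp_ge_add_one_self[of "- \<delta>"] by linarith
      also have "\<delta> \<le> real n * (r\<^sup>2 / 2)"
        unfolding \<delta>_def using ln_one_plus_ge[OF r] by (intro mult_left_mono) auto
      finally show "1 - exp (- \<delta>) \<le> real n * (r\<^sup>2 / 2)" .
    qed (use r in auto)
    also have "\<dots> = real n / 2 * (r\<^sup>2 / (1 + r) ^ n)" by simp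
    also have "\<dots> \<le> real n / 2 * (2 / (real n * (real n - 1)))"
      by (intro mult_left_mono square_div_power_le r n2) auto
    also have "\<dots> \<le> 2 / real n" using n2 by (simp add: field_simps)
    finally show ?thesis using le1 by simp
  qed
qed

section \<open>Solution operators of the scalar scheme and bounds uniform in \<mu>\<close>

text \<open>Subtraction on naturals truncates, so this is a second difference only for
  \<open>2 \<le> n\<close>; it is applied only there.\<close>

abbreviation diff2 :: "(nat \<Rightarrow> real) \<Rightarrow> nat \<Rightarrow> real" where
  "diff2 f n \<equiv> f n - 2 * f (n - 1) + f (n - 2)"

text \<open>Impulse response of the scheme, that is the coefficients of
  \<open>1 / ((1 - \<xi>) powr \<alpha> + \<mu>)\<close>, written as moments so that bounds become
  pointwise bounds under the integral.\<close>

definition res_kernel :: "real \<Rightarrow> real \<Rightarrow> nat \<Rightarrow> real" where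
  "res_kernel \<alpha> \<mu> j = (LBINT x. res_density \<alpha> \<mu> x / (1 + exp x) * (1 / (1 + exp x) ^ j))"

text \<open>The value at level \<open>n\<close> of the unperturbed scalar scheme started from 1:
  after subtraction of the initial value it is driven by the constant source \<open>- \<mu>\<close>,
  and the sum is the response to that source.\<close>

definition relax_factor :: "real \<Rightarrow> real \<Rightarrow> nat \<Rightarrow> real" where
  "relax_factor \<alpha> \<mu> n = 1 - \<mu> * (\<Sum>j<n. res_kernel \<alpha> \<mu> j)"

text \<open>The Mittag-Leffler function of \<open>- \<mu> t^\<alpha>\<close> as a mixture of
  exponentials. For \<open>\<mu> = 0\<close> the prefactor would make the integral 0 where the value
  has to be 1.\<close>

definition mittag_leffler_relax :: "real \<Rightarrow> real \<Rightarrow> real \<Rightarrow> real" where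
  "mittag_leffler_relax \<alpha> \<mu> t =
     (if \<mu> = 0 then 1 else LBINT x. \<mu> * res_density \<alpha> \<mu> x / exp x * exp (- exp x * t))"

lemma one_plus_exp_gt: "1 < 1 + exp (x::real)" "0 < 1 + exp x" "1 + exp x \<noteq> 0"
  by (auto simp: add_pos_pos) (smt (verit) exp_gt_zero)

lemma weighted_integral_bound:
  fixes f g :: "'a \<Rightarrow> real"
  assumes f: "has_bochner_integral M f c" and f0: "\<And>x. 0 \<le> f x"
    and g: "g \<in> borel_measurable M" and B: "\<And>x. \<bar>g x\<bar> \<le> B"
  shows "integrable M (\<lambda>x. f x * g x)" and "\<bar>\<integral>x. f x * g x \<partial>M\<bar> \<le> B * c"
proof -
  note [measurable] = g borel_measurable_has_bochner_integral[OF f]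
  have st: "has_bochner_integral M (\<lambda>x. B * f x) (B * c)"
    using f by (intro has_bochner_integral_mult_right) auto
  have le: "\<bar>f x * g x\<bar> \<le> B * f x" for x
    using mult_left_mono[OF B f0] f0[of x] by (simp add: abs_mult mult.commute)
  show int: "integrable M (\<lambda>x. f x * g x)"
    by (rule Bochner_Integration.integrable_bound[OF integrable.intros[OF st]])
      (use order_trans[OF le abs_ge_self] in simp_all)
  have "\<bar>\<integral>x. f x * g x \<partial>M\<bar> \<le> (\<integral>x. \<bar>f x * g x\<bar> \<partial>M)" by (rule integral_abs_bound)
  also have "\<dots> \<le> (\<integral>x. B * f x \<partial>M)"
    by (rule integral_mono[OF integrable_abs[OF int] integrable.intros[OF st] le])
  also have "\<dots> = B * c" by (rule has_bochner_integral_integral_eq[OF st])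
  finally show "\<bar>\<integral>x. f x * g x \<partial>M\<bar> \<le> B * c" .
qed

context
  fixes \<alpha> \<mu> :: real
  assumes \<alpha>: "0 < \<alpha>" "\<alpha> < 1" and \<mu>: "0 \<le> \<mu>"
begin

abbreviation \<rho> where "\<rho> \<equiv> res_density \<alpha> \<mu>"

text \<open>The representation at \<open>s = 1\<close> gives the weight
  \<open>\<rho> x / (1 + exp x)\<close> the total mass \<open>1 / (1 + \<mu>)\<close>. This mass is
  the smoothing that later cancels the factor \<open>1 + \<mu>\<close> in front of the
  kernels.\<close>

lemma res_weighted:
  assumes "g \<in> borel_measurable borel" and "\<And>x. \<bar>g x\<bar> \<le> B"
  shows "integrable lborel (\<lambda>x. \<rho> x / (1 + exp x) * g x)"
    and "\<bar>LBINT x. \<rho> x / (1 + exp x) * g x\<bar> \<le> B / (1 + \<mu>)"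
  using weighted_integral_bound[of lborel "\<lambda>x. \<rho> x / (1 + exp x)" "1 / (1 + \<mu>)" g B]
    res_density_Stieltjes[OF \<alpha> \<mu>, of 1] res_density_nonneg[OF \<alpha> \<mu>] one_plus_exp_gt assms by (auto simp: less_imp_le)

lemma inverse_power_abs_le1: "\<bar>1 / (1 + exp (x::real)) ^ j\<bar> \<le> 1"
  using one_plus_exp_gt[of x] by (simp add: one_le_power)

lemma res_kernel_integrable:
  "integrable lborel (\<lambda>x. \<rho> x / (1 + exp x) * (1 / (1 + exp x) ^ j))"
  by (rule res_weighted(1)[OF _ inverse_power_abs_le1]) simp

lemma res_kernel_nonneg: "0 \<le> res_kernel \<alpha> \<mu> j"
  unfolding res_kernel_def
  using res_density_nonneg[OF \<alpha> \<mu>] one_plus_exp_gt by (intro integral_nonneg_AE AE_I2) (simp add: less_imp_le)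

lemma res_kernel_bound: "(1 + \<mu>) * \<bar>res_kernel \<alpha> \<mu> j\<bar> \<le> 1"
proof -
  have "\<bar>res_kernel \<alpha> \<mu> j\<bar> \<le> 1 / (1 + \<mu>)"
    unfolding res_kernel_def by (rule res_weighted(2)[OF _ inverse_power_abs_le1]) simp
  then show ?thesis using \<mu> by (simp add: field_simps)
qed

text \<open>Taking second differences under the integral produces \<open>r^2 / (1 + r) ^ j\<close>,
  which is \<open>O(j^-2)\<close> uniformly in \<open>r\<close>; the mass of the weight cancels
  \<open>1 + \<mu>\<close>.\<close>

lemma res_kernel_diff2:
  assumes "2 \<le> j"
  shows "(1 + \<mu>) * \<bar>diff2 (res_kernel \<alpha> \<mu>) j\<bar> \<le> 9 / (real j + 1)\<^sup>2"
proof -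
  obtain k where j: "j = k + 2" using assms by (metis add.commute le_Suc_ex)
  note ki = res_kernel_integrable
  have "diff2 (res_kernel \<alpha> \<mu>) j
     = (LBINT x. \<rho> x / (1 + exp x) * (1 / (1 + exp x) ^ j) - 2 * (\<rho> x / (1 + exp x) * (1 / (1 + exp x) ^ (j - 1)))
         + \<rho> x / (1 + exp x) * (1 / (1 + exp x) ^ (j - 2)))"
    unfolding res_kernel_def
    by (subst Bochner_Integration.integral_add Bochner_Integration.integral_diff, intro Bochner_Integration.integrable_diff integrable_mult_right ki, rule ki)
      (subst Bochner_Integration.integral_diff, auto intro!: ki integrable_mult_right simp del: times_divide_eq_right times_divide_eq_left)
  also have "\<dots> = (LBINT x. \<rho> x / (1 + exp x) * ((exp x)\<^sup>2 / (1 + exp x) ^ j))"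
  proof (rule Bochner_Integration.integral_cong[OF refl])
    fix x :: real
    have e: "1 / (1 + r) ^ j - 2 * (1 / (1 + r) ^ (j - 1)) + 1 / (1 + r) ^ (j - 2) = r\<^sup>2 / (1 + r) ^ j"
      if "r \<ge> 0" for r :: real
    proof -
      have "1 / (1 + r) ^ (j - 1) = (1 + r) / (1 + r) ^ j" "1 / (1 + r) ^ (j - 2) = (1 + r)\<^sup>2 / (1 + r) ^ j"
        using that by (simp_all add: j power2_eq_square)
      then have "1 / (1 + r) ^ j - 2 * (1 / (1 + r) ^ (j - 1)) + 1 / (1 + r) ^ (j - 2) = (1 - 2 * (1 + r) + (1 + r)\<^sup>2) / (1 + r) ^ j"
        by (simp add: diff_divide_distrib add_divide_distrib)
      also have "1 - 2 * (1 + r) + (1 + r)\<^sup>2 = r\<^sup>2" by (simp add: power2_eq_square algebra_simps)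
      finally show ?thesis .
    qed
    have "\<rho> x / (1 + exp x) * (1 / (1 + exp x) ^ j) - 2 * (\<rho> x / (1 + exp x) * (1 / (1 + exp x) ^ (j - 1)))
         + \<rho> x / (1 + exp x) * (1 / (1 + exp x) ^ (j - 2))
        = \<rho> x / (1 + exp x) * (1 / (1 + exp x) ^ j - 2 * (1 / (1 + exp x) ^ (j - 1)) + 1 / (1 + exp x) ^ (j - 2))"
      by (simp only: distrib_left right_diff_distrib mult.assoc mult.left_commute)
    then show "\<rho> x / (1 + exp x) * (1 / (1 + exp x) ^ j) - 2 * (\<rho> x / (1 + exp x) * (1 / (1 + exp x) ^ (j - 1)))
         + \<rho> x / (1 + exp x) * (1 / (1 + exp x) ^ (j - 2)) = \<rho> x / (1 + exp x) * ((exp x)\<^sup>2 / (1 + exp x) ^ j)"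
      using e[of "exp x"] by simp
  qed
  also have "\<bar>\<dots>\<bar> \<le> (2 / (real j * (real j - 1))) / (1 + \<mu>)"
  proof (rule res_weighted(2))
    fix x :: real
    have "0 \<le> (exp x)\<^sup>2 / (1 + exp x) ^ j" using one_plus_exp_gt[of x] by simp
    then show "\<bar>(exp x)\<^sup>2 / (1 + exp x) ^ j\<bar> \<le> 2 / (real j * (real j - 1))"
      using square_div_power_le[of "exp x" j] assms by simp
  qed simp
  finally have "(1 + \<mu>) * \<bar>diff2 (res_kernel \<alpha> \<mu>) j\<bar>
      \<le> (1 + \<mu>) * (2 / (real j * (real j - 1)) / (1 + \<mu>))"
    using \<mu> by (intro mult_left_mono) auto
  also have "\<dots> = 2 / (real j * (real j - 1))"
  proof -
    have "(1 + \<mu>) * (c / (1 + \<mu>)) = c" for c using \<mu> by (simp add: field_simps)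
    then show ?thesis .
  qed
  also have "\<dots> \<le> 9 / (real j + 1)\<^sup>2"
  proof -
    \<comment> \<open>Equality holds at \<open>j = 2\<close>, which fixes the constant 9.\<close>
    have "2 * (real j + 1)\<^sup>2 \<le> 9 * (real j * (real j - 1))"
      unfolding j by (simp add: algebra_simps power2_eq_square)
    then show ?thesis using assms by (simp add: divide_simps)
  qed
  finally show ?thesis .
qed

text \<open>The kernel is the convolution inverse of the weights with \<mu> added at index 0.
  Summing the geometric series under the integral turns the moments into the Stieltjes integral at
  \<open>s = 1 - \<xi>\<close>, and a Cauchy product with the series of the weights gives 1.\<close>

lemma res_kernel_convolution:
  "(\<Sum>j\<le>n. cq_weight \<alpha> j * res_kernel \<alpha> \<mu> (n - j)) + \<mu> * res_kernel \<alpha> \<mu> n = (if n = 0 then 1 else 0)"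
proof -
  define d where "d = (\<lambda>n. (\<Sum>j\<le>n. cq_weight \<alpha> j * res_kernel \<alpha> \<mu> (n - j)) + \<mu> * res_kernel \<alpha> \<mu> n - (if n = 0 then 1 else 0))"
  have "d n = 0"
  proof (rule powser_sums_zero_unique)
    fix \<xi> :: real assume \<xi>: "\<bar>\<xi>\<bar> < 1"
    have s: "0 < 1 - \<xi>" using \<xi> by auto
    \<comment> \<open>Convergence at a point strictly farther out gives absolute convergence at
      \<open>\<xi>\<close>, as the Cauchy product requires.\<close>
    obtain \<xi>' where \<xi>': "\<bar>\<xi>\<bar> < \<xi>'" "\<xi>' < 1" using \<xi> dense by blast
    have sumb: "summable (\<lambda>j. norm (cq_weight \<alpha> j * \<xi> ^ j))"
      using powser_insidea[OF sums_summable[OF cq_weight_sums[of \<xi>' \<alpha>]], of \<xi>] \<xi>' by auto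
    have bn: "norm (res_kernel \<alpha> \<mu> j * \<xi> ^ j) \<le> \<bar>\<xi>\<bar> ^ j" for j
    proof -
      have "\<bar>res_kernel \<alpha> \<mu> j\<bar> \<le> (1 + \<mu>) * \<bar>res_kernel \<alpha> \<mu> j\<bar>" using \<mu> by (simp add: distrib_right)
      also have "\<dots> \<le> 1" by (rule res_kernel_bound)
      finally show ?thesis by (simp add: abs_mult power_abs mult_left_le_one_le)
    qed
    have sumE: "summable (\<lambda>j. norm (res_kernel \<alpha> \<mu> j * \<xi> ^ j))"
      by (rule summable_comparison_test[OF _ summable_geometric[of "\<bar>\<xi>\<bar>"]]) (use bn \<xi> in auto)
    define f where "f = (\<lambda>j x. \<rho> x / (1 + exp x) * (1 / (1 + exp x) ^ j) * \<xi> ^ j)"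
    have fs: "(\<lambda>j. f j x) sums (\<rho> x / ((1 - \<xi>) + exp x))" for x
    proof -
      have q: "\<bar>\<xi> / (1 + exp x)\<bar> < 1"
        using less_trans[OF \<xi> one_plus_exp_gt(1)[of x]] one_plus_exp_gt[of x] by (simp add: abs_divide divide_less_eq)
      have "(\<lambda>j. (\<rho> x / (1 + exp x)) * (\<xi> / (1 + exp x)) ^ j) sums
        ((\<rho> x / (1 + exp x)) * (1 / (1 - \<xi> / (1 + exp x))))"
        using q by (intro sums_mult geometric_sums) auto
      moreover have "(\<rho> x / (1 + exp x)) * (1 / (1 - \<xi> / (1 + exp x))) = \<rho> x / ((1 - \<xi>) + exp x)"
      proof -
        have "(1 + exp x) * (1 - \<xi> / (1 + exp x)) = 1 - \<xi> + exp x"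
          using one_plus_exp_gt[of x] by (simp add: right_diff_distrib)
        then show ?thesis by (metis divide_divide_eq_left mult.right_neutral times_divide_eq_right)
      qed
      ultimately have "(\<lambda>j. (\<rho> x / (1 + exp x)) * (\<xi> / (1 + exp x)) ^ j) sums (\<rho> x / ((1 - \<xi>) + exp x))"
        by (simp only:)
      then show ?thesis by (simp add: f_def power_divide)
    qed
    have fn: "norm (f j x) \<le> \<rho> x / (1 + exp x) * \<bar>\<xi>\<bar> ^ j" for j x
    proof -
      have q: "0 \<le> \<rho> x / (1 + exp x)"
        using res_density_nonneg[OF \<alpha> \<mu>, of x] one_plus_exp_gt[of x] by simp
      have "norm (f j x) = \<rho> x / (1 + exp x) * \<bar>1 / (1 + exp x) ^ j\<bar> * \<bar>\<xi>\<bar> ^ j"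
        by (simp only: f_def real_norm_def abs_mult power_abs abs_of_nonneg[OF q])
      also have "\<dots> \<le> \<rho> x / (1 + exp x) * 1 * \<bar>\<xi>\<bar> ^ j"
        by (intro mult_left_mono mult_right_mono inverse_power_abs_le1 q) auto
      finally show ?thesis by simp
    qed
    have fi: "integrable lborel (f j)" for j
      unfolding f_def by (intro integrable_mult_left res_kernel_integrable)
    have q1: "integrable lborel (\<lambda>x. \<rho> x / (1 + exp x) * \<bar>\<xi>\<bar> ^ j)" 
       "(LBINT x. \<rho> x / (1 + exp x) * \<bar>\<xi>\<bar> ^ j) \<le> \<bar>\<xi>\<bar> ^ j" for j
    proof -
      show "integrable lborel (\<lambda>x. \<rho> x / (1 + exp x) * \<bar>\<xi>\<bar> ^ j)"
        by (rule res_weighted(1)[of _ "\<bar>\<xi>\<bar> ^ j"]) auto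
      have "(LBINT x. \<rho> x / (1 + exp x) * \<bar>\<xi>\<bar> ^ j) \<le> \<bar>\<xi>\<bar> ^ j / (1 + \<mu>)"
        by (rule order_trans[OF abs_ge_self res_weighted(2)]) auto
      also have "\<dots> \<le> \<bar>\<xi>\<bar> ^ j" using \<mu> by (simp add: divide_le_eq mult_le_cancel_left1)
      finally show "(LBINT x. \<rho> x / (1 + exp x) * \<bar>\<xi>\<bar> ^ j) \<le> \<bar>\<xi>\<bar> ^ j" .
    qed
    have "(\<lambda>j. integral\<^sup>L lborel (f j)) sums (LBINT x. (\<Sum>j. f j x))"
    proof (rule sums_integral)
      show "integrable lborel (f j)" for j by (rule fi)
      show "AE x in lborel. summable (\<lambda>j. norm (f j x))"
      proof (rule AE_I2)
        fix x
        have "summable (\<lambda>j. \<rho> x / (1 + exp x) * \<bar>\<xi>\<bar> ^ j)"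
          using \<xi> by (intro summable_mult summable_geometric) auto
        then show "summable (\<lambda>j. norm (f j x))"
          by (rule summable_comparison_test[rotated]) (use fn in auto)
      qed
      show "summable (\<lambda>j. LBINT x. norm (f j x))"
      proof (rule summable_comparison_test[OF _ summable_geometric[of "\<bar>\<xi>\<bar>"]])
        have "(LBINT x. norm (f j x)) \<le> \<bar>\<xi>\<bar> ^ j" for j
          by (rule order_trans[OF integral_mono q1(2)]) (use fi q1 fn in auto)
        then show "\<exists>N. \<forall>n\<ge>N. norm (LBINT x. norm (f n x)) \<le> \<bar>\<xi>\<bar> ^ n" by auto
      qed (use \<xi> in auto)
    qed
    moreover have "(LBINT x. (\<Sum>j. f j x)) = 1 / ((1 - \<xi>) powr \<alpha> + \<mu>)"
    proof -
      have "(\<Sum>j. f j x) = \<rho> x / ((1 - \<xi>) + exp x)" for x using fs[of x] by (simp add: sums_iff)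
      then show ?thesis using has_bochner_integral_integral_eq[OF res_density_Stieltjes[OF \<alpha> \<mu> s]] by simp
    qed
    moreover have "integral\<^sup>L lborel (f j) = res_kernel \<alpha> \<mu> j * \<xi> ^ j" for j
      unfolding f_def res_kernel_def by (rule integral_mult_left_zero)
    ultimately have Es: "(\<lambda>j. res_kernel \<alpha> \<mu> j * \<xi> ^ j) sums (1 / ((1 - \<xi>) powr \<alpha> + \<mu>))"
      by simp
    have bs: "(\<lambda>j. cq_weight \<alpha> j * \<xi> ^ j) sums ((1 - \<xi>) powr \<alpha>)"
      using \<xi> by (rule cq_weight_sums)
    have "(\<lambda>k. \<Sum>i\<le>k. (cq_weight \<alpha> i * \<xi> ^ i) * (res_kernel \<alpha> \<mu> (k - i) * \<xi> ^ (k - i))) sums ((1 - \<xi>) powr \<alpha> * (1 / ((1 - \<xi>) powr \<alpha> + \<mu>)))"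
      using Cauchy_product_sums[OF sumb sumE] Es bs by (simp add: sums_iff)
    moreover have "(\<Sum>i\<le>k. (cq_weight \<alpha> i * \<xi> ^ i) * (res_kernel \<alpha> \<mu> (k - i) * \<xi> ^ (k - i))) = (\<Sum>i\<le>k. cq_weight \<alpha> i * res_kernel \<alpha> \<mu> (k - i)) * \<xi> ^ k" for k
      unfolding sum_distrib_right
    proof (intro sum.cong refl)
      fix i assume "i \<in> {..k}"
      then have "\<xi> ^ k = \<xi> ^ i * \<xi> ^ (k - i)" by (simp flip: power_add)
      then show "(cq_weight \<alpha> i * \<xi> ^ i) * (res_kernel \<alpha> \<mu> (k - i) * \<xi> ^ (k - i)) = cq_weight \<alpha> i * res_kernel \<alpha> \<mu> (k - i) * \<xi> ^ k"
        by (simp add: mult_ac)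
    qed
    ultimately have 1: "(\<lambda>k. (\<Sum>i\<le>k. cq_weight \<alpha> i * res_kernel \<alpha> \<mu> (k - i)) * \<xi> ^ k) sums ((1 - \<xi>) powr \<alpha> * (1 / ((1 - \<xi>) powr \<alpha> + \<mu>)))"
      by simp
    have 2: "(\<lambda>k. \<mu> * (res_kernel \<alpha> \<mu> k * \<xi> ^ k)) sums (\<mu> * (1 / ((1 - \<xi>) powr \<alpha> + \<mu>)))"
      by (intro sums_mult Es)
    have 3: "(\<lambda>k. (if k = 0 then 1 else 0) * \<xi> ^ k) sums 1"
      using sums_If_finite_set[of "{0}" "\<lambda>k. \<xi> ^ k"] by (simp add: if_distrib[of "\<lambda>z. z * _"] cong: if_cong)
    have "(\<lambda>k. d k * \<xi> ^ k) sums ((1 - \<xi>) powr \<alpha> * (1 / ((1 - \<xi>) powr \<alpha> + \<mu>)) + \<mu> * (1 / ((1 - \<xi>) powr \<alpha> + \<mu>)) - 1)"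
      using sums_diff[OF sums_add[OF 1 2] 3] by (simp add: d_def algebra_simps)
    moreover have "(1 - \<xi>) powr \<alpha> + \<mu> > 0" using s \<mu> by (simp add: add_pos_nonneg)
    hence "(1 - \<xi>) powr \<alpha> * (1 / ((1 - \<xi>) powr \<alpha> + \<mu>)) + \<mu> * (1 / ((1 - \<xi>) powr \<alpha> + \<mu>)) - 1 = 0"
      by (simp flip: add_divide_distrib)
    ultimately show "(\<lambda>k. d k * \<xi> ^ k) sums 0" by simp
  qed
  then show ?thesis by (simp add: d_def)
qed


text \<open>The representation at \<open>s = 1 / Suc n\<close> in the limit \<open>s = 0\<close>,
  again by monotone convergence. It makes \<open>\<mu> * \<rho> x / exp x\<close> a probability
  density, against which both the discrete and the continuous relaxation are averages.\<close>

lemma res_density_over_exp: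
  assumes "0 < \<mu>"
  shows "has_bochner_integral lborel (\<lambda>x. \<mu> * \<rho> x / exp x) 1"
proof (rule has_bochner_integral_monotone_convergence)
  note [measurable] = res_density_measurable[OF \<alpha> \<mu>]
  have st: "has_bochner_integral lborel (\<lambda>x. \<mu> * (\<rho> x / (1 / Suc n + exp x))) (\<mu> * (1 / ((1 / Suc n) powr \<alpha> + \<mu>)))" for n
    using res_density_Stieltjes[OF \<alpha> \<mu>, of "1 / Suc n"] by (intro has_bochner_integral_mult_right) auto
  show "integrable lborel (\<lambda>x. \<mu> * (\<rho> x / (1 / Suc n + exp x)))" for n
    by (rule integrable.intros[OF st])
  show "AE x in lborel. mono (\<lambda>n. \<mu> * (\<rho> x / (1 / Suc n + exp x)))"
    using \<mu> by (intro AE_I2 monoI mult_left_mono divide_left_mono res_density_nonneg[OF \<alpha> \<mu>] add_right_mono mult_pos_pos add_pos_pos)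
      (auto simp: frac_le)
  have lim0: "(\<lambda>n. 1 / real (Suc n)) \<longlonglongrightarrow> 0"
    using LIMSEQ_inverse_real_of_nat by (simp add: inverse_eq_divide)
  show "AE x in lborel. (\<lambda>n. \<mu> * (\<rho> x / (1 / Suc n + exp x))) \<longlonglongrightarrow> \<mu> * \<rho> x / exp x"
  proof (rule AE_I2)
    fix x
    have "(\<lambda>n. \<mu> * (\<rho> x / (1 / Suc n + exp x))) \<longlonglongrightarrow> \<mu> * (\<rho> x / (0 + exp x))"
      by (intro tendsto_intros lim0) auto
    then show "(\<lambda>n. \<mu> * (\<rho> x / (1 / Suc n + exp x))) \<longlonglongrightarrow> \<mu> * \<rho> x / exp x"
      by simp
  qed
  have "(\<lambda>n. \<mu> * (1 / ((1 / Suc n) powr \<alpha> + \<mu>))) \<longlonglongrightarrow> \<mu> * (1 / (0 powr \<alpha> + \<mu>))"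
    using \<alpha> assms by (intro tendsto_intros tendsto_powr'[OF lim0]) auto
  then show "(\<lambda>n. LBINT x. \<mu> * (\<rho> x / (1 / Suc n + exp x))) \<longlonglongrightarrow> 1"
    unfolding has_bochner_integral_integral_eq[OF st] using assms by simp
  show "(\<lambda>x. \<mu> * \<rho> x / exp x) \<in> borel_measurable lborel" by measurable
qed

lemma relax_weighted:
  assumes "0 < \<mu>" and "g \<in> borel_measurable borel" and "\<And>x. \<bar>g x\<bar> \<le> B"
  shows "integrable lborel (\<lambda>x. \<mu> * \<rho> x / exp x * g x)"
    and "\<bar>LBINT x. \<mu> * \<rho> x / exp x * g x\<bar> \<le> B"
  using weighted_integral_bound[OF res_density_over_exp[OF assms(1)], of g B] res_density_nonneg[OF \<alpha> \<mu>] assms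
  by auto

text \<open>By \<open>1 / r - 1 / (1 + r) = 1 / (r (1 + r))\<close>, subtracting one more kernel
  value raises the power by one. The discrete factor thus becomes an average over the same density
  as the continuous one, so the two can be compared pointwise in \<open>r\<close>.\<close>

lemma relax_factor_integral:
  assumes \<mu>0: "0 < \<mu>"
  shows "relax_factor \<alpha> \<mu> n = (LBINT x. \<mu> * \<rho> x / exp x * (1 / (1 + exp x) ^ n))"
proof (induction n)
  case 0
  show ?case
    using has_bochner_integral_integral_eq[OF res_density_over_exp[OF \<mu>0]] by (simp add: relax_factor_def)
next
  case (Suc n)
  have "relax_factor \<alpha> \<mu> (Suc n) = relax_factor \<alpha> \<mu> n - \<mu> * res_kernel \<alpha> \<mu> n"
    by (simp add: relax_factor_def algebra_simps)
  also have "\<dots> = (LBINT x. \<mu> * \<rho> x / exp x * (1 / (1 + exp x) ^ n)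
       - \<mu> * (\<rho> x / (1 + exp x) * (1 / (1 + exp x) ^ n)))"
    unfolding Suc res_kernel_def
    by (subst Bochner_Integration.integral_diff)
      (auto intro!: integrable_mult_right res_kernel_integrable relax_weighted(1)[OF \<mu>0 _ inverse_power_abs_le1] simp del: times_divide_eq_right times_divide_eq_left)
  also have "\<dots> = (LBINT x. \<mu> * \<rho> x / exp x * (1 / (1 + exp x) ^ Suc n))"
  proof (rule Bochner_Integration.integral_cong[OF refl])
    fix x :: real
    have e: "m * q / r * (1 / P) - m * (q / (1 + r) * (1 / P)) = m * q / r * (1 / ((1 + r) * P))"
      if "r > 0" "P > 0" for m q r P :: real
    proof -
      have "1 / r - 1 / (1 + r) = 1 / (r * (1 + r))" using that by (simp add: field_simps)
      moreover have "m * q / r * (1 / P) - m * (q / (1 + r) * (1 / P)) = m * q / P * (1 / r - 1 / (1 + r))"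
        by (simp add: right_diff_distrib mult.commute)
      ultimately show ?thesis by (simp add: mult_ac)
    qed
    show "\<mu> * \<rho> x / exp x * (1 / (1 + exp x) ^ n)
       - \<mu> * (\<rho> x / (1 + exp x) * (1 / (1 + exp x) ^ n)) = \<mu> * \<rho> x / exp x * (1 / (1 + exp x) ^ Suc n)"
      unfolding power_Suc by (rule e) (use one_plus_exp_gt[of x] in auto)
  qed
  finally show ?case .
qed

lemma relax_factor_error:
  assumes n: "1 \<le> n"
  shows "\<bar>relax_factor \<alpha> \<mu> n - mittag_leffler_relax \<alpha> \<mu> (real n)\<bar> \<le> 2 / real n"
proof (cases "\<mu> = 0")
  case True
  then show ?thesis by (simp add: relax_factor_def mittag_leffler_relax_def)
next
  case False
  hence \<mu>0: "0 < \<mu>" using \<mu> by simp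
  have eb: "\<bar>exp (- exp x * real n)\<bar> \<le> 1" for x :: real by simp
  have "relax_factor \<alpha> \<mu> n - mittag_leffler_relax \<alpha> \<mu> (real n)
    = (LBINT x. \<mu> * \<rho> x / exp x * (1 / (1 + exp x) ^ n) - \<mu> * \<rho> x / exp x * exp (- exp x * real n))"
    unfolding relax_factor_integral[OF \<mu>0] mittag_leffler_relax_def if_not_P[OF False]
    by (rule Bochner_Integration.integral_diff[symmetric];
        rule relax_weighted(1)[OF \<mu>0 _ inverse_power_abs_le1] relax_weighted(1)[OF \<mu>0 _ eb]; simp)
  also have "\<dots> = (LBINT x. \<mu> * \<rho> x / exp x * (1 / (1 + exp x) ^ n - exp (- exp x * real n)))"
    by (simp only: right_diff_distrib)
  also have "\<bar>\<dots>\<bar> \<le> 2 / real n"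
    by (rule relax_weighted(2)[OF \<mu>0]) (use exp_rational_diff[OF _ n] in auto)
  finally show ?thesis .
qed

text \<open>After multiplication by \<open>1 + \<mu>\<close> the part with \<open>\<mu>\<^sup>2\<close> is dominated by the density for the
  exponent \<open>1 - \<alpha>\<close> and \<open>\<mu> = 0\<close>, whose integral is known.\<close>

lemma relax_factor_diff2:
  assumes n: "3 \<le> n"
  shows "(1 + \<mu>) * \<bar>diff2 (relax_factor \<alpha> \<mu>) n\<bar>
    \<le> 18 / ((sin (pi * \<alpha>))\<^sup>2 * (real n)\<^sup>2)"
proof (cases "\<mu> = 0")
  case True
  then show ?thesis by (simp add: relax_factor_def)
next
  case False
  hence \<mu>0: "0 < \<mu>" using \<mu> by simp
  obtain k where k: "n = k + 3" using n by (metis add.commute le_Suc_ex)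
  define S where "S = (sin (pi * \<alpha>))\<^sup>2"
  have S: "0 < S" "S \<le> 1" using sin_pi_pos[OF \<alpha> \<mu>] by (auto simp: S_def abs_square_le_1)
  define g where "g = (\<lambda>x::real. (exp x)\<^sup>2 / (1 + exp x) ^ n)"
  have g: "\<bar>g x\<bar> \<le> 1" for x
  proof -
    have "(exp x)\<^sup>2 \<le> (1 + exp x)\<^sup>2" by (intro power_mono) auto
    also have "\<dots> \<le> (1 + exp x) ^ n" using n by (intro power_increasing) auto
    finally show ?thesis using one_plus_exp_gt[of x] by (simp add: g_def)
  qed
  have gm: "g \<in> borel_measurable borel" unfolding g_def by measurable
  \<comment> \<open>Increments of the factor are kernel values, so its second difference is a first
    difference of the kernel. Only indices from 1 on occur because \<open>3 \<le> n\<close>; this is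
    the spare power of \<open>1 / (1 + r)\<close>.\<close>
  have "diff2 (relax_factor \<alpha> \<mu>) n
     = \<mu> * (res_kernel \<alpha> \<mu> (k + 1) - res_kernel \<alpha> \<mu> (k + 2))"
    by (simp add: k relax_factor_def eval_nat_numeral algebra_simps)
  also have "res_kernel \<alpha> \<mu> (k + 1) - res_kernel \<alpha> \<mu> (k + 2)
     = (LBINT x. \<rho> x / (1 + exp x) * (1 / (1 + exp x) ^ (k + 1)) - \<rho> x / (1 + exp x) * (1 / (1 + exp x) ^ (k + 2)))"
    unfolding res_kernel_def by (rule Bochner_Integration.integral_diff[symmetric]; rule res_kernel_integrable)
  also have "\<dots> = (LBINT x. \<rho> x / exp x * g x)"
  proof (rule Bochner_Integration.integral_cong[OF refl])
    fix x :: real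
    have e: "q / (1 + r) * (1 / ((1 + r) * P)) - q / (1 + r) * (1 / ((1 + r) * ((1 + r) * P))) = q / r * (r\<^sup>2 / ((1 + r) * ((1 + r) * ((1 + r) * P))))"
      if "r > 0" "P > 0" for q r P :: real
    proof -
      have "q / (1 + r) * (1 / ((1 + r) * P)) = q * (1 + r) / ((1 + r) * ((1 + r) * ((1 + r) * P)))"
        "q / (1 + r) * (1 / ((1 + r) * ((1 + r) * P))) = q / ((1 + r) * ((1 + r) * ((1 + r) * P)))"
        "q / r * (r\<^sup>2 / ((1 + r) * ((1 + r) * ((1 + r) * P)))) = q * r / ((1 + r) * ((1 + r) * ((1 + r) * P)))"
        using that by (simp_all add: power2_eq_square)
      then show ?thesis by (simp add: algebra_simps flip: diff_divide_distrib)
    qed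
    show "\<rho> x / (1 + exp x) * (1 / (1 + exp x) ^ (k + 1)) - \<rho> x / (1 + exp x) * (1 / (1 + exp x) ^ (k + 2)) = \<rho> x / exp x * g x"
      using e[of "exp x" "(1 + exp x) ^ k" "\<rho> x"] one_plus_exp_gt[of x] by (simp add: g_def k eval_nat_numeral)
  qed
  finally have "(1 + \<mu>) * (diff2 (relax_factor \<alpha> \<mu>) n)
     = (1 + \<mu>) * (LBINT x. \<mu> * \<rho> x / exp x * g x)"
    by (simp add: mult.assoc flip: integral_mult_right_zero)
  then have "\<bar>(1 + \<mu>) * (diff2 (relax_factor \<alpha> \<mu>) n)\<bar>
     = \<bar>LBINT x. (1 + \<mu>) * (\<mu> * \<rho> x / exp x * g x)\<bar>"
    by (simp only: integral_mult_right_zero)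
  also have "\<dots> \<le> (LBINT x. \<bar>(1 + \<mu>) * (\<mu> * \<rho> x / exp x * g x)\<bar>)"
    by (rule integral_abs_bound)
  also have "\<dots> \<le> (LBINT x. 2 / (real n * (real n - 1)) * (\<mu> * \<rho> x / exp x)
        + 2 / (S * (real (n - 1) * (real (n - 1) - 1))) * (res_density (1 - \<alpha>) 0 x / (1 + exp x)))"
  proof (rule integral_mono)
    show "integrable lborel (\<lambda>x. \<bar>(1 + \<mu>) * (\<mu> * \<rho> x / exp x * g x)\<bar>)"
      by (intro integrable_abs integrable_mult_right relax_weighted(1)[OF \<mu>0 gm g])
    show "integrable lborel (\<lambda>x. 2 / (real n * (real n - 1)) * (\<mu> * \<rho> x / exp x)
        + 2 / (S * (real (n - 1) * (real (n - 1) - 1))) * (res_density (1 - \<alpha>) 0 x / (1 + exp x)))"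
      using integrable.intros[OF res_density_Stieltjes[of "1 - \<alpha>" 0 1]] \<alpha> integrable.intros[OF res_density_over_exp[OF \<mu>0]]
      by (intro Bochner_Integration.integrable_add integrable_mult_right) auto
    fix x :: real
    define r where "r = exp x"
    define w where "w = \<rho> x"
    have r: "0 < r" by (simp add: r_def)
    have w: "0 \<le> w" unfolding w_def by (rule res_density_nonneg[OF \<alpha> \<mu>])
    have g1: "g x \<le> 2 / (real n * (real n - 1))"
      unfolding g_def using n by (intro square_div_power_le) auto
    have g2: "r\<^sup>2 / (1 + r) ^ (n - 1) \<le> 2 / (real (n - 1) * (real (n - 1) - 1))"
      using n r by (intro square_div_power_le) auto
    have g0: "0 \<le> g x" using one_plus_exp_gt[of x] by (simp add: g_def)
    \<comment> \<open>The bound \<open>res_denom_ge2\<close> replaces \<open>\<mu>^2 / D\<close> by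
      \<open>1 / S\<close>; what remains is a multiple of \<open>exp (\<alpha> * x)\<close>, the
      density for exponent \<open>1 - \<alpha>\<close> and parameter 0.\<close>
    have d: "\<mu>\<^sup>2 * w / r \<le> res_density (1 - \<alpha>) 0 x / S"
    proof -
      define D where "D = (exp (\<alpha> * x))\<^sup>2 + 2 * \<mu> * exp (\<alpha> * x) * cos (pi * \<alpha>) + \<mu>\<^sup>2"
      have D: "\<mu>\<^sup>2 * S \<le> D" "0 < D"
        using res_denom_ge2[OF \<alpha> \<mu>, of x] res_denom_pos[OF \<alpha> \<mu>, of x] by (auto simp: D_def S_def power_mult_distrib)
      have s1: "sin (pi * (1 - \<alpha>)) = sin (pi * \<alpha>)" by (simp add: right_diff_distrib)
      have e1: "exp ((1 - \<alpha>) * x) = r / exp (\<alpha> * x)" by (simp add: r_def algebra_simps exp_diff)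
      have q: "res_density (1 - \<alpha>) 0 x = sin (pi * \<alpha>) / pi * exp (\<alpha> * x)"
        unfolding res_density_def s1 e1 using r by (simp add: power2_eq_square flip: r_def)
      have "\<mu>\<^sup>2 * w / r = (sin (pi * \<alpha>) / pi * exp (\<alpha> * x)) * (\<mu>\<^sup>2 / D)"
        using r unfolding w_def res_density_def D_def[symmetric] r_def[symmetric] by simp
      also have "\<dots> \<le> (sin (pi * \<alpha>) / pi * exp (\<alpha> * x)) * (1 / S)"
        using D S sin_pi_pos[OF \<alpha> \<mu>] by (intro mult_left_mono) (auto simp: field_simps)
      finally show ?thesis by (simp add: q)
    qed
    have "\<bar>(1 + \<mu>) * (\<mu> * w / r * g x)\<bar> = \<mu> * w / r * g x + \<mu>\<^sup>2 * w / r * g x"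
      using \<mu> w r g0 by (simp add: algebra_simps power2_eq_square add_divide_distrib)
    also have "\<dots> \<le> \<mu> * w / r * (2 / (real n * (real n - 1))) + res_density (1 - \<alpha>) 0 x / S * (1 / (1 + r) * (2 / (real (n - 1) * (real (n - 1) - 1))))"
    proof (intro add_mono mult_mono d)
      \<comment> \<open>One factor \<open>1 / (1 + r)\<close> makes the growing density for
        \<open>1 - \<alpha>\<close> integrable, with integral 1. The remaining
        \<open>n - 1 \<ge> 2\<close> powers still give \<open>O(n^-2)\<close>.\<close>
      have "g x = 1 / (1 + r) * (r\<^sup>2 / (1 + r) ^ (n - 1))"
        using n by (cases n) (auto simp: g_def r_def)
      also have "\<dots> \<le> 1 / (1 + r) * (2 / (real (n - 1) * (real (n - 1) - 1)))"
        using r g2 by (intro mult_left_mono) auto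
      finally show "g x \<le> 1 / (1 + r) * (2 / (real (n - 1) * (real (n - 1) - 1)))" .
      show "0 \<le> res_density (1 - \<alpha>) 0 x / S"
        using S \<alpha> by (intro divide_nonneg_pos res_density_nonneg) auto
    qed (use \<mu> w r g0 g1 in auto)
    finally show "\<bar>(1 + \<mu>) * (\<mu> * \<rho> x / exp x * g x)\<bar> \<le> 2 / (real n * (real n - 1)) * (\<mu> * \<rho> x / exp x)
        + 2 / (S * (real (n - 1) * (real (n - 1) - 1))) * (res_density (1 - \<alpha>) 0 x / (1 + exp x))"
      unfolding r_def w_def by (simp add: mult_ac)
  qed
  also have "\<dots> = 2 / (real n * (real n - 1)) + 2 / (S * (real (n - 1) * (real (n - 1) - 1)))"
    using has_bochner_integral_integral_eq[OF has_bochner_integral_add[OF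
      has_bochner_integral_mult_right[OF res_density_over_exp[OF \<mu>0], of "2 / (real n * (real n - 1))"]
      has_bochner_integral_mult_right[OF res_density_Stieltjes[of "1 - \<alpha>" 0 1], of "2 / (S * (real (n - 1) * (real (n - 1) - 1)))"]]] \<alpha>
    by simp
  \<comment> \<open>Each of the two terms is at most half of the right-hand side; the second one
    with \<open>S = 1\<close> attains it at \<open>n = 3\<close>.\<close>
  also have "\<dots> \<le> 18 / (S * (real n)\<^sup>2)"
  proof -
    have 1: "2 / (real n * (real n - 1)) \<le> 9 / (S * (real n)\<^sup>2)"
    proof -
      have "2 / (real n * (real n - 1)) \<le> 9 / (real n)\<^sup>2"
        unfolding k by (simp add: divide_simps) (simp add: algebra_simps power2_eq_square)
      also have "\<dots> \<le> 9 / (S * (real n)\<^sup>2)"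
        using S n by (intro divide_left_mono) (auto simp: mult_left_le_one_le)
      finally show ?thesis .
    qed
    have "2 / (real (n - 1) * (real (n - 1) - 1)) \<le> 9 / (real n)\<^sup>2"
      unfolding k by (simp add: divide_simps) (simp add: algebra_simps power2_eq_square)
    from divide_right_mono[OF this, of S] S have "2 / (S * (real (n - 1) * (real (n - 1) - 1))) \<le> 9 / (S * (real n)\<^sup>2)"
      by (simp add: mult.commute)
    with 1 show ?thesis by simp
  qed
  finally show ?thesis using \<mu> by (simp add: abs_mult S_def)
qed

end

section \<open>The fractional relaxation equation\<close>

text \<open>The Riemann-Liouville kernel of order \<beta>, extended by zero so that causal
  convolutions are integrals over the whole line and Fubini applies without moving limits.\<close>

definition frac_kernel :: "real \<Rightarrow> real \<Rightarrow> real" where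
  "frac_kernel \<beta> t = indicator {0<..} t * t powr (\<beta> - 1) / Gamma \<beta>"

lemma frac_kernel_nonneg: "0 < \<beta> \<Longrightarrow> 0 \<le> frac_kernel \<beta> t"
  by (simp add: frac_kernel_def Gamma_real_pos less_imp_le)

lemma frac_kernel_nonpos: "t \<le> 0 \<Longrightarrow> frac_kernel \<beta> t = 0"
  by (simp add: frac_kernel_def)

lemma frac_kernel_pos: "0 < t \<Longrightarrow> frac_kernel \<beta> t = t powr (\<beta> - 1) / Gamma \<beta>"
  by (simp add: frac_kernel_def)

lemma frac_kernel_measurable [measurable]: "frac_kernel \<beta> \<in> borel_measurable borel"
  unfolding frac_kernel_def by measurable

lemma frac_kernel_Laplace:
  assumes \<beta>: "0 < \<beta>" and p: "0 < p"
  shows "has_bochner_integral lborel (\<lambda>t. frac_kernel \<beta> t * exp (- p * t)) (p powr (- \<beta>))"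
proof -
  define g where "g = (\<lambda>t::real. indicator {0..} t * t powr (\<beta> - 1) / exp t)"
  have G: "Gamma \<beta> \<noteq> 0" using Gamma_real_pos[OF \<beta>] by linarith
  have "has_bochner_integral lborel g (Gamma \<beta>)"
    by (rule has_bochner_integral_nn_integral)
      (use Gamma_conv_nn_integral_real[OF \<beta>] \<beta> in \<open>auto simp: g_def Gamma_real_pos less_imp_le\<close>)
  then have "has_bochner_integral lborel (\<lambda>t. g (0 + p * t)) (Gamma \<beta> /\<^sub>R \<bar>p\<bar>)"
    using p by (subst (asm) lborel_has_bochner_integral_real_affine_iff[of p _ _ 0]) auto
  then have "has_bochner_integral lborel (\<lambda>t. g (0 + p * t) * (p powr (1 - \<beta>) / Gamma \<beta>)) (Gamma \<beta> /\<^sub>R \<bar>p\<bar> * (p powr (1 - \<beta>) / Gamma \<beta>))"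
    by (intro has_bochner_integral_mult_left) auto
  also have "Gamma \<beta> /\<^sub>R \<bar>p\<bar> * (p powr (1 - \<beta>) / Gamma \<beta>) = p powr (- \<beta>)"
    using p G by (simp add: powr_diff powr_minus_divide field_simps)
  also have "(\<lambda>t. g (0 + p * t) * (p powr (1 - \<beta>) / Gamma \<beta>)) = (\<lambda>t. frac_kernel \<beta> t * exp (- p * t))"
  proof
    fix t
    show "g (0 + p * t) * (p powr (1 - \<beta>) / Gamma \<beta>) = frac_kernel \<beta> t * exp (- p * t)"
    proof (cases "0 < t")
      case True
      then have "(p * t) powr (\<beta> - 1) * p powr (1 - \<beta>) = t powr (\<beta> - 1)"
        using p by (simp add: powr_mult flip: powr_add)
      then show ?thesis using True p by (simp add: g_def frac_kernel_def exp_minus field_simps)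
    next
      case False
      then show ?thesis using p by (cases "t = 0") (auto simp: g_def frac_kernel_def mult_pos_neg zero_le_mult_iff)
    qed
  qed
  finally show ?thesis .
qed

lemma exp_Laplace:
  assumes "0 < (p::real)"
  shows "has_bochner_integral lborel (\<lambda>t. indicator {0<..} t * exp (- p * t)) (1 / p)"
proof -
  have "frac_kernel 1 = (\<lambda>t. indicator {0<..} t)"
    by (auto simp: fun_eq_iff frac_kernel_def indicator_def)
  then show ?thesis
    using frac_kernel_Laplace[of 1 p] assms by (simp add: powr_minus_divide)
qed

text \<open>An affine substitution reduces this to the Beta integral, and
  \<open>Beta (1 - \<alpha>) \<alpha>\<close> is the product of the two Gamma values. It says that
  integration of order \<alpha> undoes the kernel of the Caputo derivative up to one ordinary
  integration.\<close>

lemma frac_kernel_conv: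
  assumes \<alpha>: "0 < \<alpha>" "\<alpha> < 1" and rt: "r < t"
  shows "has_bochner_integral lborel (\<lambda>s. frac_kernel \<alpha> (t - s) * frac_kernel (1 - \<alpha>) (s - r)) 1"
proof -
  define g where "g = (\<lambda>x::real. indicator {0..1} x *\<^sub>R (x powr ((1 - \<alpha>) - 1) * (1 - x) powr (\<alpha> - 1)))"
  define h where "h = (\<lambda>s. frac_kernel \<alpha> (t - s) * frac_kernel (1 - \<alpha>) (s - r))"
  have si: "set_integrable lborel {0..1} (\<lambda>x::real. x powr ((1 - \<alpha>) - 1) * (1 - x) powr (\<alpha> - 1))"
    using \<alpha> by (intro integrable_Beta) auto
  have "(LINT x:{0..1}|lborel. x powr ((1 - \<alpha>) - 1) * (1 - x) powr (\<alpha> - 1)) = Beta (1 - \<alpha>) \<alpha>"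
    unfolding set_borel_integral_eq_integral(2)[OF si]
    using \<alpha> by (intro integral_unique has_integral_Beta_real) auto
  also have "\<dots> = Gamma \<alpha> * Gamma (1 - \<alpha>)" by (simp add: Beta_def)
  finally have g: "has_bochner_integral lborel g (Gamma \<alpha> * Gamma (1 - \<alpha>))"
    using si by (simp add: g_def has_bochner_integral_iff set_integrable_def set_lebesgue_integral_def)
  have G: "0 < Gamma \<alpha>" "0 < Gamma (1 - \<alpha>)" using \<alpha> by (auto intro: Gamma_real_pos)
  have eq: "h (r + (t - r) * x) = g x / (Gamma \<alpha> * Gamma (1 - \<alpha>) * (t - r))" for x
  proof -
    have e1: "t - (r + (t - r) * x) = (t - r) * (1 - x)" "r + (t - r) * x - r = (t - r) * x"
      by (simp_all add: algebra_simps)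
    consider "0 < x" "x < 1" | "x \<le> 0" | "1 \<le> x" by linarith
    then show ?thesis
    proof cases
      case 1
      then have p: "0 < (t - r) * (1 - x)" "0 < (t - r) * x" using rt by auto
      have "((t - r) * (1 - x)) powr (\<alpha> - 1) * ((t - r) * x) powr (- \<alpha>)
        = ((t - r) powr (\<alpha> - 1) * (t - r) powr (- \<alpha>)) * ((1 - x) powr (\<alpha> - 1) * x powr (- \<alpha>))"
        using rt 1 by (simp add: powr_mult)
      also have "(t - r) powr (\<alpha> - 1) * (t - r) powr (- \<alpha>) = (t - r) powr (- 1)"
        by (simp flip: powr_add)
      also have "\<dots> = 1 / (t - r)" using rt by (simp add: powr_minus_divide)
      finally have k: "((t - r) * (1 - x)) powr (\<alpha> - 1) * ((t - r) * x) powr (- \<alpha>) = 1 / (t - r) * (x powr (- \<alpha>) * (1 - x) powr (\<alpha> - 1))"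
        by (simp only: mult_ac)
      have "h (r + (t - r) * x) = ((t - r) * (1 - x)) powr (\<alpha> - 1) * ((t - r) * x) powr (- \<alpha>) / (Gamma \<alpha> * Gamma (1 - \<alpha>))"
        unfolding h_def e1 frac_kernel_pos[OF p(1)] frac_kernel_pos[OF p(2)] by simp
      also have "\<dots> = g x / (Gamma \<alpha> * Gamma (1 - \<alpha>) * (t - r))"
        unfolding k using 1 by (simp add: g_def)
      finally show ?thesis .
    next
      case 2
      then have "(t - r) * x \<le> 0" using rt by (simp add: mult_le_0_iff)
      moreover have "g x = 0" using 2 by (cases "x = 0") (auto simp: g_def)
      ultimately show ?thesis unfolding h_def e1 by (simp add: frac_kernel_nonpos)
    next
      case 3
      then have "(t - r) * (1 - x) \<le> 0" using rt by (simp add: mult_le_0_iff)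
      moreover have "g x = 0" using 3 by (cases "x = 1") (auto simp: g_def)
      ultimately show ?thesis unfolding h_def e1 by (simp add: frac_kernel_nonpos)
    qed
  qed
  have "has_bochner_integral lborel (\<lambda>x. g x / (Gamma \<alpha> * Gamma (1 - \<alpha>) * (t - r))) (Gamma \<alpha> * Gamma (1 - \<alpha>) / (Gamma \<alpha> * Gamma (1 - \<alpha>) * (t - r)))"
    using g by (intro has_bochner_integral_divide_zero) auto
  then have "has_bochner_integral lborel (\<lambda>x. h (r + (t - r) * x)) (1 /\<^sub>R \<bar>t - r\<bar>)"
    unfolding eq using G rt by (simp add: inverse_eq_divide)
  then have "has_bochner_integral lborel h 1"
    using rt by (subst lborel_has_bochner_integral_real_affine_iff[of "t - r" _ _ r]) auto
  then show ?thesis by (simp add: h_def)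
qed

lemma integral_shift_lborel:
  fixes f :: "real \<Rightarrow> real"
  shows "(LBINT t. f (t - s)) = integral\<^sup>L lborel f"
    and "integrable lborel f \<Longrightarrow> integrable lborel (\<lambda>t. f (t - s))"
  using lborel_integral_real_affine[of 1 f "- s"] lborel_integrable_real_affine[of f 1 "- s"] by auto

lemma convolution_lborel:
  fixes f g :: "real \<Rightarrow> real"
  assumes f: "integrable lborel f" and g: "integrable lborel g"
  shows "integrable lborel (\<lambda>t. LBINT s. f (t - s) * g s)"
    and "(LBINT t. (LBINT s. f (t - s) * g s)) = integral\<^sup>L lborel f * integral\<^sup>L lborel g"
proof -
  have [measurable]: "f \<in> borel_measurable borel" "g \<in> borel_measurable borel"
    using borel_measurable_integrable[OF f] borel_measurable_integrable[OF g] by auto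
  define H where "H = (\<lambda>s t. f (t - s) * g s)"
  have int: "integrable (lborel \<Otimes>\<^sub>M lborel) (case_prod H)"
  proof (rule lborel_pair.Fubini_integrable)
    show "case_prod H \<in> borel_measurable (lborel \<Otimes>\<^sub>M lborel)" unfolding H_def by measurable
    have "(LBINT t. norm (case_prod H (s, t))) = (LBINT t. \<bar>f t\<bar>) * \<bar>g s\<bar>" for s
      using integral_shift_lborel(1)[of "\<lambda>t. \<bar>f t\<bar>" s] by (simp add: H_def abs_mult)
    then show "integrable lborel (\<lambda>s. LBINT t. norm (case_prod H (s, t)))"
      using g by simp
    show "AE s in lborel. integrable lborel (\<lambda>t. case_prod H (s, t))"
      using integral_shift_lborel(2)[OF f] by (simp add: H_def)
  qed
  show "integrable lborel (\<lambda>t. LBINT s. f (t - s) * g s)"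
    using lborel_pair.integrable_snd[OF int] by (simp add: H_def)
  have "(LBINT t. (LBINT s. f (t - s) * g s)) = (LBINT s. (LBINT t. f (t - s) * g s))"
    using lborel_pair.Fubini_integral[OF int] by (simp add: H_def)
  also have "\<dots> = (LBINT s. integral\<^sup>L lborel f * g s)"
    using integral_shift_lborel(1)[of f] by simp
  finally show "(LBINT t. (LBINT s. f (t - s) * g s)) = integral\<^sup>L lborel f * integral\<^sup>L lborel g"
    by simp
qed

section \<open>From the Caputo equation to a Volterra equation and its Laplace transform\<close>

text \<open>Apply fractional integration of order \<alpha> to the equation. After exchanging the
  integrals the two kernels integrate to 1, and what is left is the integral of the
  derivative.\<close>

lemma Caputo_Volterra:
  assumes \<alpha>: "0 < \<alpha>" "\<alpha> < 1"
    and cont: "continuous_on {0..} w" and diff: "\<And>t. 0 < t \<Longrightarrow> w differentiable (at t)"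
    and int: "\<And>t. 0 < t \<Longrightarrow> set_integrable lborel {0<..<t} (\<lambda>s. (t - s) powr (- \<alpha>) * deriv w s)"
    and eq: "\<And>t. 0 < t \<Longrightarrow> caputo \<alpha> w t = - \<nu> * w t"
    and t: "0 < t"
  shows "w t + \<nu> * (LBINT s. frac_kernel \<alpha> (t - s) * (indicator {0<..} s * w s)) = w 0"
proof -
  \<comment> \<open>The weight \<open>(t - s) powr (- \<alpha>)\<close> is bounded below by
    \<open>t powr (- \<alpha>)\<close>, so the derivative itself is integrable down to time 0,
    although \<open>w\<close> need not be differentiable there.\<close>
  define D where "D = (\<lambda>r. indicator {0<..<t} r * deriv w r)"
  have Dint: "integrable lborel D"
  proof (rule Bochner_Integration.integrable_bound)
    have i: "integrable lborel (\<lambda>s. indicator {0<..<t} s * ((t - s) powr (- \<alpha>) * deriv w s))"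
      using int[OF t] by (simp add: set_integrable_def)
    show "integrable lborel (\<lambda>s. t powr \<alpha> * (indicator {0<..<t} s * ((t - s) powr (- \<alpha>) * deriv w s)))"
      using i by (rule integrable_mult_right)
    have [measurable]: "(\<lambda>s. indicator {0<..<t} s * ((t - s) powr (- \<alpha>) * deriv w s)) \<in> borel_measurable lborel"
      using i by (rule borel_measurable_integrable)
    have "D = (\<lambda>s. (t - s) powr \<alpha> * (indicator {0<..<t} s * ((t - s) powr (- \<alpha>) * deriv w s)))"
    proof
      fix s
      show "D s = (t - s) powr \<alpha> * (indicator {0<..<t} s * ((t - s) powr (- \<alpha>) * deriv w s))"
        by (cases "s \<in> {0<..<t}") (simp_all add: D_def flip: powr_add mult.assoc)
    qed
    also have "\<dots> \<in> borel_measurable lborel" by measurable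
    finally show "D \<in> borel_measurable lborel" .
    show "AE s in lborel. norm (D s) \<le> norm (t powr \<alpha> * (indicator {0<..<t} s * ((t - s) powr (- \<alpha>) * deriv w s)))"
    proof (rule AE_I2)
      fix s
      show "norm (D s) \<le> norm (t powr \<alpha> * (indicator {0<..<t} s * ((t - s) powr (- \<alpha>) * deriv w s)))"
      proof (cases "s \<in> {0<..<t}")
        case True
        have "1 = (t - s) powr \<alpha> * (t - s) powr (- \<alpha>)" using True by (simp flip: powr_add)
        also have "\<dots> \<le> t powr \<alpha> * (t - s) powr (- \<alpha>)"
          using True \<alpha> by (intro mult_right_mono powr_mono2) auto
        finally have "1 * \<bar>deriv w s\<bar> \<le> t powr \<alpha> * (t - s) powr (- \<alpha>) * \<bar>deriv w s\<bar>"
          by (intro mult_right_mono) auto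
        then show ?thesis using True by (simp add: D_def abs_mult mult_ac)
      qed (simp add: D_def)
    qed
  qed
  have [measurable]: "D \<in> borel_measurable borel" using borel_measurable_integrable[OF Dint] by simp
  have si: "set_integrable lborel {0<..<t} (deriv w)"
    using Dint by (simp add: D_def set_integrable_def)
  have "(deriv w has_integral (w t - w 0)) {0..t}"
  proof (rule fundamental_theorem_of_calculus_interior)
    show "continuous_on {0..t} w" using cont by (rule continuous_on_subset) auto
    show "(w has_vector_derivative deriv w s) (at s)" if "s \<in> {0<..<t}" for s
      using diff[of s] that
      by (metis DERIV_deriv_iff_real_differentiable greaterThanLessThan_iff has_real_derivative_iff_has_vector_derivative)
  qed (use t in auto)
  then have "(deriv w has_integral (w t - w 0)) {0<..<t}"
    by (simp add: has_integral_Icc_iff_Ioo)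
  then have D1: "integral\<^sup>L lborel D = w t - w 0"
    using set_borel_integral_eq_integral(2)[OF si] by (simp add: integral_unique set_lebesgue_integral_def D_def)
  \<comment> \<open>Both kernels are nonnegative, so integrating the absolute value over
    \<open>s\<close> gives exactly \<open>\<bar>D r\<bar>\<close>; this is the integrability needed
    for Fubini.\<close>
  define H where "H = (\<lambda>r s. frac_kernel \<alpha> (t - s) * frac_kernel (1 - \<alpha>) (s - r) * D r)"
  have Dz: "D r = 0" if "\<not> r < t" for r using that by (simp add: D_def)
  have absH: "norm (H r s) = frac_kernel \<alpha> (t - s) * frac_kernel (1 - \<alpha>) (s - r) * \<bar>D r\<bar>" for r s
    using \<alpha> frac_kernel_nonneg[of \<alpha>] frac_kernel_nonneg[of "1 - \<alpha>"] by (simp add: H_def abs_mult)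
  have inner: "(LBINT s. H r s) = D r" "(LBINT s. norm (H r s)) = \<bar>D r\<bar>" "integrable lborel (H r)" for r
  proof -
    show "(LBINT s. H r s) = D r"
      using frac_kernel_conv[OF \<alpha>, of r t] Dz[of r] by (cases "r < t") (auto simp: H_def has_bochner_integral_iff)
    show "(LBINT s. norm (H r s)) = \<bar>D r\<bar>"
      unfolding absH using frac_kernel_conv[OF \<alpha>, of r t] Dz[of r] by (cases "r < t") (auto simp: has_bochner_integral_iff)
    show "integrable lborel (H r)"
      using frac_kernel_conv[OF \<alpha>, of r t] Dz[of r] by (cases "r < t") (auto simp: H_def[abs_def] has_bochner_integral_iff)
  qed
  have Hint: "integrable (lborel \<Otimes>\<^sub>M lborel) (case_prod H)"
  proof (rule lborel_pair.Fubini_integrable)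
    show "case_prod H \<in> borel_measurable (lborel \<Otimes>\<^sub>M lborel)" unfolding H_def by measurable
    show "integrable lborel (\<lambda>r. LBINT s. norm (case_prod H (r, s)))"
      using Dint by (simp add: inner del: real_norm_def)
    show "AE r in lborel. integrable lborel (\<lambda>s. case_prod H (r, s))"
      using inner(3) by simp
  qed
  have "(LBINT s. frac_kernel \<alpha> (t - s) * (- \<nu> * (indicator {0<..} s * w s))) = (LBINT s. (LBINT r. H r s))"
  proof (rule Bochner_Integration.integral_cong[OF refl])
    fix s :: real
    show "frac_kernel \<alpha> (t - s) * (- \<nu> * (indicator {0<..} s * w s)) = (LBINT r. H r s)"
    proof (cases "s \<in> {0<..<t}")
      case False
      then have "frac_kernel \<alpha> (t - s) * (- \<nu> * (indicator {0<..} s * w s)) = 0"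
        by (auto simp: frac_kernel_def)
      moreover have "H r s = 0" for r using False by (auto simp: H_def frac_kernel_def D_def indicator_def)
      ultimately show ?thesis by simp
    next
      case True
      then have "- \<nu> * w s = 1 / Gamma (1 - \<alpha>) * (LBINT r. indicator {0<..<s} r * ((s - r) powr (- \<alpha>) * deriv w r))"
        using eq[of s] by (simp add: caputo_def set_lebesgue_integral_def)
      also have "\<dots> = (LBINT r. 1 / Gamma (1 - \<alpha>) * (indicator {0<..<s} r * ((s - r) powr (- \<alpha>) * deriv w r)))"
        by (rule integral_mult_right_zero[symmetric])
      also have "\<dots> = (LBINT r. frac_kernel (1 - \<alpha>) (s - r) * D r)"
        by (rule Bochner_Integration.integral_cong[OF refl])
          (use True in \<open>auto simp: frac_kernel_def D_def indicator_def\<close>)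
      finally have "frac_kernel \<alpha> (t - s) * (- \<nu> * w s) = (LBINT r. frac_kernel \<alpha> (t - s) * (frac_kernel (1 - \<alpha>) (s - r) * D r))"
        by (simp only: integral_mult_right_zero)
      then show ?thesis using True by (simp add: H_def mult.assoc)
    qed
  qed
  also have "\<dots> = (LBINT r. (LBINT s. H r s))"
    by (rule lborel_pair.Fubini_integral[OF Hint])
  also have "\<dots> = w t - w 0" by (simp add: inner D1)
  also have "(LBINT s. frac_kernel \<alpha> (t - s) * (- \<nu> * (indicator {0<..} s * w s)))
    = - \<nu> * (LBINT s. frac_kernel \<alpha> (t - s) * (indicator {0<..} s * w s))"
    by (subst integral_mult_right_zero[symmetric]) (simp only: mult_ac)
  finally show ?thesis by simp
qed

text \<open>In the weighted supremum norm the Volterra operator has norm at most \<open>1 / 2\<close>.\<close>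

lemma Volterra_growth:
  assumes \<alpha>: "0 < \<alpha>" and \<nu>: "0 \<le> \<nu>"
    and cont: "continuous_on {0..} w"
    and V: "\<And>t. 0 < t \<Longrightarrow> w t + \<nu> * (LBINT s. frac_kernel \<alpha> (t - s) * (indicator {0<..} s * w s)) = w 0"
    and \<sigma>: "0 < \<sigma>" "\<nu> * \<sigma> powr (- \<alpha>) \<le> 1 / 2" and t: "0 \<le> t"
  shows "\<bar>w t\<bar> \<le> 2 * \<bar>w 0\<bar> * exp (\<sigma> * t)"
proof -
  define v where "v = (\<lambda>s. exp (- \<sigma> * s) * \<bar>w s\<bar>)"
  have "continuous_on {0..t} v"
    unfolding v_def using cont by (intro continuous_intros) (rule continuous_on_subset, auto)
  then obtain x where x: "x \<in> {0..t}" and mx: "\<And>s. s \<in> {0..t} \<Longrightarrow> v s \<le> v x"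
    using continuous_attains_sup[of "{0..t}" v] t by auto
  have "v x \<le> 2 * \<bar>w 0\<bar>"
  proof (cases "x = 0")
    case True
    then show ?thesis by (simp add: v_def)
  next
    case False
    hence x0: "0 < x" using x by auto
    have k: "has_bochner_integral lborel (\<lambda>s. frac_kernel \<alpha> (x - s) * exp (- \<sigma> * (x - s))) (\<sigma> powr (- \<alpha>))"
      using lborel_has_bochner_integral_real_affine_iff[of "-1" "\<lambda>t. frac_kernel \<alpha> t * exp (- \<sigma> * t)" "\<sigma> powr (- \<alpha>)" x]
        frac_kernel_Laplace[OF \<alpha> \<sigma>(1)] by simp
    have le: "\<bar>frac_kernel \<alpha> (x - s) * (indicator {0<..} s * w s)\<bar> \<le> exp (\<sigma> * x) * v x * (frac_kernel \<alpha> (x - s) * exp (- \<sigma> * (x - s)))" for s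
    proof (cases "0 < s \<and> s < x")
      case True
      have "v s \<le> v x" using True x by (intro mx) auto
      moreover have "\<bar>w s\<bar> = exp (\<sigma> * s) * v s" by (simp add: v_def exp_minus)
      ultimately have "\<bar>w s\<bar> \<le> exp (\<sigma> * s) * v x" by simp
      hence "frac_kernel \<alpha> (x - s) * \<bar>w s\<bar> \<le> frac_kernel \<alpha> (x - s) * (exp (\<sigma> * s) * v x)"
        by (intro mult_left_mono frac_kernel_nonneg \<alpha>)
      moreover have "exp (\<sigma> * s) = exp (\<sigma> * x) * exp (- \<sigma> * (x - s))"
        by (simp add: algebra_simps flip: exp_add)
      ultimately show ?thesis using True frac_kernel_nonneg[OF \<alpha>, of "x - s"] by (simp add: abs_mult mult_ac)
    next
      case False
      have "0 \<le> v x" by (simp add: v_def)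
      then have "0 \<le> exp (\<sigma> * x) * v x * (frac_kernel \<alpha> (x - s) * exp (- \<sigma> * (x - s)))"
        using frac_kernel_nonneg[OF \<alpha>] by simp
      then show ?thesis using False by (auto simp: frac_kernel_def indicator_def)
    qed
    have "\<bar>LBINT s. frac_kernel \<alpha> (x - s) * (indicator {0<..} s * w s)\<bar> \<le> exp (\<sigma> * x) * v x * \<sigma> powr (- \<alpha>)"
    proof (cases "integrable lborel (\<lambda>s. frac_kernel \<alpha> (x - s) * (indicator {0<..} s * w s))")
      case True
      have "\<bar>LBINT s. frac_kernel \<alpha> (x - s) * (indicator {0<..} s * w s)\<bar> \<le> (LBINT s. \<bar>frac_kernel \<alpha> (x - s) * (indicator {0<..} s * w s)\<bar>)"
        by (rule integral_abs_bound)
      also have "\<dots> \<le> (LBINT s. exp (\<sigma> * x) * v x * (frac_kernel \<alpha> (x - s) * exp (- \<sigma> * (x - s))))"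
        by (rule integral_mono[OF integrable_abs[OF True] integrable_mult_right[OF integrable.intros[OF k]] le])
      also have "\<dots> = exp (\<sigma> * x) * v x * \<sigma> powr (- \<alpha>)"
        using has_bochner_integral_integral_eq[OF k] by simp
      finally show ?thesis .
    next
      \<comment> \<open>A function that is not integrable has integral 0, for which the bound is
        trivial.\<close>
      case False
      have "0 \<le> v x" by (simp add: v_def)
      then show ?thesis by (simp add: not_integrable_integral_eq[OF False])
    qed
    then have "\<nu> * \<bar>LBINT s. frac_kernel \<alpha> (x - s) * (indicator {0<..} s * w s)\<bar> \<le> \<nu> * (exp (\<sigma> * x) * v x * \<sigma> powr (- \<alpha>))"
      using \<nu> by (rule mult_left_mono)
    also have "\<dots> = exp (\<sigma> * x) * v x * (\<nu> * \<sigma> powr (- \<alpha>))" by (simp only: mult_ac)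
    also have "\<dots> \<le> exp (\<sigma> * x) * v x * (1 / 2)"
      using \<sigma> by (intro mult_left_mono) (auto simp: v_def)
    finally have I: "\<bar>\<nu> * (LBINT s. frac_kernel \<alpha> (x - s) * (indicator {0<..} s * w s))\<bar> \<le> exp (\<sigma> * x) * v x / 2"
      using \<nu> by (simp add: abs_mult)
    have "exp (\<sigma> * x) * v x = \<bar>w x\<bar>" by (simp add: v_def exp_minus)
    with I V[OF x0] have "exp (\<sigma> * x) * v x \<le> \<bar>w 0\<bar> + exp (\<sigma> * x) * v x / 2" by linarith
    hence "exp (\<sigma> * x) * v x \<le> 2 * \<bar>w 0\<bar>" by simp
    moreover have "1 * v x \<le> exp (\<sigma> * x) * v x"
      using \<sigma> x0 by (intro mult_right_mono) (auto simp: v_def)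
    ultimately show ?thesis by simp
  qed
  with mx[of t] t have "exp (- \<sigma> * t) * \<bar>w t\<bar> \<le> 2 * \<bar>w 0\<bar>" by (simp add: v_def)
  hence "exp (\<sigma> * t) * (exp (- \<sigma> * t) * \<bar>w t\<bar>) \<le> exp (\<sigma> * t) * (2 * \<bar>w 0\<bar>)" by (intro mult_left_mono) auto
  then show ?thesis by (simp add: mult_ac exp_minus)
qed

lemma integrable_Laplace:
  fixes w :: "real \<Rightarrow> real"
  assumes cont: "continuous_on {0..} w" and bd: "\<And>t. 0 \<le> t \<Longrightarrow> \<bar>w t\<bar> \<le> C * exp (\<sigma> * t)" and p: "\<sigma> < p"
  shows "integrable lborel (\<lambda>t. indicator {0<..} t * w t * exp (- p * t))"
proof (rule Bochner_Integration.integrable_bound)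
  show "integrable lborel (\<lambda>t. C * (indicator {0<..} t * exp (- (p - \<sigma>) * t)))"
    using exp_Laplace[of "p - \<sigma>"] p by (intro integrable_mult_right) (auto simp: has_bochner_integral_iff)
  have "(\<lambda>t. indicator {0<..} t *\<^sub>R w t) \<in> borel_measurable borel"
    using cont by (intro borel_measurable_continuous_on_indicator) (auto intro: continuous_on_subset)
  then have [measurable]: "(\<lambda>t. indicator {0<..} t * w t) \<in> borel_measurable borel" by simp
  show "(\<lambda>t. indicator {0<..} t * w t * exp (- p * t)) \<in> borel_measurable lborel"
    by measurable
  show "AE t in lborel. norm (indicator {0<..} t * w t * exp (- p * t)) \<le> norm (C * (indicator {0<..} t * exp (- (p - \<sigma>) * t)))"
  proof (rule AE_I2)
    fix t
    show "norm (indicator {0<..} t * w t * exp (- p * t)) \<le> norm (C * (indicator {0<..} t * exp (- (p - \<sigma>) * t)))"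
    proof (cases "0 < t")
      case True
      have "\<bar>w t\<bar> * exp (- p * t) \<le> C * exp (\<sigma> * t) * exp (- p * t)"
        using bd[of t] True by (intro mult_right_mono) auto
      also have "\<dots> = C * exp (- (p - \<sigma>) * t)" by (simp add: algebra_simps flip: exp_add)
      finally show ?thesis using True by (simp add: abs_mult) (smt (verit) abs_ge_self exp_gt_zero mult_right_mono)
    qed simp
  qed
qed

text \<open>Multiplying by \<open>exp (- p * t)\<close> and integrating turns the convolution into a
  product, leaving a scalar linear equation for the transform. The growth bound ensures that the
  transform exists for \<open>p > \<sigma>\<close>.\<close>

lemma Volterra_Laplace:
  assumes \<alpha>: "0 < \<alpha>" and \<nu>: "0 \<le> \<nu>"
    and cont: "continuous_on {0..} w"
    and V: "\<And>t. 0 < t \<Longrightarrow> w t + \<nu> * (LBINT s. frac_kernel \<alpha> (t - s) * (indicator {0<..} s * w s)) = w 0"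
    and \<sigma>: "0 < \<sigma>" "\<nu> * \<sigma> powr (- \<alpha>) \<le> 1 / 2" and p: "\<sigma> < p"
  shows "(LBINT t. indicator {0<..} t * w t * exp (- p * t)) = w 0 * (p powr (\<alpha> - 1) / (p powr \<alpha> + \<nu>))"
proof -
  have p0: "0 < p" using \<sigma> p by simp
  define W where "W = (\<lambda>t. indicator {0<..} t * w t * exp (- p * t))"
  define K where "K = (\<lambda>t. frac_kernel \<alpha> t * exp (- p * t))"
  have Wi: "integrable lborel W"
    unfolding W_def by (rule integrable_Laplace[OF cont Volterra_growth[OF \<alpha> \<nu> cont V \<sigma>] p]) auto
  have Ki: "integrable lborel K" "integral\<^sup>L lborel K = p powr (- \<alpha>)"
    using frac_kernel_Laplace[OF \<alpha> p0] by (auto simp: K_def has_bochner_integral_iff)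
  \<comment> \<open>Valid for every real \<open>t\<close>: for \<open>t \<le> 0\<close> both sides
    vanish since all functions involved are extended by zero.\<close>
  have eq: "W t + \<nu> * (LBINT s. K (t - s) * W s) = w 0 * (indicator {0<..} t * exp (- p * t))" for t
  proof -
    have "K (t - s) * W s = exp (- p * t) * (frac_kernel \<alpha> (t - s) * (indicator {0<..} s * w s))" for s
      by (simp add: K_def W_def algebra_simps flip: exp_add)
    then have c: "(LBINT s. K (t - s) * W s) = exp (- p * t) * (LBINT s. frac_kernel \<alpha> (t - s) * (indicator {0<..} s * w s))"
      by simp
    show ?thesis
    proof (cases "0 < t")
      case True
      have "exp (- p * t) * (w t + \<nu> * (LBINT s. frac_kernel \<alpha> (t - s) * (indicator {0<..} s * w s))) = exp (- p * t) * w 0"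
        by (simp only: V[OF True])
      then show ?thesis unfolding c using True by (simp add: W_def distrib_left mult_ac)
    next
      case False
      then have "frac_kernel \<alpha> (t - s) * (indicator {0<..} s * w s) = 0" for s
        by (auto simp: frac_kernel_def indicator_def)
      then have "(LBINT s. frac_kernel \<alpha> (t - s) * (indicator {0<..} s * w s)) = 0"
        by (simp only: Bochner_Integration.integral_zero)
      then show ?thesis unfolding c using False by (simp add: W_def)
    qed
  qed
  have "w 0 * (1 / p) = (LBINT t. w 0 * (indicator {0<..} t * exp (- p * t)))"
    using has_bochner_integral_integral_eq[OF exp_Laplace[OF p0]] by simp
  also have "\<dots> = (LBINT t. W t + \<nu> * (LBINT s. K (t - s) * W s))"
    by (simp only: eq)
  also have "\<dots> = integral\<^sup>L lborel W + \<nu> * (p powr (- \<alpha>) * integral\<^sup>L lborel W)"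
    using convolution_lborel[OF Ki(1) Wi] Wi Ki by (subst Bochner_Integration.integral_add) auto
  finally have "w 0 / p = integral\<^sup>L lborel W * (1 + \<nu> * p powr (- \<alpha>))" by (simp add: algebra_simps)
  moreover have "1 + \<nu> * p powr (- \<alpha>) = (p powr \<alpha> + \<nu>) * p powr (- \<alpha>)"
    using p0 by (simp add: distrib_right flip: powr_add)
  ultimately have e: "w 0 / p = integral\<^sup>L lborel W * ((p powr \<alpha> + \<nu>) * p powr (- \<alpha>))" by simp
  have pos: "0 < p powr \<alpha> + \<nu>" using p0 \<nu> by (simp add: add_pos_nonneg)
  have "integral\<^sup>L lborel W = w 0 / p / ((p powr \<alpha> + \<nu>) * p powr (- \<alpha>))"
    using e pos p0 by simp
  also have "\<dots> = w 0 * (p powr (\<alpha> - 1) / (p powr \<alpha> + \<nu>))"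
    using p0 by (simp add: powr_diff powr_minus_divide)
  finally show ?thesis by (simp add: W_def)
qed

text \<open>In the variable \<open>x = e\<^sup>-\<^sup>t\<close> the hypothesis at integer points says that \<open>h\<close> is orthogonal to all
  polynomials, so the Weierstrass theorem applies.\<close>

lemma Laplace_unique:
  fixes h :: "real \<Rightarrow> real"
  assumes cont: "continuous_on {0..} h" and bd: "\<And>t. 0 \<le> t \<Longrightarrow> \<bar>h t\<bar> \<le> C * exp (\<sigma> * t)"
    and L: "\<And>p. \<sigma> < p \<Longrightarrow> (LBINT t. indicator {0<..} t * h t * exp (- p * t)) = 0"
    and t: "0 < t"
  shows "h t = 0"
proof -
  \<comment> \<open>The shift by \<open>\<sigma> + 1\<close> forces decay like
    \<open>exp (- t)\<close>, so that the function extends continuously by 0 to the point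
    \<open>x = 0\<close> that corresponds to infinite time.\<close>
  define G where "G = (\<lambda>t. h t * exp (- (\<sigma> + 1) * t))"
  have Gc: "continuous_on {0..} G" unfolding G_def by (intro continuous_intros cont)
  have C: "0 \<le> C" using bd[of 0] by simp
  have Gb: "\<bar>G s\<bar> \<le> C * exp (- 1 * s)" if "0 \<le> s" for s
  proof -
    have "\<bar>G s\<bar> \<le> C * exp (\<sigma> * s) * exp (- (\<sigma> + 1) * s)"
      unfolding G_def abs_mult using bd[OF that] by (simp add: mult_right_mono)
    also have "\<dots> = C * exp (- 1 * s)" by (simp add: algebra_simps flip: exp_add)
    finally show ?thesis .
  qed
  \<comment> \<open>The maximum keeps the argument of \<open>G\<close> in its domain for
    \<open>x > 1\<close>; on the unit interval it changes nothing.\<close>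
  define g where "g = (\<lambda>x::real. if x \<le> 0 then 0 else G (max 0 (- ln x)))"
  have gG: "g (exp (- s)) = G s" if "0 \<le> s" for s using that by (simp add: g_def)
  have gcont: "continuous_on {0..1} g"
    unfolding continuous_on_eq_continuous_within
  proof
    fix x :: real assume x: "x \<in> {0..1}"
    show "continuous (at x within {0..1}) g"
    proof (cases "x = 0")
      case True
      have "(g \<longlongrightarrow> 0) (at 0 within {0..1})"
      proof (rule Lim_null_comparison)
        show "((\<lambda>x. C * x) \<longlongrightarrow> 0) (at 0 within {0..1})" by (auto intro!: tendsto_eq_intros)
        show "\<forall>\<^sub>F x in at 0 within {0..1}. norm (g x) \<le> C * x"
          unfolding eventually_at
        proof (intro exI[of _ 1] conjI ballI impI)
          fix y :: real assume y: "y \<in> {0..1}" "y \<noteq> 0 \<and> dist y 0 < 1"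
          then have "0 < y" "0 \<le> - ln y" by auto
          then show "norm (g y) \<le> C * y" using Gb[of "- ln y"] by (simp add: g_def)
        qed simp
      qed
      then show ?thesis using True by (simp add: continuous_within g_def)
    next
      case False
      have "continuous_on {0<..} (\<lambda>x. G (max 0 (- ln x)))"
        by (rule continuous_on_compose2[OF Gc]) (auto intro!: continuous_intros)
      then have "isCont (\<lambda>x. G (max 0 (- ln x))) x"
        using False x by (simp add: continuous_on_eq_continuous_at)
      moreover have "\<forall>\<^sub>F y in nhds x. g y = G (max 0 (- ln y))"
        using False x by (intro eventually_nhds_in_open[of "{0<..}" x, THEN eventually_mono]) (auto simp: g_def)
      then have "isCont g x \<longleftrightarrow> isCont (\<lambda>x. G (max 0 (- ln x))) x"
        by (rule isCont_cong)
      ultimately have "isCont g x" by blast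
      then show ?thesis by (rule continuous_at_imp_continuous_at_within)
    qed
  qed
  define J where "J = (LBINT s. indicator {0<..} s * (G s)\<^sup>2 * exp (- 1 * s))"
  have Ji: "integrable lborel (\<lambda>s. indicator {0<..} s * (G s)\<^sup>2 * exp (- 1 * s))"
  proof (rule integrable_Laplace[where \<sigma> = "-2" and C = "C\<^sup>2"])
    show "continuous_on {0..} (\<lambda>s. (G s)\<^sup>2)" by (intro continuous_intros Gc)
    fix s :: real assume "0 \<le> s"
    then have "\<bar>G s\<bar>\<^sup>2 \<le> (C * exp (- 1 * s))\<^sup>2" by (intro power_mono Gb) auto
    also have "\<dots> = C\<^sup>2 * exp (- 2 * s)" by (simp add: power_mult_distrib flip: exp_double)
    finally show "\<bar>(G s)\<^sup>2\<bar> \<le> C\<^sup>2 * exp (- 2 * s)" by simp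
  qed simp
  have Gi: "integrable lborel (\<lambda>s. indicator {0<..} s * G s * exp (- (1 + real i) * s))" for i
    by (rule integrable_Laplace[OF Gc Gb]) auto
  have G0: "(LBINT s. indicator {0<..} s * G s * exp (- (1 + real i) * s)) = 0" for i
  proof -
    have "indicator {0<..} s * G s * exp (- (1 + real i) * s) = indicator {0<..} s * h s * exp (- (\<sigma> + 2 + real i) * s)" for s
    proof -
      have "exp (- (\<sigma> + 1) * s) * exp (- (1 + real i) * s) = exp (- (\<sigma> + 2 + real i) * s)"
        by (simp add: algebra_simps flip: exp_add)
      then show ?thesis unfolding G_def by (simp only: mult.assoc)
    qed
    then show ?thesis using L[of "\<sigma> + 2 + real i"] by (simp only:)
  qed
  \<comment> \<open>By the vanishing moments, \<open>J\<close> is the integral of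
    \<open>G * (G - P)\<close> instead of \<open>G * G\<close>, with \<open>P\<close> taken at
    \<open>exp (- s)\<close>. The second factor is at most \<open>e\<close>, the first at most
    \<open>C\<close>.\<close>
  have Jle: "J \<le> e * C" if e: "0 < e" for e
  proof -
    obtain P where P: "real_polynomial_function P" "\<And>x. x \<in> {0..1} \<Longrightarrow> \<bar>g x - P x\<bar> < e"
      using Stone_Weierstrass_real_polynomial_function[OF compact_Icc gcont e] by blast
    obtain a n where a: "P = (\<lambda>x. \<Sum>i\<le>n. a i * x ^ i)"
      using P(1) by (auto simp: real_polynomial_function_iff_sum)
    define Q where "Q = (\<lambda>s. \<Sum>i\<le>n. a i * (indicator {0<..} s * G s * exp (- (1 + real i) * s)))"
    have Qi: "integrable lborel Q" unfolding Q_def by (intro Bochner_Integration.integrable_sum integrable_mult_right Gi)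
    have Q0: "integral\<^sup>L lborel Q = 0"
      unfolding Q_def using Gi G0 by (subst Bochner_Integration.integral_sum) auto
    have Qeq: "Q s = indicator {0<..} s * G s * exp (- 1 * s) * P (exp (- s))" for s
    proof -
      have "exp (- (1 + real i) * s) = exp (- 1 * s) * exp (- s) ^ i" for i
        by (simp add: algebra_simps flip: exp_add exp_of_nat_mult)
      then show ?thesis unfolding Q_def a sum_distrib_left by (intro sum.cong refl) (simp only: mult_ac)
    qed
    have "J = (LBINT s. indicator {0<..} s * (G s)\<^sup>2 * exp (- 1 * s) - Q s)"
      unfolding J_def using Ji Qi Q0 by simp
    also have "\<dots> \<le> (LBINT s. e * C * (indicator {0<..} s * exp (- 1 * s)))"
    proof (rule integral_mono)
      show "integrable lborel (\<lambda>s. e * C * (indicator {0<..} s * exp (- 1 * s)))"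
        using exp_Laplace[of 1] by (intro integrable_mult_right) (auto simp: has_bochner_integral_iff)
      fix s :: real
      show "indicator {0<..} s * (G s)\<^sup>2 * exp (- 1 * s) - Q s \<le> e * C * (indicator {0<..} s * exp (- 1 * s))"
      proof (cases "0 < s")
        case True
        have "\<bar>G s\<bar> \<le> C * 1"
          by (rule order_trans[OF Gb]) (use True C in \<open>auto intro!: mult_left_mono simp: mult_left_le\<close>)
        moreover have "\<bar>G s - P (exp (- s))\<bar> \<le> e"
          using P(2)[of "exp (- s)"] True gG[of s] by simp
        ultimately have "\<bar>G s * (G s - P (exp (- s)))\<bar> \<le> (C * 1) * e"
          unfolding abs_mult by (intro mult_mono) (use C in auto)
        then have "G s * (G s - P (exp (- s))) * exp (- 1 * s) \<le> C * e * exp (- 1 * s)"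
          by (intro mult_right_mono) auto
        then show ?thesis unfolding Qeq using True by (simp add: power2_eq_square algebra_simps)
      qed (simp add: Qeq)
    qed (use Ji Qi in auto)
    also have "\<dots> = e * C"
      using has_bochner_integral_integral_eq[OF exp_Laplace[of 1]] by simp
    finally show ?thesis .
  qed
  have "J \<le> 0"
  proof (rule field_le_epsilon)
    fix e :: real assume e: "0 < e"
    have "J \<le> e / (C + 1) * C" using e C by (intro Jle) auto
    also have "\<dots> \<le> 0 + e" using e C by (simp add: field_simps)
    finally show "J \<le> 0 + e" .
  qed
  moreover have "0 \<le> J" unfolding J_def by (intro integral_nonneg_AE AE_I2) auto
  ultimately have "J = 0" by simp
  then have ae: "AE s in lborel. indicator {0<..} s * (G s)\<^sup>2 * exp (- 1 * s) = 0"
    unfolding J_def by (subst (asm) integral_nonneg_eq_0_iff_AE[OF Ji]) auto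
  have "G t = 0"
  proof (rule ccontr)
    assume "G t \<noteq> 0"
    \<comment> \<open>A continuous function that vanishes almost everywhere vanishes: otherwise it
      is nonzero on an interval of positive length.\<close>
    define A where "A = {0<..} \<inter> G -` (- {0})"
    have "open A" unfolding A_def
      by (rule continuous_open_preimage) (auto intro: continuous_on_subset[OF Gc])
    moreover have "t \<in> A" using t \<open>G t \<noteq> 0\<close> by (simp add: A_def)
    ultimately obtain e where e: "0 < e" "ball t e \<subseteq> A" by (auto simp: open_contains_ball)
    have "AE s in lborel. s \<notin> {t - e<..<t + e}"
      using ae
    proof eventually_elim
      case (elim s)
      then show ?case using e(2) by (auto simp: A_def ball_eq_greaterThanLessThan indicator_def)
    qed
    then have "{t - e<..<t + e} \<in> null_sets lborel" by (subst AE_iff_null_sets) auto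
    then show False using e(1) by (simp add: null_sets_def)
  qed
  then show ?thesis by (simp add: G_def)
qed

section \<open>The integral representation solves the relaxation equation\<close>

context
  fixes \<alpha> \<mu> :: real
  assumes \<alpha>: "0 < \<alpha>" "\<alpha> < 1" and \<mu>: "0 \<le> \<mu>"
begin

lemma mittag_leffler_relax_bound: "0 \<le> t \<Longrightarrow> \<bar>mittag_leffler_relax \<alpha> \<mu> t\<bar> \<le> 1"
  using relax_weighted(2)[OF \<alpha> \<mu>, of "\<lambda>x. exp (- exp x * t)" 1] \<mu>
  by (simp add: mittag_leffler_relax_def)

lemma mittag_leffler_relax_continuous: "continuous_on {0..} (mittag_leffler_relax \<alpha> \<mu>)"
proof (cases "\<mu> = 0")
  case True
  then show ?thesis by (simp add: mittag_leffler_relax_def[abs_def])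
next
  case False
  hence \<mu>0: "0 < \<mu>" using \<mu> by simp
  note [measurable] = res_density_measurable[OF \<alpha> \<mu>]
  show ?thesis
    unfolding continuous_on_sequentially mittag_leffler_relax_def if_not_P[OF False] o_def
  proof (intro allI ballI impI, elim conjE)
    fix s :: "nat \<Rightarrow> real" and a :: real
    assume a: "a \<in> {0..}" and s: "\<forall>n. s n \<in> {0..}" and lim: "s \<longlonglongrightarrow> a"
    show "(\<lambda>n. LBINT x. \<mu> * res_density \<alpha> \<mu> x / exp x * exp (- exp x * s n))
        \<longlonglongrightarrow> (LBINT x. \<mu> * res_density \<alpha> \<mu> x / exp x * exp (- exp x * a))"
    proof (rule integral_dominated_convergence)
      show "integrable lborel (\<lambda>x. \<mu> * res_density \<alpha> \<mu> x / exp x)"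
        by (rule integrable.intros[OF res_density_over_exp[OF \<alpha> \<mu> \<mu>0]])
      show "AE x in lborel. (\<lambda>n. \<mu> * res_density \<alpha> \<mu> x / exp x * exp (- exp x * s n)) \<longlonglongrightarrow> \<mu> * res_density \<alpha> \<mu> x / exp x * exp (- exp x * a)"
        by (intro AE_I2 tendsto_intros lim)
      show "AE x in lborel. norm (\<mu> * res_density \<alpha> \<mu> x / exp x * exp (- exp x * s n)) \<le> \<mu> * res_density \<alpha> \<mu> x / exp x" for n
      proof (rule AE_I2)
        fix x
        have "0 \<le> \<mu> * res_density \<alpha> \<mu> x / exp x" using res_density_nonneg[OF \<alpha> \<mu>, of x] \<mu> by simp
        moreover have "exp (- exp x * s n) \<le> 1" using s by simp
        ultimately have "\<mu> * res_density \<alpha> \<mu> x / exp x * exp (- exp x * s n) \<le> \<mu> * res_density \<alpha> \<mu> x / exp x * 1"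
          by (intro mult_left_mono)
        then show "norm (\<mu> * res_density \<alpha> \<mu> x / exp x * exp (- exp x * s n)) \<le> \<mu> * res_density \<alpha> \<mu> x / exp x"
          using \<open>0 \<le> \<mu> * res_density \<alpha> \<mu> x / exp x\<close> by (simp only: real_norm_def abs_mult abs_of_nonneg abs_exp_cancel mult_1_right)
      qed
    qed measurable
  qed
qed

text \<open>Fubini turns each exponential into \<open>1 / (p + exp x)\<close>. Partial fractions
  then split the integral into the total mass 1 and the Stieltjes representation at
  \<open>s = p\<close>.\<close>

lemma mittag_leffler_relax_Laplace:
  assumes p: "0 < p"
  shows "(LBINT t. indicator {0<..} t * mittag_leffler_relax \<alpha> \<mu> t * exp (- p * t)) = p powr (\<alpha> - 1) / (p powr \<alpha> + \<mu>)"
proof (cases "\<mu> = 0")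
  case True
  then show ?thesis
    using has_bochner_integral_integral_eq[OF exp_Laplace[OF p]] p
    by (simp add: mittag_leffler_relax_def powr_diff)
next
  case False
  hence \<mu>0: "0 < \<mu>" using \<mu> by simp
  note [measurable] = res_density_measurable[OF \<alpha> \<mu>]
  define P where "P = (\<lambda>x. \<mu> * res_density \<alpha> \<mu> x / exp x)"
  have P: "has_bochner_integral lborel P 1" unfolding P_def by (rule res_density_over_exp[OF \<alpha> \<mu> \<mu>0])
  have P0: "0 \<le> P x" for x using res_density_nonneg[OF \<alpha> \<mu>, of x] \<mu> by (simp add: P_def)
  define H where "H = (\<lambda>x t. P x * (indicator {0<..} t * exp (- (p + exp x) * t)))"
  have pe: "0 < p + exp x" for x using p by (simp add: add_pos_pos)
  have inner: "has_bochner_integral lborel (H x) (P x * (1 / (p + exp x)))" for x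
    unfolding H_def by (intro has_bochner_integral_mult_right exp_Laplace pe)
  have nH: "norm (H x t) = H x t" for x t using P0[of x] by (simp add: H_def)
  have St: "has_bochner_integral lborel (\<lambda>x. 1 / p * P x - 1 / p * (\<mu> * (res_density \<alpha> \<mu> x / (p + exp x)))) (1 / p * 1 - 1 / p * (\<mu> * (1 / (p powr \<alpha> + \<mu>))))"
    by (intro has_bochner_integral_diff has_bochner_integral_mult_right P res_density_Stieltjes[OF \<alpha> \<mu> p])
  have eq: "P x * (1 / (p + exp x)) = 1 / p * P x - 1 / p * (\<mu> * (res_density \<alpha> \<mu> x / (p + exp x)))" for x
  proof -
    have "m * q / r * (1 / (p + r)) = 1 / p * (m * q / r) - 1 / p * (m * (q / (p + r)))" if "0 < r" for m q r
    proof -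
      have "1 / r * (1 / (p + r)) = 1 / p * (1 / r) - 1 / p * (1 / (p + r))"
        using that p by (simp add: divide_simps)
      then have "m * q * (1 / r * (1 / (p + r))) = m * q * (1 / p * (1 / r) - 1 / p * (1 / (p + r)))" by simp
      then show ?thesis by (simp add: right_diff_distrib mult_ac)
    qed
    then show ?thesis by (simp add: P_def)
  qed
  have int: "integrable (lborel \<Otimes>\<^sub>M lborel) (case_prod H)"
  proof (rule lborel_pair.Fubini_integrable)
    show "case_prod H \<in> borel_measurable (lborel \<Otimes>\<^sub>M lborel)" unfolding H_def P_def by measurable
    have "(LBINT t. norm (case_prod H (x, t))) = 1 / p * P x - 1 / p * (\<mu> * (res_density \<alpha> \<mu> x / (p + exp x)))" for x
      using has_bochner_integral_integral_eq[OF inner[of x]] by (simp only: prod.case nH eq)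
    then show "integrable lborel (\<lambda>x. LBINT t. norm (case_prod H (x, t)))"
      using integrable.intros[OF St] by (simp only:)
    show "AE x in lborel. integrable lborel (\<lambda>t. case_prod H (x, t))"
      using integrable.intros[OF inner] by simp
  qed
  have "indicator {0<..} t * mittag_leffler_relax \<alpha> \<mu> t * exp (- p * t) = (LBINT x. H x t)" for t
  proof -
    have "(LBINT x. H x t) = (LBINT x. indicator {0<..} t * exp (- p * t) * (P x * exp (- exp x * t)))"
      by (rule Bochner_Integration.integral_cong[OF refl]) (simp add: H_def algebra_simps exp_add[symmetric])
    also have "\<dots> = indicator {0<..} t * exp (- p * t) * mittag_leffler_relax \<alpha> \<mu> t"
      unfolding mittag_leffler_relax_def if_not_P[OF False] P_def by (rule integral_mult_right_zero)
    finally show ?thesis by (simp only: mult_ac)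
  qed
  then have "(LBINT t. indicator {0<..} t * mittag_leffler_relax \<alpha> \<mu> t * exp (- p * t)) = (LBINT t. (LBINT x. H x t))"
    by (simp only:)
  also have "\<dots> = (LBINT x. (LBINT t. H x t))"
    by (rule lborel_pair.Fubini_integral[OF int])
  also have "\<dots> = (LBINT x. 1 / p * P x - 1 / p * (\<mu> * (res_density \<alpha> \<mu> x / (p + exp x))))"
    using has_bochner_integral_integral_eq[OF inner] by (simp only: eq)
  also have "\<dots> = 1 / p * 1 - 1 / p * (\<mu> * (1 / (p powr \<alpha> + \<mu>)))"
    by (rule has_bochner_integral_integral_eq[OF St])
  also have "\<dots> = p powr (\<alpha> - 1) / (p powr \<alpha> + \<mu>)"
  proof -
    have "0 < p powr \<alpha> + \<mu>" using p \<mu> by (simp add: add_pos_nonneg)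
    then have "1 - \<mu> / (p powr \<alpha> + \<mu>) = p powr \<alpha> / (p powr \<alpha> + \<mu>)" by (simp add: divide_simps)
    then have "1 / p * (1 - \<mu> / (p powr \<alpha> + \<mu>)) = p powr (\<alpha> - 1) / (p powr \<alpha> + \<mu>)"
      using p by (simp add: powr_diff)
    then show ?thesis by (simp add: right_diff_distrib)
  qed
  finally show ?thesis .
qed

end

text \<open>In units of the step size both sides are continuous, of exponential growth, and have the
  same Laplace transform for large \<open>p\<close>. The change of units is what replaces \<nu> by
  \<open>\<nu> * \<tau> powr \<alpha>\<close>.\<close>

theorem Caputo_relaxation:
  assumes \<alpha>: "0 < \<alpha>" "\<alpha> < 1" and \<nu>: "0 \<le> \<nu>" and \<tau>: "0 < \<tau>"
    and cont: "continuous_on {0..} w" and diff: "\<And>t. 0 < t \<Longrightarrow> w differentiable (at t)"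
    and int: "\<And>t. 0 < t \<Longrightarrow> set_integrable lborel {0<..<t} (\<lambda>s. (t - s) powr (- \<alpha>) * deriv w s)"
    and eq: "\<And>t. 0 < t \<Longrightarrow> caputo \<alpha> w t = - \<nu> * w t"
    and t: "0 < t"
  shows "w (t * \<tau>) = w 0 * mittag_leffler_relax \<alpha> (\<nu> * \<tau> powr \<alpha>) t"
proof -
  define \<mu> where "\<mu> = \<nu> * \<tau> powr \<alpha>"
  have \<mu>: "0 \<le> \<mu>" using \<nu> by (simp add: \<mu>_def)
  \<comment> \<open>Chosen so that \<open>\<sigma> powr \<alpha> = 2 * \<nu> + 1\<close>, which
    makes the Volterra operator a contraction with factor 1/2.\<close>
  define \<sigma> where "\<sigma> = (2 * \<nu> + 1) powr (1 / \<alpha>)"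
  have \<sigma>0: "0 < \<sigma>" using \<nu> by (simp add: \<sigma>_def)
  have "\<sigma> powr (- \<alpha>) = 1 / (2 * \<nu> + 1)"
    using \<nu> \<alpha> by (simp add: \<sigma>_def powr_powr powr_minus_divide)
  then have \<sigma>1: "\<nu> * \<sigma> powr (- \<alpha>) \<le> 1 / 2" using \<nu> by (simp only:) (simp add: divide_simps)
  note V = Caputo_Volterra[OF \<alpha> cont diff int eq]
  note growth = Volterra_growth[OF \<alpha>(1) \<nu> cont V \<sigma>0 \<sigma>1]
  define h where "h = (\<lambda>t. w (\<tau> * t) - w 0 * mittag_leffler_relax \<alpha> \<mu> t)"
  have wc: "continuous_on {0..} (\<lambda>t. w (\<tau> * t))"
    using \<tau> by (intro continuous_on_compose2[OF cont] continuous_intros) auto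
  have wb: "\<bar>w (\<tau> * t)\<bar> \<le> 2 * \<bar>w 0\<bar> * exp (\<sigma> * \<tau> * t)" if "0 \<le> t" for t
    using growth[of "\<tau> * t"] \<tau> that by (simp add: mult_ac)
  have mb: "\<bar>mittag_leffler_relax \<alpha> \<mu> t\<bar> \<le> 1 * exp (0 * t)" if "0 \<le> t" for t
    using mittag_leffler_relax_bound[OF \<alpha> \<mu> that] by simp
  have "h t = 0"
  proof (rule Laplace_unique[of h "3 * \<bar>w 0\<bar>" "\<sigma> * \<tau>"])
    show "continuous_on {0..} h"
      unfolding h_def by (intro continuous_intros wc mittag_leffler_relax_continuous[OF \<alpha> \<mu>])
    show "\<bar>h t\<bar> \<le> 3 * \<bar>w 0\<bar> * exp (\<sigma> * \<tau> * t)" if "0 \<le> t" for t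
    proof -
      have "\<bar>w 0 * mittag_leffler_relax \<alpha> \<mu> t\<bar> \<le> \<bar>w 0\<bar> * 1"
        unfolding abs_mult using mb[OF that] by (intro mult_left_mono) auto
      also have "\<dots> \<le> \<bar>w 0\<bar> * exp (\<sigma> * \<tau> * t)"
        using \<sigma>0 \<tau> that by (intro mult_left_mono) auto
      finally show ?thesis using wb[OF that] unfolding h_def by linarith
    qed
    fix p assume p: "\<sigma> * \<tau> < p"
    have p0: "0 < p" using less_trans[OF mult_pos_pos[OF \<sigma>0 \<tau>] p] .
    have i1: "integrable lborel (\<lambda>t. indicator {0<..} t * w (\<tau> * t) * exp (- p * t))"
      by (rule integrable_Laplace[OF wc wb p])
    have i2: "integrable lborel (\<lambda>t. indicator {0<..} t * mittag_leffler_relax \<alpha> \<mu> t * exp (- p * t))"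
      by (rule integrable_Laplace[OF mittag_leffler_relax_continuous[OF \<alpha> \<mu>] mb p0])
    have "(LBINT t. indicator {0<..} t * w t * exp (- (p / \<tau>) * t)) = w 0 * ((p / \<tau>) powr (\<alpha> - 1) / ((p / \<tau>) powr \<alpha> + \<nu>))"
      by (rule Volterra_Laplace[OF \<alpha>(1) \<nu> cont V \<sigma>0 \<sigma>1]) (use p \<tau> in \<open>auto simp: field_simps\<close>)
    moreover have "(LBINT t. indicator {0<..} t * w t * exp (- (p / \<tau>) * t))
        = \<tau> * (LBINT t. indicator {0<..} t * w (\<tau> * t) * exp (- p * t))"
      using \<tau> by (subst lborel_integral_real_affine[of \<tau> _ 0]) (auto simp: indicator_def zero_less_mult_iff)
    moreover have "(p / \<tau>) powr (\<alpha> - 1) / ((p / \<tau>) powr \<alpha> + \<nu>) = \<tau> * (p powr (\<alpha> - 1) / (p powr \<alpha> + \<mu>))"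
    proof -
      have d: "(p / \<tau>) powr \<alpha> + \<nu> = (p powr \<alpha> + \<mu>) / \<tau> powr \<alpha>"
        using p0 \<tau> by (simp add: powr_divide \<mu>_def add_divide_distrib)
      have n: "(p / \<tau>) powr (\<alpha> - 1) = p powr (\<alpha> - 1) * \<tau> / \<tau> powr \<alpha>"
        using p0 \<tau> by (simp add: powr_divide powr_diff)
      show ?thesis unfolding d n using \<tau> by simp
    qed
    ultimately have "\<tau> * (LBINT t. indicator {0<..} t * w (\<tau> * t) * exp (- p * t)) = \<tau> * (w 0 * (p powr (\<alpha> - 1) / (p powr \<alpha> + \<mu>)))"
      by (simp only: mult.left_commute)
    then have l1: "(LBINT t. indicator {0<..} t * w (\<tau> * t) * exp (- p * t)) = w 0 * (p powr (\<alpha> - 1) / (p powr \<alpha> + \<mu>))"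
      using \<tau> by (simp only: mult_cancel_left) simp
    have "(LBINT t. indicator {0<..} t * h t * exp (- p * t))
      = (LBINT t. indicator {0<..} t * w (\<tau> * t) * exp (- p * t) - w 0 * (indicator {0<..} t * mittag_leffler_relax \<alpha> \<mu> t * exp (- p * t)))"
      by (rule Bochner_Integration.integral_cong[OF refl]) (simp add: h_def algebra_simps)
    also have "\<dots> = (LBINT t. indicator {0<..} t * w (\<tau> * t) * exp (- p * t)) - w 0 * (LBINT t. indicator {0<..} t * mittag_leffler_relax \<alpha> \<mu> t * exp (- p * t))"
      by (subst Bochner_Integration.integral_diff[OF i1 integrable_mult_right[OF i2]]) (simp only: integral_mult_right_zero)
    also have "\<dots> = 0" unfolding l1 mittag_leffler_relax_Laplace[OF \<alpha> \<mu> p0] by simp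
    finally show "(LBINT t. indicator {0<..} t * h t * exp (- p * t)) = 0" .
  qed (rule t)
  then show ?thesis by (simp add: h_def \<mu>_def mult.commute)
qed

section \<open>Symmetric forms on finite dimensional function spaces\<close>

definition fun_subspace :: "('a \<Rightarrow> real) set \<Rightarrow> bool" where
  "fun_subspace X \<longleftrightarrow> (\<lambda>x. 0) \<in> X \<and> (\<forall>\<phi>\<in>X. \<forall>\<psi>\<in>X. \<forall>a b. (\<lambda>x. a * \<phi> x + b * \<psi> x) \<in> X)"

definition sym_form_on :: "('a \<Rightarrow> real) set \<Rightarrow> (('a \<Rightarrow> real) \<Rightarrow> ('a \<Rightarrow> real) \<Rightarrow> real) \<Rightarrow> bool" where
  "sym_form_on X B \<longleftrightarrow> (\<forall>\<phi>\<in>X. \<forall>\<psi>\<in>X. B \<phi> \<psi> = B \<psi> \<phi>) \<and>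
     (\<forall>\<phi>\<in>X. \<forall>\<psi>\<in>X. \<forall>\<eta>\<in>X. \<forall>a b. B (\<lambda>x. a * \<phi> x + b * \<psi> x) \<eta> = a * B \<phi> \<eta> + b * B \<psi> \<eta>)"

text \<open>Finite dimension expressed through points: evaluation on \<open>Z\<close> is injective
  on \<open>X\<close>. For finite elements \<open>Z\<close> consists of the mesh vertices, and its
  cardinality is the induction measure for the eigenbasis.\<close>

definition determining :: "'a set \<Rightarrow> ('a \<Rightarrow> real) set \<Rightarrow> bool" where
  "determining Z X \<longleftrightarrow> finite Z \<and> (\<forall>\<phi>\<in>X. (\<forall>z\<in>Z. \<phi> z = 0) \<longrightarrow> \<phi> = (\<lambda>x. 0))"

lemma fun_subspace_0: "fun_subspace X \<Longrightarrow> (\<lambda>x. 0) \<in> X"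
  by (simp add: fun_subspace_def)

lemma fun_subspace_lincomb:
  "fun_subspace X \<Longrightarrow> \<phi> \<in> X \<Longrightarrow> \<psi> \<in> X \<Longrightarrow> (\<lambda>x. a * \<phi> x + b * \<psi> x) \<in> X"
  by (simp add: fun_subspace_def)

lemma fun_subspace_scale: "fun_subspace X \<Longrightarrow> \<phi> \<in> X \<Longrightarrow> (\<lambda>x. a * \<phi> x) \<in> X"
  using fun_subspace_lincomb[of X \<phi> \<phi> a 0] by simp

lemma fun_subspace_diff: "fun_subspace X \<Longrightarrow> \<phi> \<in> X \<Longrightarrow> \<psi> \<in> X \<Longrightarrow> (\<lambda>x. \<phi> x - \<psi> x) \<in> X"
  using fun_subspace_lincomb[of X \<phi> \<psi> 1 "-1"] by simp

lemma fun_subspace_sum: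
  assumes X: "fun_subspace X" and "\<And>i. i \<in> S \<Longrightarrow> b i \<in> X"
  shows "(\<lambda>x. \<Sum>i\<in>S. c i * b i x) \<in> X"
  using assms(2)
proof (induction S rule: infinite_finite_induct)
  case (insert i S)
  then show ?case using fun_subspace_lincomb[OF X, of "b i" "\<lambda>x. \<Sum>i\<in>S. c i * b i x" "c i" 1] by simp
qed (use fun_subspace_0[OF X] in auto)

lemma sym_form_sym: "sym_form_on X B \<Longrightarrow> \<phi> \<in> X \<Longrightarrow> \<psi> \<in> X \<Longrightarrow> B \<phi> \<psi> = B \<psi> \<phi>"
  by (simp add: sym_form_on_def)

lemma sym_form_lincomb:
  "sym_form_on X B \<Longrightarrow> \<phi> \<in> X \<Longrightarrow> \<psi> \<in> X \<Longrightarrow> \<eta> \<in> X \<Longrightarrow> B (\<lambda>x. a * \<phi> x + b * \<psi> x) \<eta> = a * B \<phi> \<eta> + b * B \<psi> \<eta>"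
  by (simp add: sym_form_on_def)

lemma sym_form_0: "sym_form_on X B \<Longrightarrow> \<eta> \<in> X \<Longrightarrow> B (\<lambda>x. 0) \<eta> = 0"
  using sym_form_lincomb[of X B \<eta> \<eta> \<eta> 0 0] by simp

lemma sym_form_scale: "sym_form_on X B \<Longrightarrow> \<phi> \<in> X \<Longrightarrow> \<eta> \<in> X \<Longrightarrow> B (\<lambda>x. a * \<phi> x) \<eta> = a * B \<phi> \<eta>"
  using sym_form_lincomb[of X B \<phi> \<phi> \<eta> a 0] by simp

lemma sym_form_diff: "sym_form_on X B \<Longrightarrow> \<phi> \<in> X \<Longrightarrow> \<psi> \<in> X \<Longrightarrow> \<eta> \<in> X \<Longrightarrow> B (\<lambda>x. \<phi> x - \<psi> x) \<eta> = B \<phi> \<eta> - B \<psi> \<eta>"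
  using sym_form_lincomb[of X B \<phi> \<psi> \<eta> 1 "-1"] by simp

lemma sym_form_sum:
  assumes X: "fun_subspace X" and B: "sym_form_on X B" and "\<And>i. i \<in> S \<Longrightarrow> b i \<in> X" and \<eta>: "\<eta> \<in> X"
  shows "B (\<lambda>x. \<Sum>i\<in>S. c i * b i x) \<eta> = (\<Sum>i\<in>S. c i * B (b i) \<eta>)"
  using assms(3)
proof (induction S rule: infinite_finite_induct)
  case (insert i S)
  then show ?case
    using sym_form_lincomb[OF B, of "b i" "\<lambda>x. \<Sum>i\<in>S. c i * b i x" \<eta> "c i" 1] fun_subspace_sum[OF X, of S b c] \<eta>
    by simp
qed (use sym_form_0[OF B \<eta>] in auto)

text \<open>A minimal determining set carries a Lagrange basis.\<close>

lemma nodal_basis: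
  assumes X: "fun_subspace X" and Z: "determining Z X"
  obtains Z' b where "Z' \<subseteq> Z" "\<forall>z\<in>Z'. b z \<in> X"
    "\<forall>z\<in>Z'. \<forall>y\<in>Z'. b z y = (if z = y then 1 else 0)"
    "\<forall>\<phi>\<in>X. \<phi> = (\<lambda>x. \<Sum>z\<in>Z'. \<phi> z * b z x)"
proof -
  define P where "P = (\<lambda>k. \<exists>Z'\<subseteq>Z. determining Z' X \<and> card Z' = k)"
  have "P (card Z)" using Z by (auto simp: P_def)
  then have "P (LEAST k. P k)" by (rule LeastI)
  then obtain Z' where Z': "Z' \<subseteq> Z" "determining Z' X" "card Z' = (LEAST k. P k)"
    by (auto simp: P_def)
  have fin: "finite Z'" using Z'(2) by (simp add: determining_def)
  \<comment> \<open>By minimality, dropping \<open>z\<close> admits a nonzero member of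
    \<open>X\<close> that vanishes at all other points; it cannot vanish at \<open>z\<close>, so it
    can be scaled to 1 there.\<close>
  have "\<exists>\<beta>\<in>X. \<forall>y\<in>Z'. \<beta> y = (if z = y then 1 else 0)" if z: "z \<in> Z'" for z
  proof -
    have "\<not> P (card (Z' - {z}))"
      using Z'(3) card_Diff1_less[OF fin z] not_less_Least by auto
    then have "\<not> determining (Z' - {z}) X" using Z'(1) by (auto simp: P_def)
    then obtain \<phi> where \<phi>: "\<phi> \<in> X" "\<forall>y\<in>Z' - {z}. \<phi> y = 0" "\<phi> \<noteq> (\<lambda>x. 0)"
      using fin by (auto simp: determining_def)
    have nz: "\<phi> z \<noteq> 0" using \<phi> Z'(2) unfolding determining_def by blast
    show ?thesis
      by (rule bexI[of _ "\<lambda>x. (1 / \<phi> z) * \<phi> x"]) (use \<phi> nz fun_subspace_scale[OF X \<phi>(1), of "1 / \<phi> z"] in auto)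
  qed
  then obtain b where b: "\<And>z. z \<in> Z' \<Longrightarrow> b z \<in> X" "\<And>z y. z \<in> Z' \<Longrightarrow> y \<in> Z' \<Longrightarrow> b z y = (if z = y then 1 else 0)"
    by metis
  have exp: "\<phi> = (\<lambda>x. \<Sum>z\<in>Z'. \<phi> z * b z x)" if \<phi>: "\<phi> \<in> X" for \<phi>
  proof -
    have dX: "(\<lambda>x. \<phi> x - (\<Sum>z\<in>Z'. \<phi> z * b z x)) \<in> X"
      by (intro fun_subspace_diff[OF X \<phi>] fun_subspace_sum[OF X] b)
    have "\<phi> y - (\<Sum>z\<in>Z'. \<phi> z * b z y) = 0" if "y \<in> Z'" for y
    proof -
      have "(\<Sum>z\<in>Z'. \<phi> z * b z y) = (\<Sum>z\<in>Z'. if z = y then \<phi> z else 0)"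
        by (intro sum.cong refl) (use b(2) that in auto)
      then show ?thesis using that fin by simp
    qed
    then have "\<forall>y\<in>Z'. \<phi> y - (\<Sum>z\<in>Z'. \<phi> z * b z y) = 0" by (rule ballI)
    then have "(\<lambda>x. \<phi> x - (\<Sum>z\<in>Z'. \<phi> z * b z x)) = (\<lambda>x. 0)"
      using bspec[OF conjunct2[OF Z'(2)[unfolded determining_def]] dX] by (rule rev_mp)
    then have "\<phi> x - (\<Sum>z\<in>Z'. \<phi> z * b z x) = 0" for x by (rule fun_cong)
    then have "\<phi> x = (\<Sum>z\<in>Z'. \<phi> z * b z x)" for x by (rule iffD1[OF right_minus_eq])
    then show ?thesis by (rule ext)
  qed
  show ?thesis
  proof (rule that[OF Z'(1)])
    show "\<forall>z\<in>Z'. b z \<in> X" "\<forall>z\<in>Z'. \<forall>y\<in>Z'. b z y = (if z = y then 1 else 0)"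
      using b by simp_all
    show "\<forall>\<phi>\<in>X. \<phi> = (\<lambda>x. \<Sum>z\<in>Z'. \<phi> z * b z x)"
      by (rule ballI) (rule exp)
  qed
qed

text \<open>Coordinate vectors are functions on the whole type that vanish off \<open>Z\<close>. The
  sphere is then a closed subset of a product of copies of \<open>{-1..1}\<close>, compact by
  Tychonoff.\<close>

lemma compact_coordinate_sphere:
  fixes Z :: "'a set" assumes "finite Z"
  shows "compact {c::'a \<Rightarrow> real. (\<forall>z. z \<notin> Z \<longrightarrow> c z = 0) \<and> (\<Sum>z\<in>Z. (c z)\<^sup>2) = 1}" (is "compact ?K")
proof -
  have "compactin (product_topology (\<lambda>i::'a. euclidean :: real topology) UNIV) (PiE UNIV (\<lambda>_. {-1..1}))"
    unfolding compactin_PiE by simp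
  then have comp: "compact (PiE UNIV (\<lambda>_::'a. {-1..1::real}))"
    by (simp add: euclidean_product_topology compactin_euclidean_iff)
  have "closed (\<Inter>z\<in>-Z. {c::'a \<Rightarrow> real. c z = 0})"
    by (intro closed_INT ballI closed_Collect_eq continuous_on_product_coordinates continuous_on_const)
  moreover have "closed {c::'a \<Rightarrow> real. (\<Sum>z\<in>Z. (c z)\<^sup>2) = 1}"
    by (intro closed_Collect_eq continuous_intros continuous_on_product_coordinates)
  ultimately have "closed ((\<Inter>z\<in>-Z. {c::'a \<Rightarrow> real. c z = 0}) \<inter> {c. (\<Sum>z\<in>Z. (c z)\<^sup>2) = 1})" by (rule closed_Int)
  also have "(\<Inter>z\<in>-Z. {c::'a \<Rightarrow> real. c z = 0}) \<inter> {c. (\<Sum>z\<in>Z. (c z)\<^sup>2) = 1} = ?K" by auto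
  finally have cl: "closed ?K" .
  have "?K \<subseteq> PiE UNIV (\<lambda>_. {-1..1})"
  proof
    fix c assume c: "c \<in> ?K"
    have "c z \<in> {-1..1}" for z
    proof (cases "z \<in> Z")
      case True
      have "(c z)\<^sup>2 \<le> (\<Sum>z\<in>Z. (c z)\<^sup>2)" using assms True by (intro member_le_sum) auto
      then have "(c z)\<^sup>2 \<le> 1" using c by simp
      then show ?thesis by (auto simp: abs_square_le_1 abs_le_iff)
    qed (use c in auto)
    then show "c \<in> PiE UNIV (\<lambda>_. {-1..1})" by auto
  qed
  then show ?thesis using compact_Int_closed[OF comp cl] by (simp add: Int_absorb1)
qed

text \<open>The eigenvector maximises the Rayleigh quotient.\<close>

lemma exists_eigenvector:
  assumes X: "fun_subspace X" and Z: "determining Z X"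
    and ip: "sym_form_on X ip" and pos: "\<And>\<phi>. \<phi> \<in> X \<Longrightarrow> \<phi> \<noteq> (\<lambda>x. 0) \<Longrightarrow> 0 < ip \<phi> \<phi>"
    and a: "sym_form_on X a" and nz: "X \<noteq> {\<lambda>x. 0}"
  obtains e M where "e \<in> X" "ip e e = 1" "\<And>\<eta>. \<eta> \<in> X \<Longrightarrow> a e \<eta> = M * ip e \<eta>"
proof -
  obtain Z' b where Z': "Z' \<subseteq> Z" and b: "\<forall>z\<in>Z'. b z \<in> X"
    and bd: "\<forall>z\<in>Z'. \<forall>y\<in>Z'. b z y = (if z = y then 1 else 0)"
    and exp: "\<forall>\<phi>\<in>X. \<phi> = (\<lambda>x. \<Sum>z\<in>Z'. \<phi> z * b z x)"
    by (rule nodal_basis[OF X Z])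
  note b = bspec[OF b] and bd = bd[rule_format] and exp = bspec[OF exp]
  have fin: "finite Z'" using Z' Z finite_subset by (auto simp: determining_def)
  define F where "F = (\<lambda>c x. \<Sum>z\<in>Z'. c z * b z x)"
  define K where "K = {c::'a \<Rightarrow> real. (\<forall>z. z \<notin> Z' \<longrightarrow> c z = 0) \<and> (\<Sum>z\<in>Z'. (c z)\<^sup>2) = 1}"
  have FX: "F c \<in> X" for c unfolding F_def by (intro fun_subspace_sum[OF X] b)
  have Fz: "F c y = c y" if "y \<in> Z'" for c y
  proof -
    have "F c y = (\<Sum>z\<in>Z'. if z = y then c z else 0)"
      unfolding F_def by (intro sum.cong refl) (use bd that in auto)
    then show ?thesis using that fin by simp
  qed
  have form: "B (F c) (F c) = (\<Sum>z\<in>Z'. \<Sum>y\<in>Z'. c z * (c y * B (b y) (b z)))" if B: "sym_form_on X B" for B c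
  proof -
    have "B (F c) (F c) = (\<Sum>z\<in>Z'. c z * B (b z) (F c))"
      by (subst (1) F_def) (intro sym_form_sum[OF X B] b FX)
    also have "\<dots> = (\<Sum>z\<in>Z'. c z * B (F c) (b z))"
    proof (rule sum.cong[OF refl])
      fix z assume "z \<in> Z'"
      then show "c z * B (b z) (F c) = c z * B (F c) (b z)" by (simp only: sym_form_sym[OF B b FX])
    qed
    also have "\<dots> = (\<Sum>z\<in>Z'. c z * (\<Sum>y\<in>Z'. c y * B (b y) (b z)))"
    proof (rule sum.cong[OF refl])
      fix z assume z: "z \<in> Z'"
      have "B (F c) (b z) = (\<Sum>y\<in>Z'. c y * B (b y) (b z))"
        unfolding F_def by (intro sym_form_sum[OF X B] b z)
      then show "c z * B (F c) (b z) = c z * (\<Sum>y\<in>Z'. c y * B (b y) (b z))" by (simp only:)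
    qed
    finally show ?thesis by (simp add: sum_distrib_left)
  qed
  have Fpos: "0 < ip (F c) (F c)" if "c \<in> K" for c
  proof (rule pos[OF FX])
    show "F c \<noteq> (\<lambda>x. 0)"
    proof
      assume "F c = (\<lambda>x. 0)"
      then have "\<forall>y\<in>Z'. c y = 0" using Fz by metis
      then have "(\<Sum>z\<in>Z'. (c z)\<^sup>2) = 0" by simp
      then show False using that by (simp add: K_def)
    qed
  qed
  have cont: "continuous_on K (\<lambda>c. a (F c) (F c) / ip (F c) (F c))"
  proof (rule continuous_on_divide)
    have c: "continuous_on K (\<lambda>c::'a \<Rightarrow> real. c z)" for z
      by (rule continuous_on_subset[OF continuous_on_product_coordinates]) simp
    show "continuous_on K (\<lambda>c. a (F c) (F c))" "continuous_on K (\<lambda>c. ip (F c) (F c))"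
      unfolding form[OF a] form[OF ip] by (intro continuous_intros c)+
  qed (use Fpos in force)
  have "Z' \<noteq> {}"
  proof
    assume "Z' = {}"
    then have "X \<subseteq> {\<lambda>x. 0}" using exp by auto
    then show False using nz fun_subspace_0[OF X] by auto
  qed
  then obtain z0 where "z0 \<in> Z'" by auto
  then have "(\<lambda>z. if z = z0 then 1 else 0) \<in> K"
    using fin by (auto simp: K_def if_distrib[of "\<lambda>z. z ^ 2"] cong: if_cong)
  then have "K \<noteq> {}" by auto
  then obtain c0 where c0: "c0 \<in> K" "\<And>c. c \<in> K \<Longrightarrow> a (F c) (F c) / ip (F c) (F c) \<le> a (F c0) (F c0) / ip (F c0) (F c0)"
    using continuous_attains_sup[OF _ _ cont] compact_coordinate_sphere[OF fin] unfolding K_def by blast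
  define e0 where "e0 = F c0"
  define M where "M = a e0 e0 / ip e0 e0"
  have e0: "e0 \<in> X" "0 < ip e0 e0" using FX Fpos[OF c0(1)] by (auto simp: e0_def)
  have Qnn: "0 \<le> M * ip \<phi> \<phi> - a \<phi> \<phi>" if \<phi>: "\<phi> \<in> X" for \<phi>
  proof (cases "\<phi> = (\<lambda>x. 0)")
    case True
    then show ?thesis using sym_form_0[OF ip \<phi>] sym_form_0[OF a \<phi>] by simp
  next
    case False
    define N where "N = sqrt (\<Sum>z\<in>Z'. (\<phi> z)\<^sup>2)"
    have "\<exists>z\<in>Z'. \<phi> z \<noteq> 0"
    proof (rule ccontr)
      assume "\<not> ?thesis"
      then have "\<phi> = (\<lambda>x. 0)" by (subst exp[OF \<phi>]) simp
      then show False using False by contradiction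
    qed
    then obtain y where "y \<in> Z'" "\<phi> y \<noteq> 0" by blast
    then have "0 < (\<Sum>z\<in>Z'. (\<phi> z)\<^sup>2)" using fin by (intro sum_pos2[of _ y]) auto
    then have N: "0 < N" "N\<^sup>2 = (\<Sum>z\<in>Z'. (\<phi> z)\<^sup>2)" by (auto simp: N_def)
    define c where "c = (\<lambda>z. if z \<in> Z' then \<phi> z / N else 0)"
    have "(\<Sum>z\<in>Z'. (c z)\<^sup>2) = (\<Sum>z\<in>Z'. (\<phi> z)\<^sup>2) / N\<^sup>2"
      unfolding sum_divide_distrib by (intro sum.cong refl) (auto simp: c_def power_divide)
    then have cK: "c \<in> K" using N by (auto simp: K_def c_def)
    have Fc: "F c = (\<lambda>x. (1 / N) * \<phi> x)"
    proof
      fix x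
      have "F c x = (\<Sum>z\<in>Z'. (1 / N) * (\<phi> z * b z x))" unfolding F_def by (intro sum.cong refl) (auto simp: c_def)
      also have "\<dots> = (1 / N) * \<phi> x" by (subst (2) exp[OF \<phi>]) (simp add: sum_distrib_left)
      finally show "F c x = (1 / N) * \<phi> x" .
    qed
    have sc: "B (F c) (F c) = (1 / N) * ((1 / N) * B \<phi> \<phi>)" if B: "sym_form_on X B" for B
      unfolding Fc using sym_form_scale[OF B \<phi>, of "\<lambda>x. (1 / N) * \<phi> x" "1 / N"] sym_form_scale[OF B \<phi> \<phi>, of "1 / N"]
        sym_form_sym[OF B \<phi>, of "\<lambda>x. (1 / N) * \<phi> x"] fun_subspace_scale[OF X \<phi>, of "1 / N"] by simp
    have ipp: "0 < ip \<phi> \<phi>" using pos[OF \<phi> False] .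
    have "a \<phi> \<phi> / ip \<phi> \<phi> = a (F c) (F c) / ip (F c) (F c)"
      unfolding sc[OF a] sc[OF ip] using N by simp
    also have "\<dots> \<le> M" using c0(2)[OF cK] by (simp add: M_def e0_def)
    finally show ?thesis using ipp by (simp add: divide_le_eq)
  qed
  \<comment> \<open>This form is positive semidefinite and vanishes on the maximiser, so the
    maximiser lies in its kernel; that is the eigenvalue equation in weak form.\<close>
  define Q where "Q = (\<lambda>\<phi> \<psi>. M * ip \<phi> \<psi> - a \<phi> \<psi>)"
  have Q0: "Q e0 \<eta> = 0" if \<eta>: "\<eta> \<in> X" for \<eta>
  proof (rule ccontr)
    assume ne: "Q e0 \<eta> \<noteq> 0"
    have q: "0 \<le> 2 * s * Q e0 \<eta> + s\<^sup>2 * Q \<eta> \<eta>" for s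
    proof -
      define \<psi> where "\<psi> = (\<lambda>x. 1 * e0 x + s * \<eta> x)"
      have \<psi>: "\<psi> \<in> X" unfolding \<psi>_def by (intro fun_subspace_lincomb[OF X] e0 \<eta>)
      have ex: "B \<psi> \<psi> = B e0 e0 + 2 * s * B e0 \<eta> + s\<^sup>2 * B \<eta> \<eta>" if B: "sym_form_on X B" for B
      proof -
        have "B \<psi> \<psi> = B e0 \<psi> + s * B \<eta> \<psi>"
          by (subst (1) \<psi>_def) (use sym_form_lincomb[OF B e0(1) \<eta> \<psi>, of 1 s] in simp)
        also have "B e0 \<psi> = B e0 e0 + s * B \<eta> e0"
          using sym_form_sym[OF B e0(1) \<psi>] sym_form_lincomb[OF B e0(1) \<eta> e0(1), of 1 s] by (simp add: \<psi>_def)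
        also have "B \<eta> \<psi> = B e0 \<eta> + s * B \<eta> \<eta>"
          using sym_form_sym[OF B \<eta> \<psi>] sym_form_lincomb[OF B e0(1) \<eta> \<eta>, of 1 s] by (simp add: \<psi>_def)
        also have "B \<eta> e0 = B e0 \<eta>" by (rule sym_form_sym[OF B \<eta> e0(1)])
        finally show ?thesis by (simp add: algebra_simps power2_eq_square)
      qed
      have "M * ip e0 e0 = a e0 e0" using e0 by (simp add: M_def)
      then show ?thesis using Qnn[OF \<psi>] unfolding ex[OF ip] ex[OF a] Q_def by (simp add: algebra_simps)
    qed
    define q1 q2 where "q1 = Q e0 \<eta>" and "q2 = Q \<eta> \<eta>"
    have q2: "0 \<le> q2" using Qnn[OF \<eta>] by (simp add: q2_def Q_def)
    \<comment> \<open>The trial step \<open>- q1 / u\<close> nearly minimises the quadratic in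
      \<open>s\<close>; adding 1 avoids dividing by zero when \<open>q2 = 0\<close>.\<close>
    define u where "u = q2 + 1"
    have u: "0 < u" using q2 by (simp add: u_def)
    have "0 \<le> u\<^sup>2 * (2 * (- q1 / u) * q1 + (- q1 / u)\<^sup>2 * q2)"
      using q[of "- q1 / u"] by (intro mult_nonneg_nonneg) (auto simp: q1_def q2_def)
    also have "\<dots> = - 2 * q1\<^sup>2 * u + q1\<^sup>2 * q2"
    proof -
      have "u\<^sup>2 * (- q1 / u)\<^sup>2 = q1\<^sup>2" "u\<^sup>2 * (2 * (- q1 / u) * q1) = - 2 * q1\<^sup>2 * u"
        using u by (simp_all add: power_divide power2_eq_square)
      then show ?thesis by (simp only: distrib_left mult.assoc[symmetric])
    qed
    finally have "q1\<^sup>2 * (q2 + 2) \<le> 0" by (simp add: u_def algebra_simps)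
    moreover have "0 < q1\<^sup>2 * (q2 + 2)" using ne q2 by (simp add: q1_def)
    ultimately show False by simp
  qed
  define e where "e = (\<lambda>x. (1 / sqrt (ip e0 e0)) * e0 x)"
  have e: "e \<in> X" unfolding e_def by (rule fun_subspace_scale[OF X e0(1)])
  show ?thesis
  proof (rule that[OF e])
    have "ip e e = (1 / sqrt (ip e0 e0)) * ip e0 e" 
      by (subst (1) e_def) (rule sym_form_scale[OF ip e0(1) e])
    also have "ip e0 e = ip e e0" by (rule sym_form_sym[OF ip e0(1) e])
    also have "\<dots> = (1 / sqrt (ip e0 e0)) * ip e0 e0" unfolding e_def by (rule sym_form_scale[OF ip e0(1) e0(1)])
    finally show "ip e e = 1" using e0(2) by (simp add: field_simps)
    fix \<eta> assume \<eta>: "\<eta> \<in> X"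
    show "a e \<eta> = M * ip e \<eta>"
      unfolding e_def sym_form_scale[OF ip e0(1) \<eta>] sym_form_scale[OF a e0(1) \<eta>] using Q0[OF \<eta>] by (simp add: Q_def)
  qed
qed

definition eigenbasis_on ::
  "('a \<Rightarrow> real) set \<Rightarrow> (('a \<Rightarrow> real) \<Rightarrow> ('a \<Rightarrow> real) \<Rightarrow> real) \<Rightarrow> (('a \<Rightarrow> real) \<Rightarrow> ('a \<Rightarrow> real) \<Rightarrow> real) \<Rightarrow>
   nat \<Rightarrow> (nat \<Rightarrow> 'a \<Rightarrow> real) \<Rightarrow> (nat \<Rightarrow> real) \<Rightarrow> bool" where
  "eigenbasis_on X ip a m e ev \<longleftrightarrow>
     (\<forall>i<m. e i \<in> X \<and> (\<forall>\<eta>\<in>X. a (e i) \<eta> = ev i * ip (e i) \<eta>)) \<and>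
     (\<forall>i<m. \<forall>j<m. ip (e i) (e j) = (if i = j then 1 else 0)) \<and>
     (\<forall>\<phi>\<in>X. \<phi> = (\<lambda>x. \<Sum>i<m. ip \<phi> (e i) * e i x))"

text \<open>The orthogonal complement of an eigenvector is determined by one point less.\<close>

theorem orthonormal_eigenbasis:
  assumes X: "fun_subspace X" and Z: "determining Z X"
    and ip: "sym_form_on X ip" and pos: "\<And>\<phi>. \<phi> \<in> X \<Longrightarrow> \<phi> \<noteq> (\<lambda>x. 0) \<Longrightarrow> 0 < ip \<phi> \<phi>"
    and a: "sym_form_on X a"
  shows "\<exists>m e ev. eigenbasis_on X ip a m e ev"
  using assms
proof (induction "card Z" arbitrary: X Z rule: less_induct)
  case less
  note X = less.prems(1) and Z = less.prems(2) and ip = less.prems(3) and pos = less.prems(4) and a = less.prems(5)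
  show ?case
  proof (cases "X = {\<lambda>x. 0}")
    case True
    then show ?thesis unfolding eigenbasis_on_def by (intro exI[of _ 0]) auto
  next
    case False
    obtain e1 M where e1: "e1 \<in> X" "ip e1 e1 = 1" and eig: "\<And>\<eta>. \<eta> \<in> X \<Longrightarrow> a e1 \<eta> = M * ip e1 \<eta>"
      using exists_eigenvector[OF X Z ip pos a False] by blast
    obtain Z' b where Z': "Z' \<subseteq> Z" and b: "\<forall>z\<in>Z'. b z \<in> X"
      and "\<forall>z\<in>Z'. \<forall>y\<in>Z'. b z y = (if z = y then 1 else 0)"
      and exp: "\<forall>\<phi>\<in>X. \<phi> = (\<lambda>x. \<Sum>z\<in>Z'. \<phi> z * b z x)"
      by (rule nodal_basis[OF X Z])
    note b = bspec[OF b] and exp = bspec[OF exp]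
    have finZ: "finite Z" using Z by (simp add: determining_def)
    have fin: "finite Z'" using finite_subset[OF Z' finZ] .
    define W where "W = {\<phi>\<in>X. ip \<phi> e1 = 0}"
    have WX: "W \<subseteq> X" by (auto simp: W_def)
    \<comment> \<open>Otherwise \<open>e1\<close> would be orthogonal to its own nodal
      expansion.\<close>
    have "\<exists>z\<in>Z'. ip (b z) e1 \<noteq> 0"
    proof (rule ccontr)
      assume "\<not> ?thesis"
      then have "(\<Sum>z\<in>Z'. e1 z * ip (b z) e1) = 0" by (intro sum.neutral) auto
      then have "ip e1 e1 = 0" by (subst (1) exp[OF e1(1)], subst sym_form_sum[OF X ip b e1(1)]) auto
      then show False using e1 by simp
    qed
    then obtain z0 where z0: "z0 \<in> Z'" "ip (b z0) e1 \<noteq> 0" by blast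
    \<comment> \<open>A member of the complement that vanishes at the other nodes is a multiple of
      \<open>b z0\<close>, and orthogonality to \<open>e1\<close> makes the multiple zero.\<close>
    have detW: "determining (Z' - {z0}) W"
      unfolding determining_def
    proof (intro conjI ballI impI)
      fix \<phi> assume \<phi>: "\<phi> \<in> W" "\<forall>z\<in>Z' - {z0}. \<phi> z = 0"
      have "(\<Sum>z\<in>Z'. \<phi> z * g z) = \<phi> z0 * g z0" for g
        using \<phi>(2) by (subst sum.remove[OF fin z0(1)]) (simp add: sum.neutral)
      then have e: "\<phi> = (\<lambda>x. \<phi> z0 * b z0 x)" using exp[of \<phi>] \<phi>(1) WX by auto
      have "0 = ip \<phi> e1" using \<phi>(1) by (simp add: W_def)
      also have "ip \<phi> e1 = \<phi> z0 * ip (b z0) e1" by (subst e, rule sym_form_scale[OF ip b[OF z0(1)] e1(1)])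
      finally have "\<phi> z0 = 0" using z0 by simp
      then show "\<phi> = (\<lambda>x. 0)" using e by simp
    qed (use fin in auto)
    have W: "fun_subspace W"
      unfolding fun_subspace_def
    proof (intro conjI ballI allI)
      show "(\<lambda>x. 0) \<in> W" using fun_subspace_0[OF X] sym_form_0[OF ip e1(1)] by (simp add: W_def)
      fix \<phi> \<psi> :: "'a \<Rightarrow> real" and s t assume "\<phi> \<in> W" "\<psi> \<in> W"
      then show "(\<lambda>x. s * \<phi> x + t * \<psi> x) \<in> W"
        using fun_subspace_lincomb[OF X, of \<phi> \<psi> s t] sym_form_lincomb[OF ip _ _ e1(1), of \<phi> \<psi> s t] by (simp add: W_def)
    qed
    have sub: "sym_form_on W B" if "sym_form_on X B" for B
      using that WX unfolding sym_form_on_def by (meson subsetD)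
    have "card (Z' - {z0}) < card Z"
      using card_Diff1_less[OF fin z0(1)] card_mono[OF finZ Z'] by simp
    moreover have "\<And>\<phi>. \<phi> \<in> W \<Longrightarrow> \<phi> \<noteq> (\<lambda>x. 0) \<Longrightarrow> 0 < ip \<phi> \<phi>"
      using pos WX by auto
    ultimately have "\<exists>m e ev. eigenbasis_on W ip a m e ev"
      by (intro less.hyps[OF _ W detW sub[OF ip] _ sub[OF a]])
    then obtain m e ev where basis: "eigenbasis_on W ip a m e ev" by blast
    note e = conjunct1[OF basis[unfolded eigenbasis_on_def]]
      and on = conjunct1[OF conjunct2[OF basis[unfolded eigenbasis_on_def]]]
      and ex = conjunct2[OF conjunct2[OF basis[unfolded eigenbasis_on_def]]]
    define e' where "e' = (\<lambda>i. if i < m then e i else e1)"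
    define ev' where "ev' = (\<lambda>i. if i < m then ev i else M)"
    have eX: "e i \<in> X" "ip (e i) e1 = 0" "ip e1 (e i) = 0" if "i < m" for i
      using e that WX sym_form_sym[OF ip e1(1), of "e i"] by (auto simp: W_def)
    have proj: "(\<lambda>x. \<eta> x - ip \<eta> e1 * e1 x) \<in> W" if \<eta>: "\<eta> \<in> X" for \<eta>
    proof -
      have "(\<lambda>x. 1 * \<eta> x + (- ip \<eta> e1) * e1 x) \<in> X" by (intro fun_subspace_lincomb[OF X] \<eta> e1)
      moreover have "ip (\<lambda>x. 1 * \<eta> x + (- ip \<eta> e1) * e1 x) e1 = 0"
        using sym_form_lincomb[OF ip \<eta> e1(1) e1(1), of 1 "- ip \<eta> e1"] e1(2) by simp
      ultimately show ?thesis by (simp add: W_def)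
    qed
    \<comment> \<open>The induction hypothesis tests the eigenvalue equation only against the
      complement \<open>W\<close>; the splitting extends it to all of \<open>X\<close>.\<close>
    have decomp: "B (e i) \<eta> = B (e i) (\<lambda>x. \<eta> x - ip \<eta> e1 * e1 x) + ip \<eta> e1 * B (e i) e1"
      if B: "sym_form_on X B" and \<eta>: "\<eta> \<in> X" and i: "i < m" for B \<eta> i
    proof -
      let ?p = "\<lambda>x. \<eta> x - ip \<eta> e1 * e1 x"
      have pX: "?p \<in> X" using proj[OF \<eta>] WX by auto
      have "B \<eta> (e i) = B (\<lambda>x. 1 * ?p x + ip \<eta> e1 * e1 x) (e i)" by simp
      also have "\<dots> = 1 * B ?p (e i) + ip \<eta> e1 * B e1 (e i)"
        by (rule sym_form_lincomb[OF B pX e1(1) eX(1)[OF i]])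
      finally show ?thesis
        using sym_form_sym[OF B \<eta> eX(1)[OF i]] sym_form_sym[OF B pX eX(1)[OF i]] sym_form_sym[OF B e1(1) eX(1)[OF i]] by simp
    qed
    have 1: "\<forall>i<Suc m. e' i \<in> X \<and> (\<forall>\<eta>\<in>X. a (e' i) \<eta> = ev' i * ip (e' i) \<eta>)"
    proof (intro allI impI conjI ballI)
      fix i assume i: "i < Suc m"
      then show "e' i \<in> X" using eX e1 by (simp add: e'_def)
      fix \<eta> assume \<eta>: "\<eta> \<in> X"
      show "a (e' i) \<eta> = ev' i * ip (e' i) \<eta>"
      proof (cases "i < m")
        case True
        have "a (e i) e1 = 0"
          using sym_form_sym[OF a eX(1)[OF True] e1(1)] eig[OF eX(1)[OF True]] eX(3)[OF True] by simp
        then show ?thesis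
          using decomp[OF a \<eta> True] decomp[OF ip \<eta> True] eX(2)[OF True] e True proj[OF \<eta>] by (simp add: e'_def ev'_def)
      qed (use eig[OF \<eta>] in \<open>simp add: e'_def ev'_def\<close>)
    qed
    have 2: "\<forall>i<Suc m. \<forall>j<Suc m. ip (e' i) (e' j) = (if i = j then 1 else 0)"
      using on eX e1 by (auto simp: e'_def less_Suc_eq)
    have 3: "\<forall>\<phi>\<in>X. \<phi> = (\<lambda>x. \<Sum>i<Suc m. ip \<phi> (e' i) * e' i x)"
    proof
      fix \<phi> assume \<phi>: "\<phi> \<in> X"
      let ?p = "\<lambda>x. \<phi> x - ip \<phi> e1 * e1 x"
      have pX: "?p \<in> X" using proj[OF \<phi>] WX by auto
      have c: "ip ?p (e i) = ip \<phi> (e i)" if "i < m" for i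
        using decomp[OF ip \<phi> that] eX(2)[OF that] sym_form_sym[OF ip \<phi> eX(1)[OF that]] sym_form_sym[OF ip pX eX(1)[OF that]] by simp
      have "?p x = (\<Sum>i<m. ip ?p (e i) * e i x)" for x
        using bspec[OF ex proj[OF \<phi>]] by (rule fun_cong)
      then have "?p x = (\<Sum>i<m. ip \<phi> (e i) * e i x)" for x using c by simp
      then have "\<phi> x = (\<Sum>i<m. ip \<phi> (e i) * e i x) + ip \<phi> e1 * e1 x" for x by (simp only: diff_eq_eq)
      moreover have "(\<Sum>i<m. ip \<phi> (e i) * e i x) + ip \<phi> e1 * e1 x = (\<Sum>i<Suc m. ip \<phi> (e' i) * e' i x)" for x
        by (simp add: e'_def)
      ultimately show "\<phi> = (\<lambda>x. \<Sum>i<Suc m. ip \<phi> (e' i) * e' i x)"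
        by (intro ext) (rule trans)
    qed
    show ?thesis
      unfolding eigenbasis_on_def
      by (rule exI[of _ "Suc m"], rule exI[of _ e'], rule exI[of _ ev'], rule conjI[OF 1 conjI[OF 2 3]])
  qed
qed

section \<open>The finite element space\<close>

lemma L2_mult_integrable:
  assumes v: "v \<in> L2 \<Omega>" and w: "w \<in> L2 \<Omega>"
  shows "integrable (lebesgue_on \<Omega>) (\<lambda>x. v x * w x)"
proof (rule Bochner_Integration.integrable_bound)
  show "integrable (lebesgue_on \<Omega>) (\<lambda>x. (v x)\<^sup>2 + (w x)\<^sup>2)" using v w by (simp add: L2_def)
  show "(\<lambda>x. v x * w x) \<in> borel_measurable (lebesgue_on \<Omega>)" using v w by (auto simp: L2_def)
  show "AE x in lebesgue_on \<Omega>. norm (v x * w x) \<le> norm ((v x)\<^sup>2 + (w x)\<^sup>2)"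
  proof (rule AE_I2)
    fix x
    have "2 * (\<bar>v x\<bar> * \<bar>w x\<bar>) \<le> (v x)\<^sup>2 + (w x)\<^sup>2"
      using sum_squares_bound[of "\<bar>v x\<bar>" "\<bar>w x\<bar>"] by (simp add: mult.assoc)
    moreover have "0 \<le> \<bar>v x\<bar> * \<bar>w x\<bar>" by simp
    ultimately have "\<bar>v x\<bar> * \<bar>w x\<bar> \<le> (v x)\<^sup>2 + (w x)\<^sup>2" by linarith
    then show "norm (v x * w x) \<le> norm ((v x)\<^sup>2 + (w x)\<^sup>2)" by (simp add: abs_mult)
  qed
qed

lemma L2_lincomb:
  assumes v: "v \<in> L2 \<Omega>" and w: "w \<in> L2 \<Omega>"
  shows "(\<lambda>x. a * v x + b * w x) \<in> L2 \<Omega>"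
proof -
  have "integrable (lebesgue_on \<Omega>) (\<lambda>x. a\<^sup>2 * (v x)\<^sup>2 + 2 * a * b * (v x * w x) + b\<^sup>2 * (w x)\<^sup>2)"
    using v w L2_mult_integrable[OF v w] by (simp add: L2_def)
  moreover have "(\<lambda>x. a\<^sup>2 * (v x)\<^sup>2 + 2 * a * b * (v x * w x) + b\<^sup>2 * (w x)\<^sup>2) = (\<lambda>x. (a * v x + b * w x)\<^sup>2)"
    by (auto simp: fun_eq_iff algebra_simps power2_eq_square)
  moreover have "(\<lambda>x. a * v x + b * w x) \<in> borel_measurable (lebesgue_on \<Omega>)"
    using v w by (intro borel_measurable_add borel_measurable_times) (auto simp: L2_def)
  ultimately show ?thesis by (simp add: L2_def)
qed

lemma L2_subspace: "fun_subspace (L2 \<Omega>)"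
  unfolding fun_subspace_def by (intro conjI ballI allI L2_lincomb) (simp_all add: L2_def)

lemma L2_inner_commute: "L2_inner \<Omega> v w = L2_inner \<Omega> w v"
  by (simp add: L2_inner_def mult.commute)

lemma L2_inner_lincomb:
  assumes "v \<in> L2 \<Omega>" "w \<in> L2 \<Omega>" "z \<in> L2 \<Omega>"
  shows "L2_inner \<Omega> (\<lambda>x. a * v x + b * w x) z = a * L2_inner \<Omega> v z + b * L2_inner \<Omega> w z"
proof -
  have "L2_inner \<Omega> (\<lambda>x. a * v x + b * w x) z = (\<integral>x. a * (v x * z x) + b * (w x * z x) \<partial>lebesgue_on \<Omega>)"
    unfolding L2_inner_def by (intro Bochner_Integration.integral_cong refl) (simp add: algebra_simps)
  then show ?thesis
    using L2_mult_integrable[of v \<Omega> z] L2_mult_integrable[of w \<Omega> z] assms by (simp add: L2_inner_def)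
qed

lemma L2_sym_form: "X \<subseteq> L2 \<Omega> \<Longrightarrow> sym_form_on X (L2_inner \<Omega>)"
  unfolding sym_form_on_def by (intro conjI ballI allI L2_inner_commute L2_inner_lincomb) auto

lemma L2_inner_nonneg: "0 \<le> L2_inner \<Omega> v v"
  unfolding L2_inner_def by (intro integral_nonneg_AE AE_I2) simp

lemma open_null_set_empty:
  fixes S :: "'a::euclidean_space set"
  assumes "open S" "S \<in> null_sets lebesgue" shows "S = {}"
proof (rule ccontr)
  assume "S \<noteq> {}"
  then obtain x where "x \<in> S" by blast
  then obtain e where e: "0 < e" "ball x e \<subseteq> S" using openE[OF assms(1)] by metis
  have "negligible (ball x e)"
    using assms(2) by (intro negligible_subset[OF _ e(2)]) (simp add: negligible_iff_null_sets)
  then have "measure lebesgue (ball x e) = 0"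
    unfolding negligible_iff_null_sets by (rule measure_eq_0_null_sets)
  moreover have "measure lebesgue (ball x e) = measure lborel (ball x e)"
    by (rule measure_completion) simp
  ultimately show False using content_ball_pos[OF e(1), of x] by linarith
qed

lemma grad_affine:
  assumes "\<forall>y\<in>K. \<phi> y = a \<bullet> y + b" "x \<in> interior K"
  shows "grad \<phi> x = a"
proof -
  have "((\<lambda>y. a \<bullet> y + b) has_derivative (\<lambda>h. a \<bullet> h)) (at x)"
    by (auto intro!: derivative_eq_intros)
  then have "(\<phi> has_derivative (\<lambda>h. a \<bullet> h)) (at x)"
    by (rule has_derivative_transform_within_open[OF _ open_interior assms(2)])
      (use assms(1) interior_subset in fastforce)
  then have "frechet_derivative \<phi> (at x) = (\<lambda>h. a \<bullet> h)"
    using frechet_derivative_at by metis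
  then show ?thesis by (simp add: grad_def euclidean_representation)
qed

section \<open>Finite element functions on one mesh: nodes, positivity, gradients and the Dirichlet
  form\<close>

context
  fixes \<Omega> :: "'a::euclidean_space set" and \<T> :: "'a set set"
  assumes dom: "convex_polyhedral_domain \<Omega>" and mesh: "mesh_of \<Omega> \<T>"
begin

lemma fe_space_affine:
  assumes "\<phi> \<in> fe_space \<Omega> \<T>" "K \<in> \<T>"
  obtains a b where "\<forall>x\<in>K. \<phi> x = a \<bullet> x + b"
proof -
  have "\<exists>a b. \<forall>x\<in>K. \<phi> x = a \<bullet> x + b" using assms by (simp add: fe_space_def)
  then show ?thesis by (elim exE) (rule that)
qed

lemma domain_open: "open \<Omega>" using dom by (simp add: convex_polyhedral_domain_def)

lemma domain_bounded: "bounded \<Omega>"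
  using dom unfolding convex_polyhedral_domain_def
  by (meson bounded_closure_image bounded_subset closure_subset polytope_imp_bounded)

lemma domain_lmeasurable: "\<Omega> \<in> lmeasurable"
  using domain_open domain_bounded by (rule lmeasurable_open[rotated])

lemma mesh_finite: "finite \<T>"
  using mesh by (simp add: mesh_of_def triangulation_def)

lemma mesh_vertices:
  assumes "K \<in> \<T>" obtains C where "finite C" "K = convex hull C"
  using mesh assms unfolding mesh_of_def simplex by blast

lemma mesh_Union: "\<Union>\<T> = closure \<Omega>"
  using mesh by (simp add: mesh_of_def)

lemma fe_space_subspace: "fun_subspace (fe_space \<Omega> \<T>)"
  unfolding fun_subspace_def
proof (intro conjI ballI allI)
  show "(\<lambda>x. 0) \<in> fe_space \<Omega> \<T>"
    unfolding fe_space_def by (auto intro!: exI[of _ 0])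
  fix \<phi> \<psi> :: "'a \<Rightarrow> real" and a b :: real assume \<phi>: "\<phi> \<in> fe_space \<Omega> \<T>" and \<psi>: "\<psi> \<in> fe_space \<Omega> \<T>"
  have "\<exists>p q. \<forall>x\<in>K. a * \<phi> x + b * \<psi> x = p \<bullet> x + q" if K: "K \<in> \<T>" for K
  proof -
    obtain p q where pq: "\<forall>x\<in>K. \<phi> x = p \<bullet> x + q" by (rule fe_space_affine[OF \<phi> K])
    obtain p' q' where pq': "\<forall>x\<in>K. \<psi> x = p' \<bullet> x + q'" by (rule fe_space_affine[OF \<psi> K])
    from pq pq' have "\<forall>x\<in>K. a * \<phi> x + b * \<psi> x = (a *\<^sub>R p + b *\<^sub>R p') \<bullet> x + (a * q + b * q')"
      by (simp add: inner_add_left algebra_simps)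
    then show ?thesis by blast
  qed
  then show "(\<lambda>x. a * \<phi> x + b * \<psi> x) \<in> fe_space \<Omega> \<T>"
    using \<phi> \<psi> unfolding fe_space_def by (auto intro!: continuous_intros)
qed

text \<open>An affine function that vanishes at the vertices of a cell vanishes on their convex
  hull, and off the domain the functions are zero by convention.\<close>

lemma fe_space_determining: "\<exists>Z. determining Z (fe_space \<Omega> \<T>)"
proof -
  have "\<forall>K\<in>\<T>. \<exists>C. finite C \<and> K = convex hull C" using mesh_vertices by metis
  then obtain V where V: "\<And>K. K \<in> \<T> \<Longrightarrow> finite (V K)" "\<And>K. K \<in> \<T> \<Longrightarrow> K = convex hull (V K)"
    by metis
  have "\<phi> = (\<lambda>x. 0)" if \<phi>: "\<phi> \<in> fe_space \<Omega> \<T>" and z: "\<forall>z\<in>(\<Union>K\<in>\<T>. V K). \<phi> z = 0" for \<phi>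
  proof
    fix x
    show "\<phi> x = 0"
    proof (cases "x \<in> \<Omega>")
      case True
      then obtain K where K: "K \<in> \<T>" "x \<in> K" using mesh_Union closure_subset by blast
      obtain a b where ab: "\<forall>y\<in>K. \<phi> y = a \<bullet> y + b" using \<phi> K(1) by (rule fe_space_affine)
      have "V K \<subseteq> K" using V(2)[OF K(1)] hull_subset by metis
      then have "V K \<subseteq> {y. a \<bullet> y = - b}" using ab z K(1) by force
      then have "convex hull (V K) \<subseteq> {y. a \<bullet> y = - b}" by (rule hull_minimal) (rule convex_hyperplane)
      then have "a \<bullet> x = - b" using K V(2)[OF K(1)] by blast
      then show ?thesis using ab K by simp
    qed (use \<phi> in \<open>simp add: fe_space_def\<close>)
  qed
  then have "determining (\<Union>K\<in>\<T>. V K) (fe_space \<Omega> \<T>)"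
    using V(1) mesh_finite by (simp add: determining_def)
  then show ?thesis by blast
qed

lemma fe_space_L2: "fe_space \<Omega> \<T> \<subseteq> L2 \<Omega>"
proof
  fix \<phi> assume \<phi>: "\<phi> \<in> fe_space \<Omega> \<T>"
  have c: "continuous_on (closure \<Omega>) \<phi>" using \<phi> by (simp add: fe_space_def)
  have m: "\<phi> \<in> borel_measurable (lebesgue_on \<Omega>)"
    using continuous_on_subset[OF c closure_subset] domain_open
    by (intro continuous_imp_measurable_on_sets_lebesgue) auto
  have "bounded (\<phi> ` closure \<Omega>)"
    using c domain_bounded by (intro compact_imp_bounded compact_continuous_image) (auto simp: compact_closure)
  then obtain B where B: "\<And>x. x \<in> closure \<Omega> \<Longrightarrow> \<bar>\<phi> x\<bar> \<le> B" by (auto simp: bounded_iff)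
  have "integrable (lebesgue_on \<Omega>) (\<lambda>x. (\<phi> x)\<^sup>2)"
  proof (rule finite_measure.integrable_const_bound[OF finite_measure_lebesgue_on[OF domain_lmeasurable], where B = "B\<^sup>2"])
    show "AE x in lebesgue_on \<Omega>. norm ((\<phi> x)\<^sup>2) \<le> B\<^sup>2"
    proof (rule AE_I2)
      fix x assume "x \<in> space (lebesgue_on \<Omega>)"
      then have "\<bar>\<phi> x\<bar> \<le> B" using B closure_subset by (auto simp: space_restrict_space)
      then show "norm ((\<phi> x)\<^sup>2) \<le> B\<^sup>2" by (simp add: abs_le_square_iff[symmetric])
    qed
    show "(\<lambda>x. (\<phi> x)\<^sup>2) \<in> borel_measurable (lebesgue_on \<Omega>)" using m by measurable
  qed
  then show "\<phi> \<in> L2 \<Omega>" using m by (simp add: L2_def)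
qed

text \<open>Continuity makes the set where \<open>\<phi>\<close> is nonzero inside the domain open,
  and an open null set is empty. The extension by zero then gives equality with the zero function
  everywhere.\<close>

lemma L2_inner_pos:
  assumes \<phi>: "\<phi> \<in> fe_space \<Omega> \<T>" "\<phi> \<noteq> (\<lambda>x. 0)"
  shows "0 < L2_inner \<Omega> \<phi> \<phi>"
proof (rule ccontr)
  assume "\<not> ?thesis"
  then have "L2_inner \<Omega> \<phi> \<phi> = 0" using L2_inner_nonneg[of \<Omega> \<phi>] by simp
  then have "AE x in lebesgue_on \<Omega>. \<phi> x * \<phi> x = 0"
    using L2_mult_integrable[of \<phi> \<Omega> \<phi>] \<phi>(1) fe_space_L2 unfolding L2_inner_def
    by (subst (asm) integral_nonneg_eq_0_iff_AE) auto
  then have ae: "AE x in lebesgue. x \<in> \<Omega> \<longrightarrow> \<phi> x = 0"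
    using domain_open by (subst (asm) AE_restrict_space_iff) auto
  define S where "S = \<Omega> \<inter> \<phi> -` (- {0})"
  have c: "continuous_on \<Omega> \<phi>"
    using \<phi>(1) continuous_on_subset[OF _ closure_subset] by (auto simp: fe_space_def)
  have S: "open S" unfolding S_def
    by (rule continuous_open_preimage[OF c domain_open]) auto
  have "AE x in lebesgue. x \<notin> S" using ae by eventually_elim (auto simp: S_def)
  then have "S \<in> null_sets lebesgue" using S by (subst AE_iff_null_sets) auto
  then have "S = {}" using S by (rule open_null_set_empty[rotated])
  then have "\<phi> = (\<lambda>x. 0)" using \<phi>(1) unfolding S_def fe_space_def by (auto simp: fun_eq_iff)
  then show False using \<phi>(2) by contradiction
qed

definition mesh_interior :: "'a set" where "mesh_interior = (\<Union>K\<in>\<T>. interior K)"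

lemma negligible_diff_mesh_interior: "negligible (\<Omega> - mesh_interior)"
proof (rule negligible_subset)
  have conv: "convex K \<and> closed K" if "K \<in> \<T>" for K
    using mesh_vertices[OF that] by (metis compact_imp_closed convex_convex_hull finite_imp_compact_convex_hull)
  show "negligible (\<Union>K\<in>\<T>. frontier K)"
    using mesh_finite conv by (intro negligible_Union) (auto intro: negligible_convex_frontier)
  show "\<Omega> - mesh_interior \<subseteq> (\<Union>K\<in>\<T>. frontier K)"
  proof
    fix x assume x: "x \<in> \<Omega> - mesh_interior"
    then obtain K where K: "K \<in> \<T>" "x \<in> K" using mesh_Union closure_subset by blast
    then have "x \<in> frontier K" using x conv[OF K(1)] by (auto simp: frontier_def mesh_interior_def)
    then show "x \<in> (\<Union>K\<in>\<T>. frontier K)" using K by blast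
  qed
qed

lemma AE_mesh_interior: "AE x in lebesgue_on \<Omega>. x \<in> mesh_interior"
proof -
  have "AE x in lebesgue. x \<notin> \<Omega> - mesh_interior"
    using negligible_diff_mesh_interior by (subst AE_iff_null_sets[symmetric]) (auto simp: negligible_iff_null_sets)
  then show ?thesis using domain_open by (subst AE_restrict_space_iff) auto
qed

lemma grad_lincomb:
  assumes \<phi>: "\<phi> \<in> fe_space \<Omega> \<T>" and \<psi>: "\<psi> \<in> fe_space \<Omega> \<T>" and x: "x \<in> mesh_interior"
  shows "grad (\<lambda>x. s * \<phi> x + t * \<psi> x) x = s *\<^sub>R grad \<phi> x + t *\<^sub>R grad \<psi> x"
proof -
  obtain K where K: "K \<in> \<T>" "x \<in> interior K" using x by (auto simp: mesh_interior_def)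
  obtain p q where pq: "\<forall>x\<in>K. \<phi> x = p \<bullet> x + q" using \<phi> K(1) by (rule fe_space_affine)
  obtain p' q' where pq': "\<forall>x\<in>K. \<psi> x = p' \<bullet> x + q'" using \<psi> K(1) by (rule fe_space_affine)
  have "\<forall>x\<in>K. s * \<phi> x + t * \<psi> x = (s *\<^sub>R p + t *\<^sub>R p') \<bullet> x + (s * q + t * q')"
    using pq pq' by (simp add: inner_add_left algebra_simps)
  then show ?thesis
    by (simp only: grad_affine[OF _ K(2)] grad_affine[OF pq K(2)] grad_affine[OF pq' K(2)])
qed

text \<open>On the open set of cell interiors the integrand is locally constant, hence continuous
  and measurable, and it takes finitely many values. The cell frontiers are null sets.\<close>

lemma grad_inner_integrable:
  assumes \<phi>: "\<phi> \<in> fe_space \<Omega> \<T>" and \<psi>: "\<psi> \<in> fe_space \<Omega> \<T>"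
  shows "integrable (lebesgue_on \<Omega>) (\<lambda>x. grad \<phi> x \<bullet> grad \<psi> x)"
proof -
  let ?f = "\<lambda>x. grad \<phi> x \<bullet> grad \<psi> x"
  obtain p where p: "\<And>K. K \<in> \<T> \<Longrightarrow> \<exists>b. \<forall>x\<in>K. \<phi> x = p K \<bullet> x + b"
    using \<phi> unfolding fe_space_def by (simp add: Bex_def) metis
  obtain q where q: "\<And>K. K \<in> \<T> \<Longrightarrow> \<exists>b. \<forall>x\<in>K. \<psi> x = q K \<bullet> x + b"
    using \<psi> unfolding fe_space_def by (simp add: Bex_def) metis
  have val: "?f x = p K \<bullet> q K" if "K \<in> \<T>" "x \<in> interior K" for K x
    using p[OF that(1)] q[OF that(1)] grad_affine[OF _ that(2)] by metis
  have cont: "continuous_on mesh_interior ?f"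
    unfolding mesh_interior_def
  proof (rule continuous_on_open_UN)
    fix K assume "K \<in> \<T>"
    then have "continuous_on (interior K) ?f = continuous_on (interior K) (\<lambda>x. p K \<bullet> q K)"
      using val by (intro continuous_on_cong) auto
    then show "continuous_on (interior K) ?f" by simp
  qed auto
  have op: "open (\<Omega> \<inter> mesh_interior)" using domain_open by (auto simp: mesh_interior_def)
  have lm: "\<Omega> \<inter> mesh_interior \<in> lmeasurable"
    using domain_bounded op by (intro lmeasurable_open) (auto intro: bounded_subset)
  have "integrable (lebesgue_on (\<Omega> \<inter> mesh_interior)) ?f"
  proof (rule finite_measure.integrable_const_bound[OF finite_measure_lebesgue_on[OF lm]])
    show "?f \<in> borel_measurable (lebesgue_on (\<Omega> \<inter> mesh_interior))"
      using op by (intro continuous_imp_measurable_on_sets_lebesgue continuous_on_subset[OF cont]) auto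
    show "AE x in lebesgue_on (\<Omega> \<inter> mesh_interior). norm (?f x) \<le> (\<Sum>K\<in>\<T>. \<bar>p K \<bullet> q K\<bar>)"
    proof (rule AE_I2)
      fix x assume "x \<in> space (lebesgue_on (\<Omega> \<inter> mesh_interior))"
      then obtain K where K: "K \<in> \<T>" "x \<in> interior K" by (auto simp: mesh_interior_def space_restrict_space)
      have "norm (?f x) = \<bar>p K \<bullet> q K\<bar>" using val[OF K] by simp
      also have "\<dots> \<le> (\<Sum>K\<in>\<T>. \<bar>p K \<bullet> q K\<bar>)" using mesh_finite K(1) by (intro member_le_sum) auto
      finally show "norm (?f x) \<le> (\<Sum>K\<in>\<T>. \<bar>p K \<bullet> q K\<bar>)" .
    qed
  qed
  then have "?f absolutely_integrable_on (\<Omega> \<inter> mesh_interior)"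
    using op by (simp add: set_integrable_def integrable_restrict_space)
  moreover have "?f absolutely_integrable_on (\<Omega> \<inter> mesh_interior) \<longleftrightarrow> ?f absolutely_integrable_on \<Omega>"
    by (rule absolutely_integrable_spike_set_eq) (auto intro: negligible_subset[OF negligible_diff_mesh_interior])
  ultimately show ?thesis
    using domain_open by (simp add: set_integrable_def integrable_restrict_space)
qed

text \<open>The classical gradient is linear only inside cells, since its value at a point without
  derivative is arbitrary. Linearity of the form therefore goes through an almost everywhere
  identity.\<close>

lemma dirichlet_sym_form: "sym_form_on (fe_space \<Omega> \<T>) (dirichlet_form \<Omega>)"
  unfolding sym_form_on_def
proof (intro conjI ballI allI)
  show "dirichlet_form \<Omega> \<phi> \<psi> = dirichlet_form \<Omega> \<psi> \<phi>" for \<phi> \<psi>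
    by (simp add: dirichlet_form_def inner_commute)
  fix \<phi> \<psi> \<eta> :: "'a \<Rightarrow> real" and a b
  assume \<phi>: "\<phi> \<in> fe_space \<Omega> \<T>" and \<psi>: "\<psi> \<in> fe_space \<Omega> \<T>" and \<eta>: "\<eta> \<in> fe_space \<Omega> \<T>"
  have i: "integrable (lebesgue_on \<Omega>) (\<lambda>x. grad \<phi> x \<bullet> grad \<eta> x)" "integrable (lebesgue_on \<Omega>) (\<lambda>x. grad \<psi> x \<bullet> grad \<eta> x)"
    using \<phi> \<psi> \<eta> by (auto intro: grad_inner_integrable)
  have l: "(\<lambda>x. a * \<phi> x + b * \<psi> x) \<in> fe_space \<Omega> \<T>" using fun_subspace_lincomb[OF fe_space_subspace \<phi> \<psi>] .
  have "dirichlet_form \<Omega> (\<lambda>x. a * \<phi> x + b * \<psi> x) \<eta> = (\<integral>x. a * (grad \<phi> x \<bullet> grad \<eta> x) + b * (grad \<psi> x \<bullet> grad \<eta> x) \<partial>lebesgue_on \<Omega>)"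
    unfolding dirichlet_form_def
  proof (rule integral_cong_AE)
    show "(\<lambda>x. grad (\<lambda>x. a * \<phi> x + b * \<psi> x) x \<bullet> grad \<eta> x) \<in> borel_measurable (lebesgue_on \<Omega>)"
      using grad_inner_integrable[OF l \<eta>] by (rule borel_measurable_integrable)
    show "(\<lambda>x. a * (grad \<phi> x \<bullet> grad \<eta> x) + b * (grad \<psi> x \<bullet> grad \<eta> x)) \<in> borel_measurable (lebesgue_on \<Omega>)"
      using i by (intro borel_measurable_integrable) auto
    show "AE x in lebesgue_on \<Omega>. grad (\<lambda>x. a * \<phi> x + b * \<psi> x) x \<bullet> grad \<eta> x = a * (grad \<phi> x \<bullet> grad \<eta> x) + b * (grad \<psi> x \<bullet> grad \<eta> x)"
      using AE_mesh_interior by eventually_elim (simp add: grad_lincomb[OF \<phi> \<psi>] inner_add_left)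
  qed
  then show "dirichlet_form \<Omega> (\<lambda>x. a * \<phi> x + b * \<psi> x) \<eta> = a * dirichlet_form \<Omega> \<phi> \<eta> + b * dirichlet_form \<Omega> \<psi> \<eta>"
    using i by (simp add: dirichlet_form_def)
qed

end

lemma dirichlet_form_nonneg: "0 \<le> dirichlet_form \<Omega> \<phi> \<phi>"
  unfolding dirichlet_form_def by (intro integral_nonneg_AE AE_I2) simp

section \<open>Modal coordinates: all operators of the scheme become diagonal\<close>

locale fe_eigenbasis =
  fixes \<Omega> :: "'a::euclidean_space set" and \<T> :: "'a set set"
    and m :: nat and e :: "nat \<Rightarrow> 'a \<Rightarrow> real" and ev :: "nat \<Rightarrow> real"
  assumes dom: "convex_polyhedral_domain \<Omega>" and mesh: "mesh_of \<Omega> \<T>"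
    and basis: "eigenbasis_on (fe_space \<Omega> \<T>) (L2_inner \<Omega>) (dirichlet_form \<Omega>) m e ev"

lemma fe_eigenbasis_exists:
  assumes "convex_polyhedral_domain \<Omega>" and "mesh_of \<Omega> \<T>"
  shows "\<exists>m e ev. fe_eigenbasis \<Omega> \<T> m e ev"
proof -
  obtain Z where Z: "determining Z (fe_space \<Omega> \<T>)" using fe_space_determining[OF assms] by blast
  have "\<exists>m e ev. eigenbasis_on (fe_space \<Omega> \<T>) (L2_inner \<Omega>) (dirichlet_form \<Omega>) m e ev"
    by (rule orthonormal_eigenbasis[OF fe_space_subspace[OF assms] Z L2_sym_form[OF fe_space_L2[OF assms]] _ dirichlet_sym_form[OF assms]])
      (rule L2_inner_pos[OF assms])
  then show ?thesis using assms by (simp add: fe_eigenbasis_def)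
qed

context fe_eigenbasis
begin

abbreviation "X \<equiv> fe_space \<Omega> \<T>"
abbreviation "ip \<equiv> L2_inner \<Omega>"

lemma e_in: "i < m \<Longrightarrow> e i \<in> X"
  and eig: "i < m \<Longrightarrow> \<eta> \<in> X \<Longrightarrow> dirichlet_form \<Omega> (e i) \<eta> = ev i * ip (e i) \<eta>"
  and on: "i < m \<Longrightarrow> j < m \<Longrightarrow> ip (e i) (e j) = (if i = j then 1 else 0)"
  using basis by (simp_all add: eigenbasis_on_def)

lemma expand: "\<phi> \<in> X \<Longrightarrow> \<phi> = (\<lambda>x. \<Sum>i<m. ip \<phi> (e i) * e i x)"
  by (rule bspec[OF conjunct2[OF conjunct2[OF basis[unfolded eigenbasis_on_def]]]])

lemmas X_sub = fe_space_subspace[OF dom mesh]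
lemmas X_L2 = fe_space_L2[OF dom mesh]
lemmas ip_form = L2_sym_form[OF X_L2]
lemmas dir_form = dirichlet_sym_form[OF dom mesh]

lemma ev_nonneg: "i < m \<Longrightarrow> 0 \<le> ev i"
  using eig[of i "e i"] on[of i i] e_in[of i] dirichlet_form_nonneg[of \<Omega> "e i"] by simp

lemma comb_in: "(\<lambda>x. \<Sum>i<m. c i * e i x) \<in> X"
  by (intro fun_subspace_sum[OF X_sub]) (use e_in in auto)

lemma ip_comb:
  assumes \<eta>: "\<eta> \<in> X"
  shows "ip (\<lambda>x. \<Sum>i<m. c i * e i x) \<eta> = (\<Sum>i<m. c i * ip (e i) \<eta>)"
  by (rule sym_form_sum[OF X_sub ip_form _ \<eta>]) (use e_in in auto)

lemma coef_comb: "j < m \<Longrightarrow> ip (\<lambda>x. \<Sum>i<m. c i * e i x) (e j) = c j"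
  using ip_comb[OF e_in[of j], of c] on by (simp add: if_distrib cong: if_cong)

lemma eqI:
  assumes "\<phi> \<in> X" "\<psi> \<in> X" "\<And>i. i < m \<Longrightarrow> ip \<phi> (e i) = ip \<psi> (e i)"
  shows "\<phi> = \<psi>"
proof -
  have "(\<lambda>x. \<Sum>i<m. ip \<phi> (e i) * e i x) = (\<lambda>x. \<Sum>i<m. ip \<psi> (e i) * e i x)"
    by (intro ext sum.cong refl) (simp add: assms(3))
  from trans[OF expand[OF assms(1)] trans[OF this expand[OF assms(2), symmetric]]] show ?thesis .
qed

lemma parseval:
  assumes \<phi>: "\<phi> \<in> X" and \<psi>: "\<psi> \<in> X"
  shows "ip \<phi> \<psi> = (\<Sum>i<m. ip \<phi> (e i) * ip \<psi> (e i))"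
proof -
  have "ip \<phi> \<psi> = ip (\<lambda>x. \<Sum>i<m. ip \<phi> (e i) * e i x) \<psi>" by (subst (1) expand[OF \<phi>]) (rule refl)
  also have "\<dots> = (\<Sum>i<m. ip \<phi> (e i) * ip (e i) \<psi>)" by (rule ip_comb[OF \<psi>])
  also have "\<dots> = (\<Sum>i<m. ip \<phi> (e i) * ip \<psi> (e i))" by (simp add: L2_inner_commute)
  finally show ?thesis .
qed

lemma L2_norm_coef: "\<phi> \<in> X \<Longrightarrow> L2_norm \<Omega> \<phi> = L2_set (\<lambda>i. ip \<phi> (e i)) {..<m}"
  by (simp add: L2_norm_def L2_set_def parseval power2_eq_square)

lemma coef_lincomb:
  assumes "\<phi> \<in> X" "\<psi> \<in> X" "i < m"
  shows "ip (\<lambda>x. a * \<phi> x + b * \<psi> x) (e i) = a * ip \<phi> (e i) + b * ip \<psi> (e i)"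
  by (rule sym_form_lincomb[OF ip_form assms(1,2) e_in[OF assms(3)]])

lemma A_h_eq:
  assumes \<phi>: "\<phi> \<in> X"
  shows "A_h \<Omega> \<T> \<phi> = (\<lambda>x. \<Sum>i<m. (ev i * ip \<phi> (e i)) * e i x)" (is "_ = ?\<psi>")
  unfolding A_h_def
proof (rule the_equality)
  show "?\<psi> \<in> X \<and> (\<forall>\<eta>\<in>X. ip ?\<psi> \<eta> = dirichlet_form \<Omega> \<phi> \<eta>)"
  proof (intro conjI ballI comb_in)
    fix \<eta> assume \<eta>: "\<eta> \<in> X"
    have "dirichlet_form \<Omega> \<phi> \<eta> = dirichlet_form \<Omega> (\<lambda>x. \<Sum>i<m. ip \<phi> (e i) * e i x) \<eta>"
      by (subst (1) expand[OF \<phi>]) (rule refl)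
    also have "\<dots> = (\<Sum>i<m. ip \<phi> (e i) * dirichlet_form \<Omega> (e i) \<eta>)"
      by (rule sym_form_sum[OF X_sub dir_form _ \<eta>]) (use e_in in auto)
    also have "\<dots> = (\<Sum>i<m. (ev i * ip \<phi> (e i)) * ip (e i) \<eta>)"
      by (intro sum.cong refl) (simp add: eig[OF _ \<eta>])
    also have "\<dots> = ip ?\<psi> \<eta>" by (rule ip_comb[OF \<eta>, symmetric])
    finally show "ip ?\<psi> \<eta> = dirichlet_form \<Omega> \<phi> \<eta>" by simp
  qed
  then have *: "\<forall>\<eta>\<in>X. ip ?\<psi> \<eta> = dirichlet_form \<Omega> \<phi> \<eta>" by blast
  fix \<psi> assume \<psi>: "\<psi> \<in> X \<and> (\<forall>\<eta>\<in>X. ip \<psi> \<eta> = dirichlet_form \<Omega> \<phi> \<eta>)"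
  show "\<psi> = ?\<psi>"
    by (rule eqI) (use \<psi> comb_in e_in * in auto)
qed

lemma A_h_in: "\<phi> \<in> X \<Longrightarrow> A_h \<Omega> \<T> \<phi> \<in> X"
  by (simp add: A_h_eq comb_in)

lemma A_h_coef: "\<phi> \<in> X \<Longrightarrow> i < m \<Longrightarrow> ip (A_h \<Omega> \<T> \<phi>) (e i) = ev i * ip \<phi> (e i)"
  by (simp add: A_h_eq coef_comb)

text \<open>The Fourier sum of \<open>v\<close> is the unique candidate, which settles existence and
  uniqueness behind the definite description.\<close>

lemma projection:
  assumes v: "v \<in> L2 \<Omega>"
  shows "L2_projection \<Omega> \<T> v \<in> X" "\<And>\<eta>. \<eta> \<in> X \<Longrightarrow> ip (L2_projection \<Omega> \<T> v) \<eta> = ip v \<eta>"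
proof -
  define \<psi> where "\<psi> = (\<lambda>x. \<Sum>i<m. ip v (e i) * e i x)"
  have \<psi>: "\<psi> \<in> X" unfolding \<psi>_def by (rule comb_in)
  have orth: "ip \<psi> \<eta> = ip v \<eta>" if \<eta>: "\<eta> \<in> X" for \<eta>
  proof -
    have "sym_form_on (L2 \<Omega>) ip" by (rule L2_sym_form) simp
    moreover have "fun_subspace (L2 \<Omega>)" by (rule L2_subspace)
    ultimately have "ip (\<lambda>x. \<Sum>i<m. ip \<eta> (e i) * e i x) v = (\<Sum>i<m. ip \<eta> (e i) * ip (e i) v)"
      by (intro sym_form_sum[of "L2 \<Omega>"]) (use e_in X_L2 v in auto)
    then have "ip \<eta> v = (\<Sum>i<m. ip \<eta> (e i) * ip (e i) v)"
      by (subst (1) expand[OF \<eta>])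
    moreover have "ip \<psi> \<eta> = (\<Sum>i<m. ip v (e i) * ip (e i) \<eta>)" unfolding \<psi>_def by (rule ip_comb[OF \<eta>])
    ultimately show ?thesis by (simp add: L2_inner_commute mult.commute)
  qed
  have "L2_projection \<Omega> \<T> v = \<psi>"
    unfolding L2_projection_def
  proof (rule the_equality)
    show "\<psi> \<in> X \<and> (\<forall>\<eta>\<in>X. ip \<psi> \<eta> = ip v \<eta>)" using \<psi> orth by blast
    show "\<phi> = \<psi>" if "\<phi> \<in> X \<and> (\<forall>\<eta>\<in>X. ip \<phi> \<eta> = ip v \<eta>)" for \<phi>
      by (rule eqI) (use that \<psi> orth e_in in auto)
  qed
  then show "L2_projection \<Omega> \<T> v \<in> X" "\<And>\<eta>. \<eta> \<in> X \<Longrightarrow> ip (L2_projection \<Omega> \<T> v) \<eta> = ip v \<eta>"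
    using \<psi> orth by auto
qed

text \<open>Pythagoras: the squared norm of the residual is \<open>ip v v - ip p p\<close>.\<close>

lemma projection_norm:
  assumes v: "v \<in> L2 \<Omega>"
  shows "L2_norm \<Omega> (L2_projection \<Omega> \<T> v) \<le> L2_norm \<Omega> v"
proof -
  define p where "p = L2_projection \<Omega> \<T> v"
  have p: "p \<in> X" "ip p p = ip v p" using projection[OF v] by (auto simp: p_def)
  have pL: "p \<in> L2 \<Omega>" using p X_L2 by auto
  define d where "d = (\<lambda>x. 1 * v x + (- 1) * p x)"
  have d: "d \<in> L2 \<Omega>" unfolding d_def by (rule L2_lincomb[OF v pL])
  have "ip d d = ip v d - ip p d" using L2_inner_lincomb[OF v pL d, of 1 "- 1"] by (simp add: d_def)
  also have "ip v d = ip v v - ip p v"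
    using L2_inner_lincomb[OF v pL v, of 1 "- 1"] L2_inner_commute[of \<Omega> v d] by (simp add: d_def)
  also have "ip p d = ip v p - ip p p"
    using L2_inner_lincomb[OF v pL pL, of 1 "- 1"] L2_inner_commute[of \<Omega> p d] by (simp add: d_def)
  finally have "0 \<le> ip v v - ip p p"
    using L2_inner_nonneg[of \<Omega> d] p(2) L2_inner_commute[of \<Omega> p v] by simp
  then show ?thesis by (simp add: L2_norm_def p_def)
qed

lemma projection_zero: "L2_projection \<Omega> \<T> (\<lambda>x. 0) = (\<lambda>x. 0)"
proof (rule eqI)
  have z: "(\<lambda>x. 0) \<in> L2 \<Omega>" by (simp add: L2_def)
  show "L2_projection \<Omega> \<T> (\<lambda>x. 0) \<in> X" by (rule projection(1)[OF z])
  show "(\<lambda>x. 0) \<in> X" by (rule fun_subspace_0[OF X_sub])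
  show "ip (L2_projection \<Omega> \<T> (\<lambda>x. 0)) (e i) = ip (\<lambda>x. 0) (e i)" if "i < m" for i
    by (rule projection(2)[OF z e_in[OF that]])
qed

lemma step_op_in: "\<psi> \<in> X \<Longrightarrow> step_op \<Omega> \<T> \<alpha> \<tau> \<psi> \<in> X"
  unfolding step_op_def using fun_subspace_lincomb[OF X_sub, of \<psi> "A_h \<Omega> \<T> \<psi>" 1 "\<tau> powr \<alpha>"] A_h_in by simp

lemma step_op_coef: "\<psi> \<in> X \<Longrightarrow> i < m \<Longrightarrow> ip (step_op \<Omega> \<T> \<alpha> \<tau> \<psi>) (e i) = (1 + \<tau> powr \<alpha> * ev i) * ip \<psi> (e i)"
  unfolding step_op_def using coef_lincomb[of \<psi> "A_h \<Omega> \<T> \<psi>" i 1 "\<tau> powr \<alpha>"] A_h_in[of \<psi>] A_h_coef[of \<psi> i]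
  by (simp add: algebra_simps)

text \<open>Some root must exist before the choice operator says anything; the diagonal one will
  do.\<close>

lemma sqrt_exists: "\<exists>S. is_sqrt_on \<Omega> X (step_op \<Omega> \<T> \<alpha> \<tau>) S"
proof -
  define r where "r = (\<lambda>i. sqrt (1 + \<tau> powr \<alpha> * ev i))"
  define S where "S = (\<lambda>\<psi> x. \<Sum>i<m. (r i * ip \<psi> (e i)) * e i x)"
  have r: "0 \<le> r i" "r i * r i = 1 + \<tau> powr \<alpha> * ev i" if "i < m" for i
    using ev_nonneg[OF that] by (auto simp: r_def)
  have S: "S \<psi> \<in> X" for \<psi> unfolding S_def by (rule comb_in)
  have Sc: "ip (S \<psi>) (e i) = r i * ip \<psi> (e i)" if "i < m" for \<psi> i unfolding S_def by (rule coef_comb[OF that])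
  have "is_sqrt_on \<Omega> X (step_op \<Omega> \<T> \<alpha> \<tau>) S"
    unfolding is_sqrt_on_def
  proof (intro conjI ballI allI S)
    fix \<phi> \<eta> :: "'a \<Rightarrow> real" and a b assume \<phi>: "\<phi> \<in> X" and \<eta>: "\<eta> \<in> X"
    show "S (\<lambda>x. a * \<phi> x + b * \<eta> x) = (\<lambda>x. a * S \<phi> x + b * S \<eta> x)"
      by (rule eqI) (auto intro!: S fun_subspace_lincomb[OF X_sub] simp: Sc coef_lincomb[OF S S] coef_lincomb[OF \<phi> \<eta>] algebra_simps)
    show "ip (S \<phi>) \<eta> = ip \<phi> (S \<eta>)"
      unfolding parseval[OF S \<eta>] parseval[OF \<phi> S] by (intro sum.cong refl) (simp add: Sc)
  next
    fix \<phi> assume \<phi>: "\<phi> \<in> X"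
    show "0 \<le> ip (S \<phi>) \<phi>"
      unfolding parseval[OF S \<phi>] by (intro sum_nonneg) (simp add: Sc r mult.assoc)
    show "S (S \<phi>) = step_op \<Omega> \<T> \<alpha> \<tau> \<phi>"
      by (rule eqI) (auto intro!: S step_op_in \<phi> simp: Sc step_op_coef[OF \<phi>] r(2) simp flip: mult.assoc)
  qed
  then show ?thesis by blast
qed

text \<open>Self-adjointness and
  \<open>S (S \<psi>) = step_op \<Omega> \<T> \<alpha> \<tau> \<psi>\<close> alone determine the
  squared norm as the inner product of \<open>\<psi>\<close> with
  \<open>step_op \<Omega> \<T> \<alpha> \<tau> \<psi>\<close>, so the result is the same for every
  root that may have been chosen.\<close>

lemma energy_norm_coef:
  assumes \<psi>: "\<psi> \<in> X"
  shows "energy_norm \<Omega> \<T> \<alpha> \<tau> \<psi> = L2_set (\<lambda>i. sqrt (1 + \<tau> powr \<alpha> * ev i) * ip \<psi> (e i)) {..<m}"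
proof -
  define S where "S = sqrt_on \<Omega> X (step_op \<Omega> \<T> \<alpha> \<tau>)"
  have "is_sqrt_on \<Omega> X (step_op \<Omega> \<T> \<alpha> \<tau>) S"
    unfolding S_def sqrt_on_def by (rule someI_ex[OF sqrt_exists])
  then have S: "S \<psi> \<in> X" "ip (S \<psi>) (S \<psi>) = ip \<psi> (S (S \<psi>))" "S (S \<psi>) = step_op \<Omega> \<T> \<alpha> \<tau> \<psi>"
    using \<psi> unfolding is_sqrt_on_def by blast+
  have "ip (S \<psi>) (S \<psi>) = (\<Sum>i<m. ip \<psi> (e i) * ip (step_op \<Omega> \<T> \<alpha> \<tau> \<psi>) (e i))"
    unfolding S(2,3) by (rule parseval[OF \<psi> step_op_in[OF \<psi>]])
  also have "\<dots> = (\<Sum>i<m. (sqrt (1 + \<tau> powr \<alpha> * ev i) * ip \<psi> (e i))\<^sup>2)"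
    by (intro sum.cong refl) (use ev_nonneg in \<open>simp add: step_op_coef[OF \<psi>] power_mult_distrib power2_eq_square mult_ac\<close>)
  finally show ?thesis by (simp add: energy_norm_def L2_norm_def L2_set_def S_def[symmetric])
qed

end

section \<open>The perturbed scheme\<close>

text \<open>Discrete variation of constants. As formal power series the scheme reads
  \<open>B * Y = g\<close>, and \<open>R\<close> inverts \<open>B\<close>. The factor
  \<open>1 + \<mu>\<close> in the source is the step operator applied to the difference between the
  computed and the exact value of a level.\<close>

lemma perturbed_scheme_solution:
  fixes x \<epsilon> :: "nat \<Rightarrow> real"
  assumes \<alpha>: "0 < \<alpha>" "\<alpha> < 1" and \<mu>: "0 \<le> \<mu>" and \<epsilon>0: "\<epsilon> 0 = 0"
    and eq: "\<And>n. n \<in> {1..N} \<Longrightarrow> (\<Sum>j=0..n. cq_weight \<alpha> j * (x (n - j) - x 0)) + \<mu> * x n = (1 + \<mu>) * \<epsilon> n"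
    and n: "n \<le> N"
  shows "x n = relax_factor \<alpha> \<mu> n * x 0 + (\<Sum>k\<le>n. (1 + \<mu>) * res_kernel \<alpha> \<mu> (n - k) * \<epsilon> k)"
proof -
  define B where "B = Abs_fps (cq_weight \<alpha>) + fps_const \<mu>"
  define R where "R = Abs_fps (res_kernel \<alpha> \<mu>)"
  define Y where "Y = Abs_fps (\<lambda>n. x n - x 0)"
  have "B * R = 1"
  proof (rule fps_ext)
    fix n
    have "fps_nth (B * R) n = (\<Sum>j\<le>n. cq_weight \<alpha> j * res_kernel \<alpha> \<mu> (n - j)) + \<mu> * res_kernel \<alpha> \<mu> n"
      by (simp add: B_def R_def distrib_right fps_mult_nth[of "Abs_fps (cq_weight \<alpha>)"] atLeast0AtMost)
    then show "fps_nth (B * R) n = fps_nth 1 n"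
      using res_kernel_convolution[OF \<alpha> \<mu>, of n] by simp
  qed
  then have Y: "Y = R * (B * Y)" by (metis mult.assoc mult.commute mult.left_neutral)
  \<comment> \<open>The scheme starts at level 1 and \<open>Y\<close> has no constant term, so the
    source \<open>- \<mu> * x 0\<close> is absent at index 0. This is why
    \<open>relax_factor\<close> sums over \<open>j < n\<close>.\<close>
  have g: "fps_nth (B * Y) k = (if k = 0 then 0 else (1 + \<mu>) * \<epsilon> k - \<mu> * x 0)" if "k \<le> N" for k
  proof -
    have "fps_nth (B * Y) k = (\<Sum>j=0..k. cq_weight \<alpha> j * (x (k - j) - x 0)) + \<mu> * (x k - x 0)"
      by (simp add: B_def Y_def distrib_right fps_mult_nth[of "Abs_fps (cq_weight \<alpha>)"])
    then show ?thesis using eq[of k] that by (cases "k = 0") (auto simp: algebra_simps)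
  qed
  have "x n - x 0 = fps_nth Y n" by (simp add: Y_def)
  also have "\<dots> = fps_nth ((B * Y) * R) n" using Y by (metis mult.commute)
  also have "\<dots> = (\<Sum>k\<le>n. fps_nth (B * Y) k * res_kernel \<alpha> \<mu> (n - k))"
    by (subst fps_mult_nth[of "B * Y" R]) (simp add: R_def atLeast0AtMost)
  also have "\<dots> = (\<Sum>k\<le>n. (1 + \<mu>) * res_kernel \<alpha> \<mu> (n - k) * \<epsilon> k - (if k = 0 then 0 else \<mu> * x 0 * res_kernel \<alpha> \<mu> (n - k)))"
    by (intro sum.cong refl) (use n g \<epsilon>0 in \<open>auto simp: algebra_simps\<close>)
  also have "\<dots> = (\<Sum>k\<le>n. (1 + \<mu>) * res_kernel \<alpha> \<mu> (n - k) * \<epsilon> k) - (\<Sum>k\<le>n. if k = 0 then 0 else \<mu> * x 0 * res_kernel \<alpha> \<mu> (n - k))"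
    by (rule sum_subtractf)
  also have "(\<Sum>k\<le>n. if k = 0 then 0 else \<mu> * x 0 * res_kernel \<alpha> \<mu> (n - k)) = (\<Sum>k=1..n. \<mu> * x 0 * res_kernel \<alpha> \<mu> (n - k))"
    by (rule sum.mono_neutral_cong_right) auto
  also have "\<dots> = (\<Sum>j<n. \<mu> * x 0 * res_kernel \<alpha> \<mu> j)"
    by (rule sum.reindex_bij_witness[of _ "\<lambda>j. n - j" "\<lambda>k. n - k"]) auto
  also have "\<dots> = x 0 - relax_factor \<alpha> \<mu> n * x 0"
    by (simp add: relax_factor_def sum_distrib_left algebra_simps)
  finally show ?thesis by simp
qed

text \<open>The second difference of the kernel extended by zero to negative indices. With this
  convention three convolution sums of different length combine into one.\<close>

definition kernel_diff2 :: "real \<Rightarrow> real \<Rightarrow> nat \<Rightarrow> real" where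
  "kernel_diff2 \<alpha> \<mu> j = (1 + \<mu>) * (res_kernel \<alpha> \<mu> j - (if 1 \<le> j then 2 * res_kernel \<alpha> \<mu> (j - 1) else 0)
     + (if 2 \<le> j then res_kernel \<alpha> \<mu> (j - 2) else 0))"

text \<open>From index 2 on this is \<open>res_kernel_diff2\<close>. At indices 0 and 1 the
  extension by zero leaves no cancellation, but values between 0 and 1 give the bounds 1 and 2,
  below 9 and 9/4.\<close>

lemma kernel_diff2_bound:
  assumes \<alpha>: "0 < \<alpha>" "\<alpha> < 1" and \<mu>: "0 \<le> \<mu>"
  shows "\<bar>kernel_diff2 \<alpha> \<mu> j\<bar> \<le> 9 / (real j + 1)\<^sup>2"
proof -
  have K: "0 \<le> (1 + \<mu>) * res_kernel \<alpha> \<mu> i" "(1 + \<mu>) * res_kernel \<alpha> \<mu> i \<le> 1" for i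
    using res_kernel_bound[OF \<alpha> \<mu>, of i] res_kernel_nonneg[OF \<alpha> \<mu>, of i] \<mu> by auto
  consider "j = 0" | "j = 1" | "2 \<le> j" by linarith
  then show ?thesis
  proof cases
    case 1
    then show ?thesis using K[of 0] by (simp add: kernel_diff2_def)
  next
    case 2
    have "kernel_diff2 \<alpha> \<mu> 1 = (1 + \<mu>) * res_kernel \<alpha> \<mu> 1 - 2 * ((1 + \<mu>) * res_kernel \<alpha> \<mu> 0)"
      by (simp add: kernel_diff2_def algebra_simps)
    then have "\<bar>kernel_diff2 \<alpha> \<mu> 1\<bar> \<le> 2" using K[of 0] K[of 1] by linarith
    then show ?thesis using 2 by (simp add: power2_eq_square)
  next
    case 3
    then show ?thesis using res_kernel_diff2[OF \<alpha> \<mu> 3] \<mu> by (simp add: kernel_diff2_def abs_mult)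
  qed
qed

lemma perturbed_scheme_diff2:
  fixes x \<epsilon> :: "nat \<Rightarrow> real"
  assumes \<alpha>: "0 < \<alpha>" "\<alpha> < 1" and \<mu>: "0 \<le> \<mu>" and \<epsilon>0: "\<epsilon> 0 = 0"
    and eq: "\<And>n. n \<in> {1..N} \<Longrightarrow> (\<Sum>j=0..n. cq_weight \<alpha> j * (x (n - j) - x 0)) + \<mu> * x n = (1 + \<mu>) * \<epsilon> n"
    and n: "2 \<le> n" "n \<le> N"
  shows "diff2 x n =
    diff2 (relax_factor \<alpha> \<mu>) n * x 0
    + (\<Sum>k\<le>n. kernel_diff2 \<alpha> \<mu> (n - k) * \<epsilon> k)"
proof -
  note s = perturbed_scheme_solution[OF \<alpha> \<mu>, of \<epsilon> N x, OF \<epsilon>0 eq]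
  have sh: "(\<Sum>k\<le>n - i. (1 + \<mu>) * res_kernel \<alpha> \<mu> (n - i - k) * \<epsilon> k)
      = (\<Sum>k\<le>n. if i \<le> n - k then (1 + \<mu>) * res_kernel \<alpha> \<mu> (n - k - i) * \<epsilon> k else 0)" if "i \<le> 2" for i
    by (rule sum.mono_neutral_cong_left) (use n that in \<open>auto simp: diff_right_commute diff_commute add.commute\<close>)
  have "diff2 x n =
    diff2 (relax_factor \<alpha> \<mu>) n * x 0
    + ((\<Sum>k\<le>n. (1 + \<mu>) * res_kernel \<alpha> \<mu> (n - k) * \<epsilon> k)
      - 2 * (\<Sum>k\<le>n - 1. (1 + \<mu>) * res_kernel \<alpha> \<mu> (n - 1 - k) * \<epsilon> k)
      + (\<Sum>k\<le>n - 2. (1 + \<mu>) * res_kernel \<alpha> \<mu> (n - 2 - k) * \<epsilon> k))"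
    using s[of n] s[of "n - 1"] s[of "n - 2"] n by (simp add: algebra_simps)
  also have "(\<Sum>k\<le>n. (1 + \<mu>) * res_kernel \<alpha> \<mu> (n - k) * \<epsilon> k)
      - 2 * (\<Sum>k\<le>n - 1. (1 + \<mu>) * res_kernel \<alpha> \<mu> (n - 1 - k) * \<epsilon> k)
      + (\<Sum>k\<le>n - 2. (1 + \<mu>) * res_kernel \<alpha> \<mu> (n - 2 - k) * \<epsilon> k) = (\<Sum>k\<le>n. kernel_diff2 \<alpha> \<mu> (n - k) * \<epsilon> k)"
    unfolding sh[of 1, OF one_le_numeral] sh[of 2, OF order_refl]
    unfolding sum_distrib_left sum_subtractf[symmetric] sum.distrib[symmetric]
    by (intro sum.cong refl) (auto simp: kernel_diff2_def algebra_simps)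
  finally show ?thesis .
qed

section \<open>Norm inequalities and sums over time levels\<close>

text \<open>The triangle inequality with multipliers. Bounds on the scalar kernels that hold for all
  modes at once pass to norms here without any dependence on the number of modes.\<close>

lemma L2_set_sum_le:
  assumes "\<And>k i. k \<in> A \<Longrightarrow> i \<in> I \<Longrightarrow> \<bar>d k i\<bar> \<le> M k" and "\<And>k. k \<in> A \<Longrightarrow> 0 \<le> M k"
  shows "L2_set (\<lambda>i. \<Sum>k\<in>A. d k i * c k i) I \<le> (\<Sum>k\<in>A. M k * L2_set (c k) I)"
  using assms
proof (induction A rule: infinite_finite_induct)
  case (insert k A)
  have "L2_set (\<lambda>i. \<Sum>k\<in>insert k A. d k i * c k i) I = L2_set (\<lambda>i. d k i * c k i + (\<Sum>k\<in>A. d k i * c k i)) I"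
    using insert.hyps by simp
  also have "\<dots> \<le> L2_set (\<lambda>i. d k i * c k i) I + L2_set (\<lambda>i. \<Sum>k\<in>A. d k i * c k i) I"
    by (rule L2_set_triangle_ineq)
  also have "\<dots> \<le> M k * L2_set (c k) I + (\<Sum>k\<in>A. M k * L2_set (c k) I)"
  proof (rule add_mono)
    have "L2_set (\<lambda>i. d k i * c k i) I = L2_set (\<lambda>i. \<bar>d k i * c k i\<bar>) I" by (simp add: L2_set_def)
    also have "\<dots> \<le> L2_set (\<lambda>i. M k * \<bar>c k i\<bar>) I"
      by (rule L2_set_mono) (use insert.prems in \<open>auto simp: abs_mult intro!: mult_right_mono\<close>)
    also have "\<dots> = M k * L2_set (\<lambda>i. \<bar>c k i\<bar>) I"
      using insert.prems by (intro L2_set_right_distrib[symmetric]) auto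
    also have "L2_set (\<lambda>i. \<bar>c k i\<bar>) I = L2_set (c k) I" by (simp add: L2_set_def)
    finally show "L2_set (\<lambda>i. d k i * c k i) I \<le> M k * L2_set (c k) I" .
    show "L2_set (\<lambda>i. \<Sum>k\<in>A. d k i * c k i) I \<le> (\<Sum>k\<in>A. M k * L2_set (c k) I)"
      using insert by auto
  qed
  also have "\<dots> = (\<Sum>k\<in>insert k A. M k * L2_set (c k) I)" using insert.hyps by simp
  finally show ?case .
qed (auto simp: L2_set_def)

lemma L2_set_mult_le:
  assumes "\<And>i. i \<in> I \<Longrightarrow> \<bar>d i\<bar> \<le> M" "0 \<le> M"
  shows "L2_set (\<lambda>i. d i * c i) I \<le> M * L2_set c I"
  using L2_set_sum_le[of "{()}" I "\<lambda>_. d" "\<lambda>_. M" "\<lambda>_. c"] assms by simp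

lemma sum_inverse_le_ln:
  assumes "1 \<le> n" shows "(\<Sum>j=2..n. 1 / real j) \<le> ln (real n)"
  using assms
proof (induction n rule: dec_induct)
  case (step n)
  have "ln (real n) - ln (real (Suc n)) \<le> (real n - real (Suc n)) / real (Suc n)"
    using step by (intro ln_diff_le) auto
  then have "1 / real (Suc n) \<le> ln (real (Suc n)) - ln (real n)" by simp
  then show ?case using step by simp
qed simp

lemma sum_inverse_le_one_plus_ln:
  assumes "1 \<le> n" shows "(\<Sum>j=1..n. 1 / real j) \<le> 1 + ln (real n)"
  using sum_inverse_le_ln[OF assms] sum.atLeast_Suc_atMost[OF assms, of "\<lambda>j. 1 / real j"]
  by (simp add: numeral_2_eq_2)

text \<open>With \<open>n = k + l\<close> and \<open>k \<ge> 1\<close> one has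
  \<open>n \<le> k (l + 1)\<close>. One factor \<open>1 / (l + 1)\<close> together with
  \<open>1 / k\<close> becomes \<open>1 / n\<close>; the other one sums to the logarithm.\<close>

lemma sum_kernel_inverse_le:
  assumes "1 \<le> n"
  shows "(\<Sum>k=1..<n. 1 / (real (n - k) + 1)\<^sup>2 * (1 / real k)) \<le> ln (real n) / real n"
proof -
  have "(\<Sum>k=1..<n. 1 / (real (n - k) + 1)\<^sup>2 * (1 / real k)) \<le> (\<Sum>k=1..<n. 1 / real n * (1 / (real (n - k) + 1)))"
  proof (rule sum_mono)
    fix k assume k: "k \<in> {1..<n}"
    then obtain l where l: "n = k + l" "1 \<le> k" "1 \<le> l" by (auto simp: less_iff_Suc_add)
    have "real n \<le> real k * (real l + 1)"
      using l mult_right_mono[of 1 "real k" "real l"] by (simp add: algebra_simps)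
    then have "1 / (real k * (real l + 1)) \<le> 1 / real n" using l by (intro divide_left_mono) auto
    then have "1 / (real k * (real l + 1)) * (1 / (real l + 1)) \<le> 1 / real n * (1 / (real l + 1))"
      by (intro mult_right_mono) auto
    then show "1 / (real (n - k) + 1)\<^sup>2 * (1 / real k) \<le> 1 / real n * (1 / (real (n - k) + 1))"
      using l(1) by (simp add: power2_eq_square mult_ac)
  qed
  also have "\<dots> = 1 / real n * (\<Sum>k=1..<n. 1 / (real (n - k) + 1))" by (rule sum_distrib_left[symmetric])
  also have "(\<Sum>k=1..<n. 1 / (real (n - k) + 1)) = (\<Sum>j=2..n. 1 / real j)"
    by (rule sum.reindex_bij_witness[of _ "\<lambda>j. n + 1 - j" "\<lambda>k. n + 1 - k"]) (auto simp: of_nat_diff)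
  also have "1 / real n * (\<Sum>j=2..n. 1 / real j) \<le> 1 / real n * ln (real n)"
    using sum_inverse_le_ln[OF assms] by (intro mult_left_mono) auto
  finally show ?thesis by simp
qed

definition diff2_const :: "real \<Rightarrow> real" where "diff2_const \<alpha> = 18 / (sin (pi * \<alpha>))\<^sup>2"

text \<open>Strong induction over the levels. The starting error at level \<open>n\<close> consists
  of the second difference of the unperturbed scheme, the earlier solver errors and the current one;
  the first two are of the claimed size after multiplication by the contraction factor, and the last
  is absorbed on the left.\<close>

lemma perturbation_estimate:
  fixes x \<epsilon> :: "nat \<Rightarrow> nat \<Rightarrow> real" and \<mu> :: "nat \<Rightarrow> real" and m :: nat
  defines "en c \<equiv> L2_set (\<lambda>i. sqrt (1 + \<mu> i) * c i) {..<m}"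
  assumes \<alpha>: "0 < \<alpha>" "\<alpha> < 1" and \<mu>: "\<And>i. i < m \<Longrightarrow> 0 \<le> \<mu> i" and \<tau>: "0 < \<tau>"
    and \<epsilon>0: "\<And>n i. n \<le> 2 \<Longrightarrow> i < m \<Longrightarrow> \<epsilon> n i = 0"
    and eq: "\<And>n i. i < m \<Longrightarrow> n \<in> {1..N} \<Longrightarrow>
      (\<Sum>j=0..n. cq_weight \<alpha> j * (x (n - j) i - x 0 i)) + \<mu> i * x n i = (1 + \<mu> i) * \<epsilon> n i"
    and \<delta>: "0 < \<delta>" "\<delta> * (4 * (10 + diff2_const \<alpha>)) \<le> 1"
    and ctr: "\<And>n. n \<in> {3..N} \<Longrightarrow> en (\<epsilon> n) \<le> \<delta> * min (real n * \<tau>) 1 * inverse (ln (1 + real n))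
        * en (\<lambda>i. 2 * x (n - 1) i - x (n - 2) i - (x n i - \<epsilon> n i))"
    and n: "n \<in> {1..N}"
  shows "en (\<epsilon> n) \<le> \<tau> / real n * L2_set (x 0) {..<m}"
  using n
proof (induction n rule: less_induct)
  case (less n)
  define I where "I = {..<m}"
  define X0 where "X0 = L2_set (x 0) I"
  define C where "C = diff2_const \<alpha>"
  have X0: "0 \<le> X0" by (simp add: X0_def L2_set_nonneg)
  have C: "0 \<le> C" by (simp add: C_def diff2_const_def)
  have en0: "0 \<le> en c" for c by (simp add: en_def L2_set_nonneg)
  \<comment> \<open>The second difference of the unperturbed scheme is bounded with the full weight
    \<open>1 + \<mu> i\<close>; the energy norm needs only its square root.\<close>
  have sq: "0 \<le> sqrt (1 + \<mu> i)" "sqrt (1 + \<mu> i) \<le> 1 + \<mu> i" if "i < m" for i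
    using \<mu>[OF that] by (auto intro!: real_le_lsqrt simp: power2_eq_square algebra_simps)
  show ?case
  proof (cases "n \<le> 2")
    case True
    have "en (\<epsilon> n) = L2_set (\<lambda>i. 0) {..<m}" unfolding en_def by (rule L2_set_cong) (use \<epsilon>0 True in auto)
    also have "\<dots> = 0" by (simp add: L2_set_def)
    finally have "en (\<epsilon> n) = 0" .
    then show ?thesis using \<tau> X0 by (simp add: X0_def I_def)
  next
    case False
    hence n3: "3 \<le> n" "n \<le> N" using less.prems by auto
    define l where "l = ln (1 + real n)"
    have l1: "1 \<le> l"
    proof -
      have "exp 1 \<le> (1 + real n)" using exp_le n3 by linarith
      then show ?thesis unfolding l_def using n3 by (subst ln_ge_iff) auto
    qed
    define \<theta> where "\<theta> = \<delta> * min (real n * \<tau>) 1 * inverse l"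
    \<comment> \<open>Three bounds for three terms: \<open>\<delta>\<close> for the current error,
      \<open>\<delta> * (real n * \<tau>)\<close> for the term with \<open>n^-2\<close>, and
      \<open>\<theta> * l \<le> \<delta>\<close> for the sum over earlier errors.\<close>
    have \<theta>: "0 \<le> \<theta>" "\<theta> \<le> \<delta>" "\<theta> \<le> \<delta> * (real n * \<tau>)" "\<theta> * l \<le> \<delta>"
    proof -
      have m: "0 \<le> min (real n * \<tau>) 1" using \<tau> by simp
      show "0 \<le> \<theta>" using \<delta> m l1 by (simp add: \<theta>_def)
      have il: "inverse l \<le> 1" "0 \<le> inverse l" using l1 by (auto simp: inverse_le_1_iff)
      have t: "\<theta> \<le> \<delta> * min (real n * \<tau>) 1"
        unfolding \<theta>_def using \<delta> m il by (intro mult_left_le) auto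
      have "\<delta> * min (real n * \<tau>) 1 \<le> \<delta> * 1" "\<delta> * min (real n * \<tau>) 1 \<le> \<delta> * (real n * \<tau>)"
        using \<delta> by (intro mult_left_mono; simp)+
      then show "\<theta> \<le> \<delta>" "\<theta> \<le> \<delta> * (real n * \<tau>)" using t by auto
      have "\<theta> * l = \<delta> * min (real n * \<tau>) 1" using l1 by (simp add: \<theta>_def)
      then show "\<theta> * l \<le> \<delta>" using \<open>\<delta> * min (real n * \<tau>) 1 \<le> \<delta> * 1\<close> by simp
    qed
    define D where "D = (\<lambda>i. x n i - 2 * x (n - 1) i + x (n - 2) i)"
    have D: "D i = diff2 (relax_factor \<alpha> (\<mu> i)) n * x 0 i
       + (\<Sum>k\<le>n. kernel_diff2 \<alpha> (\<mu> i) (n - k) * \<epsilon> k i)" if "i < m" for i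
      unfolding D_def
      by (rule perturbed_scheme_diff2[OF \<alpha> \<mu>[OF that], of "\<lambda>n. \<epsilon> n i" N "\<lambda>n. x n i"]) (use \<epsilon>0 eq that n3 in auto)
    have enD: "en D \<le> C / (real n)\<^sup>2 * X0 + (\<Sum>k\<le>n. 9 / (real (n - k) + 1)\<^sup>2 * en (\<epsilon> k))"
    proof -
      define d where "d = (\<lambda>i. sqrt (1 + \<mu> i) * diff2 (relax_factor \<alpha> (\<mu> i)) n)"
      have "en D = L2_set (\<lambda>i. d i * x 0 i + (\<Sum>k\<le>n. kernel_diff2 \<alpha> (\<mu> i) (n - k) * (sqrt (1 + \<mu> i) * \<epsilon> k i))) I"
        unfolding en_def I_def
        by (rule L2_set_cong[OF refl]) (simp add: D d_def distrib_left sum_distrib_left mult_ac)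
      also have "\<dots> \<le> L2_set (\<lambda>i. d i * x 0 i) I + L2_set (\<lambda>i. \<Sum>k\<le>n. kernel_diff2 \<alpha> (\<mu> i) (n - k) * (sqrt (1 + \<mu> i) * \<epsilon> k i)) I"
        by (rule L2_set_triangle_ineq)
      also have "\<dots> \<le> C / (real n)\<^sup>2 * X0 + (\<Sum>k\<le>n. 9 / (real (n - k) + 1)\<^sup>2 * en (\<epsilon> k))"
      proof (rule add_mono)
        show "L2_set (\<lambda>i. d i * x 0 i) I \<le> C / (real n)\<^sup>2 * X0"
          unfolding X0_def
        proof (rule L2_set_mult_le)
          fix i assume "i \<in> I"
          then have i: "i < m" by (simp add: I_def)
          have "\<bar>d i\<bar> \<le> (1 + \<mu> i) * \<bar>diff2 (relax_factor \<alpha> (\<mu> i)) n\<bar>"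
            unfolding d_def abs_mult using sq[OF i] by (intro mult_right_mono) auto
          also have "\<dots> \<le> C / (real n)\<^sup>2"
            using relax_factor_diff2[OF \<alpha> \<mu>[OF i] n3(1)] by (simp add: C_def diff2_const_def)
          finally show "\<bar>d i\<bar> \<le> C / (real n)\<^sup>2" .
        qed (use C in simp)
        show "L2_set (\<lambda>i. \<Sum>k\<le>n. kernel_diff2 \<alpha> (\<mu> i) (n - k) * (sqrt (1 + \<mu> i) * \<epsilon> k i)) I \<le> (\<Sum>k\<le>n. 9 / (real (n - k) + 1)\<^sup>2 * en (\<epsilon> k))"
          unfolding en_def I_def[symmetric]
        proof (rule L2_set_sum_le)
          show "\<bar>kernel_diff2 \<alpha> (\<mu> i) (n - k)\<bar> \<le> 9 / (real (n - k) + 1)\<^sup>2" if "i \<in> I" for k i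
            using that by (intro kernel_diff2_bound[OF \<alpha> \<mu>]) (simp add: I_def)
        qed simp
      qed
      finally show ?thesis .
    qed
    \<comment> \<open>The current error is part of the computed value at level \<open>n\<close> and
      enters the second difference with weight 9.\<close>
    have split: "(\<Sum>k\<le>n. 9 / (real (n - k) + 1)\<^sup>2 * en (\<epsilon> k)) = (\<Sum>k=1..<n. 9 / (real (n - k) + 1)\<^sup>2 * en (\<epsilon> k)) + 9 * en (\<epsilon> n)"
    proof -
      have "{..n} = insert 0 (insert n {1..<n})" using n3 by auto
      moreover have "en (\<epsilon> 0) = 0"
      proof -
        have "en (\<epsilon> 0) = L2_set (\<lambda>i. 0) {..<m}" unfolding en_def by (rule L2_set_cong) (use \<epsilon>0 in auto)
        then show ?thesis by (simp add: L2_set_def)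
      qed
      ultimately show ?thesis using n3 by simp
    qed
    have "(\<Sum>k=1..<n. 9 / (real (n - k) + 1)\<^sup>2 * en (\<epsilon> k)) \<le> (\<Sum>k=1..<n. 9 * \<tau> * X0 * (1 / (real (n - k) + 1)\<^sup>2 * (1 / real k)))"
    proof (rule sum_mono)
      fix k assume k: "k \<in> {1..<n}"
      then have "en (\<epsilon> k) \<le> \<tau> / real k * X0" using less.IH[of k] n3 by (simp add: X0_def I_def)
      then have "9 / (real (n - k) + 1)\<^sup>2 * en (\<epsilon> k) \<le> 9 / (real (n - k) + 1)\<^sup>2 * (\<tau> / real k * X0)"
        by (intro mult_left_mono) auto
      then show "9 / (real (n - k) + 1)\<^sup>2 * en (\<epsilon> k) \<le> 9 * \<tau> * X0 * (1 / (real (n - k) + 1)\<^sup>2 * (1 / real k))"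
        by (simp add: mult_ac)
    qed
    also have "\<dots> = 9 * \<tau> * X0 * (\<Sum>k=1..<n. 1 / (real (n - k) + 1)\<^sup>2 * (1 / real k))"
      by (rule sum_distrib_left[symmetric])
    also have "\<dots> \<le> 9 * \<tau> * X0 * (l / real n)"
    proof (rule mult_left_mono)
      have "(\<Sum>k=1..<n. 1 / (real (n - k) + 1)\<^sup>2 * (1 / real k)) \<le> ln (real n) / real n"
        using n3 by (intro sum_kernel_inverse_le) auto
      also have "\<dots> \<le> l / real n" unfolding l_def using n3 by (intro divide_right_mono) auto
      finally show "(\<Sum>k=1..<n. 1 / (real (n - k) + 1)\<^sup>2 * (1 / real k)) \<le> l / real n" .
    qed (use \<tau> X0 in auto)
    finally have mid: "(\<Sum>k=1..<n. 9 / (real (n - k) + 1)\<^sup>2 * en (\<epsilon> k)) \<le> 9 * \<tau> * X0 * (l / real n)" .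
    \<comment> \<open>The starting guess is compared with the exact value
      \<open>x n i - \<epsilon> n i\<close> rather than with \<open>x n i\<close>, which adds one
      more copy of the current error: 9 + 1 = 10.\<close>
    have "en (\<lambda>i. 2 * x (n - 1) i - x (n - 2) i - (x n i - \<epsilon> n i)) = L2_set (\<lambda>i. - (sqrt (1 + \<mu> i) * D i) + sqrt (1 + \<mu> i) * \<epsilon> n i) {..<m}"
      unfolding en_def by (rule L2_set_cong[OF refl]) (simp add: D_def algebra_simps)
    also have "\<dots> \<le> L2_set (\<lambda>i. - (sqrt (1 + \<mu> i) * D i)) {..<m} + en (\<epsilon> n)"
      unfolding en_def by (rule L2_set_triangle_ineq)
    also have "L2_set (\<lambda>i. - (sqrt (1 + \<mu> i) * D i)) {..<m} = en D" by (simp add: en_def L2_set_def)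
    finally have g: "en (\<lambda>i. 2 * x (n - 1) i - x (n - 2) i - (x n i - \<epsilon> n i)) \<le> C / (real n)\<^sup>2 * X0 + 9 * \<tau> * X0 * (l / real n) + 10 * en (\<epsilon> n)"
      using enD split mid by simp
    define z where "z = \<tau> / real n * X0"
    have z: "0 \<le> z" using \<tau> X0 by (simp add: z_def)
    have "en (\<epsilon> n) \<le> \<theta> * en (\<lambda>i. 2 * x (n - 1) i - x (n - 2) i - (x n i - \<epsilon> n i))"
      unfolding \<theta>_def l_def by (rule ctr) (use n3 in auto)
    also have "\<dots> \<le> \<theta> * (C / (real n)\<^sup>2 * X0 + 9 * \<tau> * X0 * (l / real n) + 10 * en (\<epsilon> n))"
      using \<theta>(1) g by (rule mult_left_mono[rotated])
    also have "\<dots> = \<theta> * (C / (real n)\<^sup>2 * X0) + (\<theta> * l) * (9 * z) + \<theta> * (10 * en (\<epsilon> n))"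
      by (simp add: z_def algebra_simps)
    also have "\<dots> \<le> \<delta> * (C * z) + \<delta> * (9 * z) + \<delta> * (10 * en (\<epsilon> n))"
    proof (intro add_mono)
      have "\<theta> * (C / (real n)\<^sup>2 * X0) \<le> \<delta> * (real n * \<tau>) * (C / (real n)\<^sup>2 * X0)"
        using \<theta>(3) C X0 by (intro mult_right_mono) auto
      also have "\<dots> = \<delta> * (C * z)" using n3 by (simp add: z_def power2_eq_square)
      finally show "\<theta> * (C / (real n)\<^sup>2 * X0) \<le> \<delta> * (C * z)" .
      show "\<theta> * l * (9 * z) \<le> \<delta> * (9 * z)" using \<theta>(4) z by (intro mult_right_mono) auto
      show "\<theta> * (10 * en (\<epsilon> n)) \<le> \<delta> * (10 * en (\<epsilon> n))" using \<theta>(2) en0 by (intro mult_right_mono) auto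
    qed
    also have "\<dots> = \<delta> * (9 + C) * z + 10 * \<delta> * en (\<epsilon> n)" by (simp add: algebra_simps)
    \<comment> \<open>The factor 4 in the condition on \<delta> serves here: a quarter of the
      current error moves to the left, and at most a third of \<open>z\<close> remains.\<close>
    also have "\<dots> \<le> 1 / 4 * z + 1 / 4 * en (\<epsilon> n)"
    proof (intro add_mono mult_right_mono z en0)
      have "0 \<le> \<delta> * C" using \<delta> C by simp
      then show "\<delta> * (9 + C) \<le> 1 / 4" "10 * \<delta> \<le> 1 / 4"
        using \<delta> by (auto simp: C_def[symmetric] algebra_simps)
    qed
    finally have "en (\<epsilon> n) \<le> z" using z by linarith
    then show ?thesis by (simp add: z_def X0_def I_def)
  qed
qed

text \<open>The exact scheme contributes \<open>2 / n\<close>. Each solver error passes through a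
  kernel bounded by 1, so their sizes \<open>\<tau> / k\<close> simply add up to a harmonic
  sum.\<close>

lemma perturbed_scheme_error:
  fixes x \<epsilon> :: "nat \<Rightarrow> nat \<Rightarrow> real" and \<mu> :: "nat \<Rightarrow> real" and m :: nat
  defines "en c \<equiv> L2_set (\<lambda>i. sqrt (1 + \<mu> i) * c i) {..<m}"
  assumes \<alpha>: "0 < \<alpha>" "\<alpha> < 1" and \<mu>: "\<And>i. i < m \<Longrightarrow> 0 \<le> \<mu> i" and T: "0 < T" and \<tau>: "\<tau> = T / real N"
    and \<epsilon>0: "\<And>n i. n \<le> 2 \<Longrightarrow> i < m \<Longrightarrow> \<epsilon> n i = 0"
    and eq: "\<And>n i. i < m \<Longrightarrow> n \<in> {1..N} \<Longrightarrow>
      (\<Sum>j=0..n. cq_weight \<alpha> j * (x (n - j) i - x 0 i)) + \<mu> i * x n i = (1 + \<mu> i) * \<epsilon> n i"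
    and \<delta>: "0 < \<delta>" "\<delta> * (4 * (10 + diff2_const \<alpha>)) \<le> 1"
    and ctr: "\<And>n. n \<in> {3..N} \<Longrightarrow> en (\<epsilon> n) \<le> \<delta> * min (real n * \<tau>) 1 * inverse (ln (1 + real n))
        * en (\<lambda>i. 2 * x (n - 1) i - x (n - 2) i - (x n i - \<epsilon> n i))"
    and n: "n \<in> {1..N}"
  shows "L2_set (\<lambda>i. x n i - x 0 i * mittag_leffler_relax \<alpha> (\<mu> i) (real n)) {..<m}
     \<le> (4 + 3 * T) / real n * ln (1 + real n) * L2_set (x 0) {..<m}"
proof -
  define X0 where "X0 = L2_set (x 0) {..<m}"
  have X0: "0 \<le> X0" by (simp add: X0_def L2_set_nonneg)
  have n1: "1 \<le> n" "n \<le> N" using n by auto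
  have \<tau>0: "0 < \<tau>" using T n1 by (simp add: \<tau>)
  have pert: "en (\<epsilon> k) \<le> \<tau> / real k * X0" if "k \<in> {1..N}" for k
    unfolding en_def X0_def
    by (rule perturbation_estimate[OF \<alpha> \<mu> \<tau>0 \<epsilon>0 eq \<delta> ctr[unfolded en_def] that])
  have K: "\<bar>(1 + \<mu> i) * res_kernel \<alpha> (\<mu> i) j\<bar> \<le> 1" if "i < m" for i j
    using res_kernel_bound[OF \<alpha> \<mu>[OF that], of j] \<mu>[OF that] by (simp add: abs_mult)
  have "L2_set (\<lambda>i. x n i - x 0 i * mittag_leffler_relax \<alpha> (\<mu> i) (real n)) {..<m}
     = L2_set (\<lambda>i. (relax_factor \<alpha> (\<mu> i) n - mittag_leffler_relax \<alpha> (\<mu> i) (real n)) * x 0 i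
         + (\<Sum>k\<le>n. ((1 + \<mu> i) * res_kernel \<alpha> (\<mu> i) (n - k)) * \<epsilon> k i)) {..<m}"
  proof (rule L2_set_cong[OF refl])
    fix i assume "i \<in> {..<m}"
    then have i: "i < m" by simp
    have "x n i = relax_factor \<alpha> (\<mu> i) n * x 0 i + (\<Sum>k\<le>n. (1 + \<mu> i) * res_kernel \<alpha> (\<mu> i) (n - k) * \<epsilon> k i)"
      by (rule perturbed_scheme_solution[OF \<alpha> \<mu>[OF i], of "\<lambda>n. \<epsilon> n i" N "\<lambda>n. x n i"]) (use \<epsilon>0 eq i n1 in auto)
    then show "x n i - x 0 i * mittag_leffler_relax \<alpha> (\<mu> i) (real n) = (relax_factor \<alpha> (\<mu> i) n - mittag_leffler_relax \<alpha> (\<mu> i) (real n)) * x 0 i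
         + (\<Sum>k\<le>n. ((1 + \<mu> i) * res_kernel \<alpha> (\<mu> i) (n - k)) * \<epsilon> k i)"
      by (simp add: algebra_simps)
  qed
  also have "\<dots> \<le> L2_set (\<lambda>i. (relax_factor \<alpha> (\<mu> i) n - mittag_leffler_relax \<alpha> (\<mu> i) (real n)) * x 0 i) {..<m}
      + L2_set (\<lambda>i. \<Sum>k\<le>n. ((1 + \<mu> i) * res_kernel \<alpha> (\<mu> i) (n - k)) * \<epsilon> k i) {..<m}"
    by (rule L2_set_triangle_ineq)
  also have "\<dots> \<le> 2 / real n * X0 + (\<Sum>k\<le>n. 1 * L2_set (\<epsilon> k) {..<m})"
    unfolding X0_def
    by (intro add_mono L2_set_mult_le L2_set_sum_le) (use relax_factor_error[OF \<alpha> \<mu> n1(1)] K in auto)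
  also have "(\<Sum>k\<le>n. 1 * L2_set (\<epsilon> k) {..<m}) \<le> (\<Sum>k=1..n. \<tau> * X0 * (1 / real k))"
  proof -
    have z: "L2_set (\<epsilon> 0) {..<m} = 0"
    proof -
      have "L2_set (\<epsilon> 0) {..<m} = L2_set (\<lambda>i. 0) {..<m}" by (rule L2_set_cong) (use \<epsilon>0 in auto)
      then show ?thesis by (simp add: L2_set_def)
    qed
    have "{..n} = insert 0 {1..n}" by auto
    then have "(\<Sum>k\<le>n. 1 * L2_set (\<epsilon> k) {..<m}) = (\<Sum>k=1..n. L2_set (\<epsilon> k) {..<m})" using z by simp
    also have "\<dots> \<le> (\<Sum>k=1..n. \<tau> * X0 * (1 / real k))"
    proof (rule sum_mono)
      fix k assume k: "k \<in> {1..n}"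
      have "L2_set (\<epsilon> k) {..<m} = L2_set (\<lambda>i. \<bar>\<epsilon> k i\<bar>) {..<m}" by (simp add: L2_set_def)
      also have "\<dots> \<le> L2_set (\<lambda>i. \<bar>sqrt (1 + \<mu> i) * \<epsilon> k i\<bar>) {..<m}"
      proof (rule L2_set_mono)
        fix i assume "i \<in> {..<m}"
        then have "1 \<le> sqrt (1 + \<mu> i)" using \<mu>[of i] by simp
        then have "1 * \<bar>\<epsilon> k i\<bar> \<le> sqrt (1 + \<mu> i) * \<bar>\<epsilon> k i\<bar>" by (intro mult_right_mono) auto
        then show "\<bar>\<epsilon> k i\<bar> \<le> \<bar>sqrt (1 + \<mu> i) * \<epsilon> k i\<bar>" using \<open>1 \<le> sqrt (1 + \<mu> i)\<close> by (simp add: abs_mult)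
      qed auto
      also have "\<dots> = en (\<epsilon> k)" by (simp add: en_def L2_set_def)
      also have "\<dots> \<le> \<tau> / real k * X0" using k n1 by (intro pert) auto
      finally show "L2_set (\<epsilon> k) {..<m} \<le> \<tau> * X0 * (1 / real k)" by (simp add: mult_ac)
    qed
    finally show ?thesis .
  qed
  also have "(\<Sum>k=1..n. \<tau> * X0 * (1 / real k)) = \<tau> * X0 * (\<Sum>k=1..n. 1 / real k)" by (rule sum_distrib_left[symmetric])
  also have "\<dots> \<le> T / real n * X0 * (3 * ln (1 + real n))"
  proof (intro mult_mono)
    \<comment> \<open>From \<open>n \<le> N\<close>: the final time converts the step size into the
      required rate \<open>1 / n\<close>.\<close>
    show "\<tau> \<le> T / real n" unfolding \<tau> using T n1 by (intro divide_left_mono) auto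
    have l2: "1 / 2 \<le> ln (1 + real n)"
    proof -
      have "1 / 2 \<le> ln (2 :: real)" using ln2_ge_two_thirds by simp
      also have "\<dots> \<le> ln (1 + real n)" using n1 by simp
      finally show ?thesis .
    qed
    have "(\<Sum>k=1..n. 1 / real k) \<le> 1 + ln (real n)" using n1 by (intro sum_inverse_le_one_plus_ln) auto
    \<comment> \<open>The constant 3 comes from \<open>1 \<le> 2 * ln (1 + real n)\<close>, which
      needs only \<open>n \<ge> 1\<close>; the same estimate below turns 2 into 4.\<close>
    also have "\<dots> \<le> 2 * ln (1 + real n) + ln (1 + real n)"
      using l2 n1 by (intro add_mono) auto
    finally show "(\<Sum>k=1..n. 1 / real k) \<le> 3 * ln (1 + real n)" by simp
  qed (use T X0 in \<open>auto intro!: sum_nonneg\<close>)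
  also have "2 / real n * X0 + T / real n * X0 * (3 * ln (1 + real n)) \<le> (4 + 3 * T) / real n * ln (1 + real n) * X0"
  proof -
    have "1 / 2 \<le> ln (2 :: real)" using ln2_ge_two_thirds by simp
    also have "\<dots> \<le> ln (1 + real n)" using n1 by simp
    finally have "2 \<le> 4 * ln (1 + real n)" by simp
    then have "2 * (X0 / real n) \<le> 4 * ln (1 + real n) * (X0 / real n)"
      using X0 by (intro mult_right_mono) auto
    moreover have "2 / real n * X0 + T / real n * X0 * (3 * ln (1 + real n)) = 2 * (X0 / real n) + 3 * T * ln (1 + real n) * (X0 / real n)"
      by simp
    moreover have "(4 + 3 * T) / real n * ln (1 + real n) * X0 = 4 * ln (1 + real n) * (X0 / real n) + 3 * T * ln (1 + real n) * (X0 / real n)"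
      unfolding add_divide_distrib distrib_right by simp
    ultimately show ?thesis by (simp only: add_le_cancel_right)
  qed
  finally show ?thesis by (simp add: X0_def)
qed

section \<open>The incomplete iterative scheme\<close>

context fe_eigenbasis
begin

text \<open>The semidiscrete problem is stated pointwise in space. Writing modal coefficients as
  fixed finite combinations of point values transfers continuity, differentiability and the Caputo
  equation to them by linearity.\<close>

lemma point_evaluation:
  obtains Z :: "'a set" and g :: "nat \<Rightarrow> 'a \<Rightarrow> real"
  where "finite Z" "\<And>\<phi> i. \<phi> \<in> X \<Longrightarrow> i < m \<Longrightarrow> ip \<phi> (e i) = (\<Sum>z\<in>Z. g i z * \<phi> z)"
proof -
  obtain Z0 where Z0: "determining Z0 X" using fe_space_determining[OF dom mesh] by blast
  obtain Z b where Z: "Z \<subseteq> Z0" and b: "\<forall>z\<in>Z. b z \<in> X"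
    and "\<forall>z\<in>Z. \<forall>y\<in>Z. b z y = (if z = y then 1 else 0)"
    and exp: "\<forall>\<phi>\<in>X. \<phi> = (\<lambda>x. \<Sum>z\<in>Z. \<phi> z * b z x)"
    by (rule nodal_basis[OF X_sub Z0])
  have fin: "finite Z" using Z Z0 finite_subset by (auto simp: determining_def)
  have "ip \<phi> (e i) = (\<Sum>z\<in>Z. ip (b z) (e i) * \<phi> z)" if \<phi>: "\<phi> \<in> X" and i: "i < m" for \<phi> i
  proof -
    have "ip \<phi> (e i) = ip (\<lambda>x. \<Sum>z\<in>Z. \<phi> z * b z x) (e i)" by (subst (1) bspec[OF exp \<phi>]) (rule refl)
    also have "\<dots> = (\<Sum>z\<in>Z. \<phi> z * ip (b z) (e i))"
      by (rule sym_form_sum[OF X_sub ip_form _ e_in[OF i]]) (use b in auto)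
    finally show ?thesis by (simp add: mult.commute)
  qed
  with fin show ?thesis by (rule that)
qed

lemma semidiscrete_coef:
  assumes \<alpha>: "0 < \<alpha>" "\<alpha> < 1" and u: "semidiscrete_solution \<Omega> \<T> \<alpha> v\<^sub>h u" and \<tau>: "0 < \<tau>" and t: "0 < t" and i: "i < m"
  shows "ip (u (t * \<tau>)) (e i) = ip v\<^sub>h (e i) * mittag_leffler_relax \<alpha> (ev i * \<tau> powr \<alpha>) t"
proof -
  obtain Z :: "'a set" and g where Z: "finite Z" and g: "\<And>\<phi> i. \<phi> \<in> X \<Longrightarrow> i < m \<Longrightarrow> ip \<phi> (e i) = (\<Sum>z\<in>Z. g i z * \<phi> z)"
    using point_evaluation by blast
  have uX: "u t \<in> X" if "0 \<le> t" for t using u that by (simp add: semidiscrete_solution_def)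
  have u0: "u 0 = v\<^sub>h" using u by (simp add: semidiscrete_solution_def)
  have uc: "continuous_on {0..} (\<lambda>t. u t x)" for x using u by (simp add: semidiscrete_solution_def)
  have ud: "(\<lambda>s. u s x) differentiable (at t)" if "0 < t" for t x using u that by (simp add: semidiscrete_solution_def)
  have ui: "set_integrable lborel {0<..<t} (\<lambda>s. (t - s) powr (- \<alpha>) * deriv (\<lambda>r. u r x) s)" if "0 < t" for t x
    using u that by (simp add: semidiscrete_solution_def)
  have ue: "caputo \<alpha> (\<lambda>s. u s x) t = - A_h \<Omega> \<T> (u t) x" if "0 < t" for t x
    using u that unfolding semidiscrete_solution_def by (simp add: add_eq_0_iff2)
  \<comment> \<open>Defined through point values because nothing places \<open>u t\<close> in the
    space for negative times; the two descriptions agree for \<open>t \<ge> 0\<close>.\<close>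
  define w where "w = (\<lambda>t. \<Sum>z\<in>Z. g i z * u t z)"
  have w: "w t = ip (u t) (e i)" if "0 \<le> t" for t unfolding w_def using g[OF uX[OF that] i] by simp
  have dw: "deriv w s = (\<Sum>z\<in>Z. g i z * deriv (\<lambda>r. u r z) s)" if "0 < s" for s
  proof (rule DERIV_imp_deriv)
    have "((\<lambda>r. u r z) has_real_derivative deriv (\<lambda>r. u r z) s) (at s)" for z
      using ud[OF that, of z] by (simp add: DERIV_deriv_iff_real_differentiable)
    then show "(w has_real_derivative (\<Sum>z\<in>Z. g i z * deriv (\<lambda>r. u r z) s)) (at s)"
      unfolding w_def by (intro DERIV_sum DERIV_cmult)
  qed
  have ind: "indicator {0<..<t} s * ((t - s) powr (- \<alpha>) * deriv w s)
      = (\<Sum>z\<in>Z. g i z * (indicator {0<..<t} s * ((t - s) powr (- \<alpha>) * deriv (\<lambda>r. u r z) s)))" for s t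
    by (cases "s \<in> {0<..<t}") (simp_all add: dw sum_distrib_left mult_ac)
  have int: "integrable lborel (\<lambda>s. indicator {0<..<t} s * ((t - s) powr (- \<alpha>) * deriv (\<lambda>r. u r x) s))" if "0 < t" for t x
    using ui[OF that, of x] by (simp add: set_integrable_def)
  have "w (t * \<tau>) = w 0 * mittag_leffler_relax \<alpha> (ev i * \<tau> powr \<alpha>) t"
  proof (rule Caputo_relaxation[OF \<alpha> ev_nonneg[OF i] \<tau>])
    show "continuous_on {0..} w" unfolding w_def by (intro continuous_intros uc)
    show "w differentiable (at t)" if "0 < t" for t
      unfolding w_def using ud[OF that] by (intro differentiable_sum differentiable_mult Z) auto
    show "set_integrable lborel {0<..<t} (\<lambda>s. (t - s) powr (- \<alpha>) * deriv w s)" if "0 < t" for t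
      unfolding set_integrable_def real_scaleR_def ind
      by (intro Bochner_Integration.integrable_sum integrable_mult_right int[OF that])
    show "caputo \<alpha> w t = - ev i * w t" if t: "0 < t" for t
    proof -
      have "(LBINT s:{0<..<t}. (t - s) powr (- \<alpha>) * deriv w s)
        = (\<Sum>z\<in>Z. g i z * (LBINT s:{0<..<t}. (t - s) powr (- \<alpha>) * deriv (\<lambda>r. u r z) s))"
        unfolding set_lebesgue_integral_def real_scaleR_def ind
        by (subst Bochner_Integration.integral_sum) (auto intro!: integrable_mult_right int[OF t])
      then have "caputo \<alpha> w t = (\<Sum>z\<in>Z. g i z * caputo \<alpha> (\<lambda>s. u s z) t)"
        by (simp add: caputo_def sum_distrib_left mult_ac)
      also have "\<dots> = - (\<Sum>z\<in>Z. g i z * A_h \<Omega> \<T> (u t) z)"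
        by (simp add: ue[OF t] sum_negf)
      also have "(\<Sum>z\<in>Z. g i z * A_h \<Omega> \<T> (u t) z) = ip (A_h \<Omega> \<T> (u t)) (e i)"
        using g[OF A_h_in[OF uX] i] t by simp
      also have "\<dots> = ev i * w t"
        using A_h_coef[OF uX i] w[of t] t by simp
      finally show ?thesis by simp
    qed
  qed (rule t)
  then show ?thesis using w[of "t * \<tau>"] w[of 0] t \<tau> u0 by simp
qed

lemma exact_step_coef:
  assumes st: "exact_step \<Omega> \<T> \<alpha> \<tau> (\<lambda>t x. 0) U n w" and U: "\<And>k. k < n \<Longrightarrow> U k \<in> X" and n: "1 \<le> n" and i: "i < m"
  shows "(1 + \<tau> powr \<alpha> * ev i) * ip w (e i) = (\<Sum>j=0..n. cq_weight \<alpha> j * ip (U 0) (e i)) - (\<Sum>j=1..n. cq_weight \<alpha> j * ip (U (n - j)) (e i))"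
proof -
  have wX: "w \<in> X" using st by (simp add: exact_step_def)
  define S1 where "S1 = (\<lambda>x. \<Sum>j=1..n. cq_weight \<alpha> j * U (n - j) x)"
  define S2 where "S2 = (\<lambda>x. \<Sum>j=0..n. cq_weight \<alpha> j * U 0 x)"
  have S: "S1 \<in> X" "S2 \<in> X"
    unfolding S1_def S2_def by (intro fun_subspace_sum[OF X_sub] U; use n in auto)+
  have "step_op \<Omega> \<T> \<alpha> \<tau> w = (\<lambda>x. 1 * S2 x + (- 1) * S1 x)"
    using st by (auto simp: exact_step_def projection_zero S1_def S2_def fun_eq_iff)
  then have "ip (step_op \<Omega> \<T> \<alpha> \<tau> w) (e i) = ip S2 (e i) - ip S1 (e i)"
    using coef_lincomb[OF S(2,1) i, of 1 "- 1"] by simp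
  moreover have "ip S1 (e i) = (\<Sum>j=1..n. cq_weight \<alpha> j * ip (U (n - j)) (e i))"
    unfolding S1_def by (rule sym_form_sum[OF X_sub ip_form _ e_in[OF i]]) (use U n in auto)
  moreover have "ip S2 (e i) = (\<Sum>j=0..n. cq_weight \<alpha> j * ip (U 0) (e i))"
    unfolding S2_def by (rule sym_form_sum[OF X_sub ip_form _ e_in[OF i]]) (use U n in auto)
  ultimately show ?thesis using step_op_coef[OF wX i, of \<alpha> \<tau>] by simp
qed

text \<open>In modal coordinates the contraction property becomes the hypothesis on the energy norms
  of the perturbations, so the scalar theory applies to all modes together.\<close>

lemma incomplete_scheme_error:
  assumes \<alpha>: "0 < \<alpha>" "\<alpha> < 1" and T: "0 < T" and N: "1 \<le> N" and \<tau>: "\<tau> = T / real N"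
    and v: "v \<in> L2 \<Omega>" and v\<^sub>h: "v\<^sub>h = L2_projection \<Omega> \<T> v"
    and u: "semidiscrete_solution \<Omega> \<T> \<alpha> v\<^sub>h u"
    and sch: "incomplete_scheme \<Omega> \<T> \<alpha> \<tau> N (\<lambda>t x. 0) v\<^sub>h {1, 2} U Ubar W M"
    and con: "contraction_property \<Omega> \<T> \<alpha> \<tau> N {1, 2} c\<^sub>0 \<kappa> Ubar W"
    and \<delta>: "0 < \<delta>" "\<delta> * (4 * (10 + diff2_const \<alpha>)) \<le> 1"
    and M: "\<forall>n\<in>{3..N}. c\<^sub>0 * \<kappa> ^ M n \<le> \<delta> * min (real n * \<tau>) 1 * inverse (ln (1 + real n))"
    and n: "n \<in> {1..N}"
  shows "L2_norm \<Omega> (\<lambda>x. U n x - u (real n * \<tau>) x) \<le> (4 + 3 * T) / real n * ln (1 + real n) * L2_norm \<Omega> v"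
proof -
  have \<tau>0: "0 < \<tau>" using T N by (simp add: \<tau>)
  have U0: "U 0 = v\<^sub>h" and v\<^sub>hX: "v\<^sub>h \<in> X" using sch by (auto simp: incomplete_scheme_def)
  have st: "exact_step \<Omega> \<T> \<alpha> \<tau> (\<lambda>t x. 0) U k (Ubar k)" if "k \<in> {1..N}" for k
    using sch that unfolding incomplete_scheme_def by blast
  have ex: "U k = Ubar k" if "k \<in> {1..N}" "k \<le> 2" for k
  proof -
    have "k \<in> {1, 2}" using that by auto
    then show ?thesis using sch that unfolding incomplete_scheme_def by blast
  qed
  have it: "W k 0 = (\<lambda>x. 2 * U (k - 1) x - U (k - 2) x)" "W k (M k) \<in> X" "1 \<le> M k" "U k = W k (M k)" if "k \<in> {3..N}" for k
  proof -
    have "k \<in> {1..N} - {1, 2}" "2 \<le> k" using that by auto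
    then show "W k 0 = (\<lambda>x. 2 * U (k - 1) x - U (k - 2) x)" "W k (M k) \<in> X" "1 \<le> M k" "U k = W k (M k)"
      using sch unfolding incomplete_scheme_def by blast+
  qed
  have UbX: "Ubar k \<in> X" if "k \<in> {1..N}" for k using st[OF that] by (simp add: exact_step_def)
  have UX: "U k \<in> X" if "k \<le> N" for k
  proof -
    consider "k = 0" | "1 \<le> k" "k \<le> 2" | "3 \<le> k" by linarith
    then show ?thesis
    proof cases
      case 1
      then show ?thesis using U0 v\<^sub>hX by simp
    next
      case 2
      then show ?thesis using ex[of k] UbX[of k] that by simp
    next
      case 3
      then show ?thesis using it(2,4)[of k] that by simp
    qed
  qed
  define \<mu> where "\<mu> = (\<lambda>i. \<tau> powr \<alpha> * ev i)"
  define x where "x = (\<lambda>k i. ip (U k) (e i))"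
  \<comment> \<open>Set to 0 at level 0, where \<open>Ubar\<close> is unconstrained.\<close>
  define \<epsilon> where "\<epsilon> = (\<lambda>k i. if k = 0 then 0 else x k i - ip (Ubar k) (e i))"
  have \<mu>0: "0 \<le> \<mu> i" if "i < m" for i using ev_nonneg[OF that] by (simp add: \<mu>_def)
  have dX: "(\<lambda>y. U k y - Ubar k y) \<in> X" if "k \<in> {1..N}" for k
    by (rule fun_subspace_diff[OF X_sub UX UbX]) (use that in auto)
  have dc: "ip (\<lambda>y. U k y - Ubar k y) (e i) = \<epsilon> k i" if "k \<in> {1..N}" "i < m" for k i
    using sym_form_diff[OF ip_form UX UbX e_in, of k k i] that by (simp add: \<epsilon>_def x_def)
  have \<epsilon>0: "\<epsilon> k i = 0" if "k \<le> 2" "i < m" "k \<le> N" for k i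
  proof (cases "k = 0")
    case False
    then show ?thesis using ex[of k] that by (simp add: \<epsilon>_def x_def)
  qed (simp add: \<epsilon>_def)
  \<comment> \<open>Also cut off beyond \<open>N\<close>: the scalar theory asks for zero
    perturbation at every level up to 2, even when \<open>N < 2\<close>.\<close>
  define \<epsilon>' where "\<epsilon>' = (\<lambda>k i. if k \<le> N then \<epsilon> k i else 0)"
  have main: "L2_set (\<lambda>i. x n i - x 0 i * mittag_leffler_relax \<alpha> (\<mu> i) (real n)) {..<m}
     \<le> (4 + 3 * T) / real n * ln (1 + real n) * L2_set (x 0) {..<m}"
  proof (rule perturbed_scheme_error[where \<epsilon> = \<epsilon>', OF \<alpha> \<mu>0 T \<tau> _ _ \<delta> _ n])
    show "\<epsilon>' k i = 0" if "k \<le> 2" "i < m" for k i using \<epsilon>0 that by (simp add: \<epsilon>'_def)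
    show "(\<Sum>j=0..k. cq_weight \<alpha> j * (x (k - j) i - x 0 i)) + \<mu> i * x k i = (1 + \<mu> i) * \<epsilon>' k i"
      if i: "i < m" and k: "k \<in> {1..N}" for k i
    proof -
      have c: "(1 + \<mu> i) * ip (Ubar k) (e i) = (\<Sum>j=0..k. cq_weight \<alpha> j * x 0 i) - (\<Sum>j=1..k. cq_weight \<alpha> j * x (k - j) i)"
        unfolding \<mu>_def x_def by (rule exact_step_coef[OF st[OF k] UX _ i]) (use k in auto)
      \<comment> \<open>The leading weight 1 separates the unknown of level \<open>k\<close> from
        the history, so the residual of the scheme is \<open>1 + \<mu> i\<close> times the solver
        error.\<close>
      have b0: "cq_weight \<alpha> 0 = 1" by (simp add: cq_weight_eq)
      have "(\<Sum>j=0..k. cq_weight \<alpha> j * (x (k - j) i - x 0 i)) = (\<Sum>j=0..k. cq_weight \<alpha> j * x (k - j) i) - (\<Sum>j=0..k. cq_weight \<alpha> j * x 0 i)"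
        by (simp add: right_diff_distrib sum_subtractf)
      also have "(\<Sum>j=0..k. cq_weight \<alpha> j * x (k - j) i) = x k i + (\<Sum>j=1..k. cq_weight \<alpha> j * x (k - j) i)"
        by (subst sum.atLeast_Suc_atMost) (simp_all add: b0)
      finally have "(\<Sum>j=0..k. cq_weight \<alpha> j * (x (k - j) i - x 0 i)) = x k i - (1 + \<mu> i) * ip (Ubar k) (e i)"
        using c by simp
      moreover have "\<epsilon>' k i = x k i - ip (Ubar k) (e i)" using k by (simp add: \<epsilon>'_def \<epsilon>_def)
      ultimately show ?thesis by (simp only:) (simp add: algebra_simps)
    qed
    show "L2_set (\<lambda>i. sqrt (1 + \<mu> i) * \<epsilon>' k i) {..<m} \<le> \<delta> * min (real k * \<tau>) 1 * inverse (ln (1 + real k))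
        * L2_set (\<lambda>i. sqrt (1 + \<mu> i) * (2 * x (k - 1) i - x (k - 2) i - (x k i - \<epsilon>' k i))) {..<m}"
      if k: "k \<in> {3..N}" for k
    proof -
      have k1: "k \<in> {1..N}" "k \<in> {1..N} - {1, 2}" "k \<le> N" "k - 1 \<le> N" "k - 2 \<le> N" using k by auto
      define G where "G = (\<lambda>y. W k 0 y - Ubar k y)"
      have W0X: "W k 0 \<in> X"
        unfolding it(1)[OF k] using fun_subspace_lincomb[OF X_sub UX[OF k1(4)] UX[OF k1(5)], of 2 "- 1"] by simp
      have GX: "G \<in> X" unfolding G_def by (rule fun_subspace_diff[OF X_sub W0X UbX[OF k1(1)]])
      have Gc: "ip G (e i) = 2 * x (k - 1) i - x (k - 2) i - (x k i - \<epsilon>' k i)" if i: "i < m" for i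
      proof -
        have "ip G (e i) = ip (W k 0) (e i) - ip (Ubar k) (e i)"
          unfolding G_def by (rule sym_form_diff[OF ip_form W0X UbX[OF k1(1)] e_in[OF i]])
        also have "ip (W k 0) (e i) = 2 * x (k - 1) i - x (k - 2) i"
          unfolding it(1)[OF k] using coef_lincomb[OF UX[OF k1(4)] UX[OF k1(5)] i, of 2 "- 1"] by (simp add: x_def)
        also have "ip (Ubar k) (e i) = x k i - \<epsilon>' k i" using k1 k by (simp add: \<epsilon>'_def \<epsilon>_def)
        finally show ?thesis .
      qed
      have "energy_norm \<Omega> \<T> \<alpha> \<tau> (\<lambda>y. W k (M k) y - Ubar k y) \<le> c\<^sub>0 * \<kappa> ^ M k * energy_norm \<Omega> \<T> \<alpha> \<tau> G"
        using con it(3)[OF k] k1(2) unfolding contraction_property_def G_def by blast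
      then have "energy_norm \<Omega> \<T> \<alpha> \<tau> (\<lambda>y. U k y - Ubar k y) \<le> c\<^sub>0 * \<kappa> ^ M k * energy_norm \<Omega> \<T> \<alpha> \<tau> G"
        by (simp only: it(4)[OF k, symmetric])
      also have "\<dots> \<le> \<delta> * min (real k * \<tau>) 1 * inverse (ln (1 + real k)) * energy_norm \<Omega> \<T> \<alpha> \<tau> G"
        using M k by (intro mult_right_mono) (auto simp: energy_norm_def L2_norm_def L2_inner_nonneg)
      also have "energy_norm \<Omega> \<T> \<alpha> \<tau> G = L2_set (\<lambda>i. sqrt (1 + \<mu> i) * (2 * x (k - 1) i - x (k - 2) i - (x k i - \<epsilon>' k i))) {..<m}"
        unfolding energy_norm_coef[OF GX] by (rule L2_set_cong) (simp_all add: Gc \<mu>_def)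
      also have "energy_norm \<Omega> \<T> \<alpha> \<tau> (\<lambda>y. U k y - Ubar k y) = L2_set (\<lambda>i. sqrt (1 + \<mu> i) * \<epsilon>' k i) {..<m}"
        unfolding energy_norm_coef[OF dX[OF k1(1)]] using k1 by (intro L2_set_cong) (simp_all add: dc \<mu>_def \<epsilon>'_def)
      finally show ?thesis .
    qed
  qed
  have n1: "0 < real n" "n \<le> N" using n by auto
  have uX: "u (real n * \<tau>) \<in> X" using u \<tau>0 by (simp add: semidiscrete_solution_def)
  have "L2_norm \<Omega> (\<lambda>y. U n y - u (real n * \<tau>) y) = L2_set (\<lambda>i. x n i - x 0 i * mittag_leffler_relax \<alpha> (\<mu> i) (real n)) {..<m}"
    unfolding L2_norm_coef[OF fun_subspace_diff[OF X_sub UX[OF n1(2)] uX]]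
  proof (rule L2_set_cong[OF refl])
    fix i assume "i \<in> {..<m}"
    then have i: "i < m" by simp
    show "ip (\<lambda>y. U n y - u (real n * \<tau>) y) (e i) = x n i - x 0 i * mittag_leffler_relax \<alpha> (\<mu> i) (real n)"
      unfolding sym_form_diff[OF ip_form UX[OF n1(2)] uX e_in[OF i]] semidiscrete_coef[OF \<alpha> u \<tau>0 n1(1) i]
      by (simp add: x_def U0 \<mu>_def mult.commute)
  qed
  also note main
  also have "L2_set (x 0) {..<m} = L2_norm \<Omega> v\<^sub>h" unfolding L2_norm_coef[OF v\<^sub>hX] by (simp add: x_def U0)
  also have "(4 + 3 * T) / real n * ln (1 + real n) * L2_norm \<Omega> v\<^sub>h \<le> (4 + 3 * T) / real n * ln (1 + real n) * L2_norm \<Omega> v"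
    unfolding v\<^sub>h using T by (intro mult_left_mono projection_norm[OF v]) auto
  finally show ?thesis .
qed

end

theorem theorem4p2:
  fixes \<Omega> :: "'a::euclidean_space set"
    and \<M> :: "'a set set set"
    and T \<alpha> c\<^sub>0 \<kappa> :: real
  assumes "DIM('a) \<in> {1, 2, 3}"
    and "convex_polyhedral_domain \<Omega>"
    and "0 < T"
    and "0 < \<alpha>" and "\<alpha> < 1"
    and "\<forall>\<T>\<in>\<M>. mesh_of \<Omega> \<T>" and "shape_regular \<M>" and "quasi_uniform \<M>"
    and "0 < c\<^sub>0" and "0 < \<kappa>" and "\<kappa> < 1"
  shows "\<exists>\<delta>>0. \<exists>c>0.
    \<forall>\<T>\<in>\<M>. \<forall>N::nat. \<forall>\<tau>::real. \<forall>v v\<^sub>h u U Ubar W M.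
      1 \<le> N \<longrightarrow> \<tau> = T / real N \<longrightarrow>
      v \<in> L2 \<Omega> \<longrightarrow> v\<^sub>h = L2_projection \<Omega> \<T> v \<longrightarrow>
      semidiscrete_solution \<Omega> \<T> \<alpha> v\<^sub>h u \<longrightarrow>
      incomplete_scheme \<Omega> \<T> \<alpha> \<tau> N (\<lambda>t x. 0) v\<^sub>h {1, 2} U Ubar W M \<longrightarrow>
      contraction_property \<Omega> \<T> \<alpha> \<tau> N {1, 2} c\<^sub>0 \<kappa> Ubar W \<longrightarrow>
      (\<forall>n\<in>{3..N}. c\<^sub>0 * \<kappa> ^ M n
          \<le> \<delta> * min (real n * \<tau>) 1 * inverse (ln (1 + real n * \<tau> / \<tau>))) \<longrightarrow>
      (\<forall>n\<in>{1..N}.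
          L2_norm \<Omega> (\<lambda>x. U n x - u (real n * \<tau>) x)
          \<le> c * \<tau> * inverse (real n * \<tau>) * ln (1 + real n * \<tau> / \<tau>) * L2_norm \<Omega> v)"
proof -
  \<comment> \<open>Built from \<open>sin (pi * \<alpha>)\<close> through
    \<open>diff2_const\<close>. Both constants are fixed before the mesh is chosen, which is
    possible because no bound involved an eigenvalue or the number of modes.\<close>
  define \<delta> where "\<delta> = 1 / (4 * (10 + diff2_const \<alpha>))"
  have "0 \<le> diff2_const \<alpha>" by (simp add: diff2_const_def)
  then have \<delta>: "0 < \<delta>" "\<delta> * (4 * (10 + diff2_const \<alpha>)) \<le> 1" by (auto simp: \<delta>_def)
  have c: "0 < 4 + 3 * T" using assms(3) by simp
  show ?thesis
  proof (rule exI[of _ \<delta>], rule conjI[OF \<delta>(1)], rule exI[of _ "4 + 3 * T"], rule conjI[OF c], intro ballI allI impI)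
    fix \<T> and N :: nat and \<tau> :: real and v v\<^sub>h u U Ubar W M n
    assume \<T>: "\<T> \<in> \<M>" and N: "1 \<le> N" and \<tau>: "\<tau> = T / real N"
      and v: "v \<in> L2 \<Omega>" "v\<^sub>h = L2_projection \<Omega> \<T> v" and u: "semidiscrete_solution \<Omega> \<T> \<alpha> v\<^sub>h u"
      and s: "incomplete_scheme \<Omega> \<T> \<alpha> \<tau> N (\<lambda>t x. 0) v\<^sub>h {1, 2} U Ubar W M"
      and cp: "contraction_property \<Omega> \<T> \<alpha> \<tau> N {1, 2} c\<^sub>0 \<kappa> Ubar W"
      and M: "\<forall>n\<in>{3..N}. c\<^sub>0 * \<kappa> ^ M n \<le> \<delta> * min (real n * \<tau>) 1 * inverse (ln (1 + real n * \<tau> / \<tau>))"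
      and n: "n \<in> {1..N}"
    have mesh: "mesh_of \<Omega> \<T>" using assms(6) \<T> by blast
    obtain m e ev where "fe_eigenbasis \<Omega> \<T> m e ev" using fe_eigenbasis_exists[OF assms(2) mesh] by blast
    then interpret fe_eigenbasis \<Omega> \<T> m e ev .
    have \<tau>0: "0 < \<tau>" using assms(3) N by (simp add: \<tau>)
    have M': "\<forall>n\<in>{3..N}. c\<^sub>0 * \<kappa> ^ M n \<le> \<delta> * min (real n * \<tau>) 1 * inverse (ln (1 + real n))"
      using M \<tau>0 by simp
    have "L2_norm \<Omega> (\<lambda>x. U n x - u (real n * \<tau>) x) \<le> (4 + 3 * T) / real n * ln (1 + real n) * L2_norm \<Omega> v"
      by (rule incomplete_scheme_error[OF assms(4,5,3) N \<tau> v u s cp \<delta> M' n])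
    moreover have "(4 + 3 * T) * \<tau> * inverse (real n * \<tau>) = (4 + 3 * T) / real n"
      using \<tau>0 by (simp add: divide_inverse)
    moreover have "real n * \<tau> / \<tau> = real n" using \<tau>0 by simp
    ultimately show "L2_norm \<Omega> (\<lambda>x. U n x - u (real n * \<tau>) x)
      \<le> (4 + 3 * T) * \<tau> * inverse (real n * \<tau>) * ln (1 + real n * \<tau> / \<tau>) * L2_norm \<Omega> v"
      by (simp only:)
  qed
qed

end
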